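(* Let $1< p < \infty$, $m \in \mathbb{N}$, $0 \le \ell < d$, and $a_0 \in \mathbb{R}$. Let $$t:= \frac{d}{2 \frac dp -m}\qquad\text{and}\qquad \tilde{a}_1:= 2 a_0-m.$$ Suppose $$2d\, \Big(\frac{1}{p}-\frac 12 \Big) < m < \frac dp .$$ Then for any $a_1 < \tilde{a}_1$ there exists a constant $c$ such that $$\|u\cdot v|\mathcal{K}^{m}_{a_1,t} (\mathbb{R}^d,\mathbb{R}^\ell_* )\|\le c \, \|u|\mathcal{K}^{m}_{a_0,p} (\mathbb{R}^d,\mathbb{R}^\ell_* )\| \, \|v|\mathcal{K}^{m}_{a_0,p} (\mathbb{R}^d,\mathbb{R}^\ell_* )\|$$ holds for all $u, v \in \mathcal{K}^{m}_{a_0,p} (\mathbb{R}^d,\mathbb{R}^\ell_* )$.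
   Context: $\mathbb{N}=\{1,2,\dots\}$, $\mathbb{N}_0=\mathbb{N}\cup\{0\}$. For an integer $0\le\ell<d$ put $\mathbb{R}^\ell_*=\{x\in\mathbb{R}^d: x_1=\dots=x_{d-\ell}=0\}$ (so $\mathbb{R}^0_*=\{0\}$) and $\rho(x)=\min\big(1,(\sum_{i=1}^{d-\ell}|x_i|^2)^{1/2}\big)$. For $m\in\mathbb{N}_0$, $a\in\mathbb{R}$, $1\le p<\infty$, the Kondratiev space $\mathcal{K}^m_{a,p}(\mathbb{R}^d,\mathbb{R}^\ell_* )$ consists of all measurable functions $u$ on $\mathbb{R}^d\setminus\mathbb{R}^\ell_*$ having weak derivatives $\partial^\alpha u$, $|\alpha|\le m$, in $\mathbb{R}^d\setminus\mathbb{R}^\ell_*$ with $\|u|\mathcal{K}^m_{a,p}(\mathbb{R}^d,\mathbb{R}^\ell_* )\|=\big(\sum_{|\alpha|\le m}\int_{\mathbb{R}^d\setminus\mathbb{R}^\ell_*}|\rho(x)^{|\alpha|-a}\partial^\alpha u(x)|^p\,dx\big)^{1/p}<\infty$. *)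

theory Defs
  imports "HOL-Analysis.Analysis"
begin

section \<open>Multi-indices, test functions and weak derivatives\<close>

text \<open>A multi-index is a function \<open>'n \<Rightarrow> nat\<close>.  The linear order on the finite index type \<open>'n\<close>
  numbers the coordinates of \<open>real ^ 'n\<close> as \<open>1, \<dots>, CARD('n)\<close>.\<close>

definition coord_number :: "'n::{finite,linorder} \<Rightarrow> nat"
  where "coord_number i = card {j. j \<le> i}"

definition mi_order :: "('n::finite \<Rightarrow> nat) \<Rightarrow> nat"
  where "mi_order \<alpha> = (\<Sum>i\<in>UNIV. \<alpha> i)"

lemma finite_mi_order_le: "finite {\<alpha> :: 'n::finite \<Rightarrow> nat. mi_order \<alpha> \<le> m}"
proof (rule finite_subset)
  show "{\<alpha> :: 'n \<Rightarrow> nat. mi_order \<alpha> \<le> m} \<subseteq> UNIV \<rightarrow>\<^sub>E {..m}"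
  proof
    fix \<alpha> :: "'n \<Rightarrow> nat" assume "\<alpha> \<in> {\<alpha>. mi_order \<alpha> \<le> m}"
    moreover have "\<alpha> i \<le> mi_order \<alpha>" for i
      unfolding mi_order_def by (rule member_le_sum) auto
    ultimately show "\<alpha> \<in> UNIV \<rightarrow>\<^sub>E {..m}"
      by (auto intro: order_trans)
  qed
  show "finite ((UNIV :: 'n set) \<rightarrow>\<^sub>E {..m})"
    by (intro finite_PiE) auto
qed

definition partial_deriv ::
  "'n::finite \<Rightarrow> ((real, 'n) vec \<Rightarrow> 'b::real_normed_vector) \<Rightarrow> (real, 'n) vec \<Rightarrow> 'b"
  where "partial_deriv i f x = vector_derivative (\<lambda>s. f (x + s *\<^sub>R axis i 1)) (at 0)"

text \<open>\<open>mi_deriv \<alpha> f\<close> is the classical derivative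
  \<open>\<partial>\<^sub>1\<^bsup>\<alpha> 1\<^esup> \<dots> \<partial>\<^sub>d\<^bsup>\<alpha> d\<^esup> f\<close>; it is only applied to smooth \<open>f\<close>,
  for which the order of differentiation is immaterial.\<close>

definition mi_deriv ::
  "('n::{finite,linorder} \<Rightarrow> nat) \<Rightarrow> ((real, 'n) vec \<Rightarrow> 'b::real_normed_vector) \<Rightarrow> (real, 'n) vec \<Rightarrow> 'b"
  where "mi_deriv \<alpha> f =
    foldr partial_deriv (concat (map (\<lambda>i. replicate (\<alpha> i) i) (sorted_list_of_set UNIV))) f"

text \<open>All iterated partial derivatives are everywhere Frechet differentiable (hence continuous),
  i.e. \<open>f\<close> is infinitely often continuously differentiable.\<close>

definition smooth :: "((real, 'n::finite) vec \<Rightarrow> 'b::real_normed_vector) \<Rightarrow> bool"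
  where "smooth f \<longleftrightarrow> (\<forall>is x. foldr partial_deriv is f differentiable (at x))"

definition test_functions :: "(real, 'n::finite) vec set \<Rightarrow> ((real, 'n) vec \<Rightarrow> real) set"
  where "test_functions \<Omega> =
    {\<phi>. smooth \<phi> \<and> (\<exists>K. compact K \<and> K \<subseteq> \<Omega> \<and> (\<forall>x. x \<notin> K \<longrightarrow> \<phi> x = 0))}"

definition locally_integrable ::
  "(real, 'n::finite) vec set \<Rightarrow> ((real, 'n) vec \<Rightarrow> 'b::{banach,second_countable_topology}) \<Rightarrow> bool"
  where "locally_integrable \<Omega> u \<longleftrightarrow>
    (\<forall>K. compact K \<and> K \<subseteq> \<Omega> \<longrightarrow> set_integrable lebesgue K u)"

definition has_weak_deriv ::
  "(real, 'n::{finite,linorder}) vec set \<Rightarrow> ('n \<Rightarrow> nat) \<Rightarrow>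
    ((real, 'n) vec \<Rightarrow> 'b::{banach,second_countable_topology}) \<Rightarrow> ((real, 'n) vec \<Rightarrow> 'b) \<Rightarrow> bool"
  where "has_weak_deriv \<Omega> \<alpha> u w \<longleftrightarrow>
    locally_integrable \<Omega> u \<and> locally_integrable \<Omega> w \<and>
    (\<forall>\<phi>\<in>test_functions \<Omega>.
       (LINT x:\<Omega>|lebesgue. mi_deriv \<alpha> \<phi> x *\<^sub>R u x) =
       (- 1) ^ mi_order \<alpha> *\<^sub>R (LINT x:\<Omega>|lebesgue. \<phi> x *\<^sub>R w x))"

text \<open>A weak derivative on an open set is unique up to a null set, so the choice below
  does not affect integrals over \<open>\<Omega>\<close>.\<close>

definition weak_deriv ::
  "(real, 'n::{finite,linorder}) vec set \<Rightarrow> ('n \<Rightarrow> nat) \<Rightarrow>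
    ((real, 'n) vec \<Rightarrow> 'b::{banach,second_countable_topology}) \<Rightarrow> ((real, 'n) vec \<Rightarrow> 'b)"
  where "weak_deriv \<Omega> \<alpha> u = (SOME w. has_weak_deriv \<Omega> \<alpha> u w)"

section \<open>Kondratiev spaces\<close>

definition singular_set :: "nat \<Rightarrow> (real, 'n::{finite,linorder}) vec set"
  where "singular_set l = {x. \<forall>i. coord_number i \<le> CARD('n) - l \<longrightarrow> x $ i = 0}"

definition rho :: "nat \<Rightarrow> (real, 'n::{finite,linorder}) vec \<Rightarrow> real"
  where "rho l x = min 1 (sqrt (\<Sum>i | coord_number i \<le> CARD('n) - l. \<bar>x $ i\<bar>\<^sup>2))"

definition kondratiev_integral ::
  "nat \<Rightarrow> nat \<Rightarrow> real \<Rightarrow> real \<Rightarrow>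
    ((real, 'n::{finite,linorder}) vec \<Rightarrow> 'b::{banach,second_countable_topology}) \<Rightarrow> ennreal"
  where "kondratiev_integral l m a p u =
    (\<Sum>\<alpha> | mi_order \<alpha> \<le> m. \<integral>\<^sup>+x\<in>- singular_set l.
       ennreal (norm (rho l x powr (real (mi_order \<alpha>) - a) *\<^sub>R
                      weak_deriv (- singular_set l) \<alpha> u x) powr p) \<partial>lebesgue)"

text \<open>Only the values of \<open>u\<close> off the singular set matter.\<close>

definition kondratiev_space ::
  "nat \<Rightarrow> nat \<Rightarrow> real \<Rightarrow> real \<Rightarrow>
    ((real, 'n::{finite,linorder}) vec \<Rightarrow> 'b::{banach,second_countable_topology}) set"
  where "kondratiev_space l m a p =
    {u. u \<in> borel_measurable (lebesgue_on (- singular_set l)) \<and>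
        (\<forall>\<alpha>. mi_order \<alpha> \<le> m \<longrightarrow> (\<exists>w. has_weak_deriv (- singular_set l) \<alpha> u w)) \<and>
        kondratiev_integral l m a p u < \<infinity>}"

text \<open>Meaningful for members of \<open>kondratiev_space l m a p\<close> only.\<close>

definition kondratiev_norm ::
  "nat \<Rightarrow> nat \<Rightarrow> real \<Rightarrow> real \<Rightarrow>
    ((real, 'n::{finite,linorder}) vec \<Rightarrow> 'b::{banach,second_countable_topology}) \<Rightarrow> real"
  where "kondratiev_norm l m a p u = enn2real (kondratiev_integral l m a p u) powr (1 / p)"

end

theory Submission
  imports Defs
begin

text \<open>Put \<open>q\<^sub>j\<close> with \<open>1 / q\<^sub>j = 1 / p - j / d\<close>.  A weighted form of the endpoint Sobolev inequality on the
  complement of the singular set (the Gagliardo--Nirenberg--Sobolev inequality applied to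
  \<open>\<rho>\<^sup>b f\<close>, so that the term with the derivative of the weight is controlled by \<open>\<rho>\<close> to the power
  \<open>b - 1\<close> times \<open>f\<close>) gives, by iteration, that \<open>\<rho>\<close> to the power \<open>|\<beta>| + j - a\<^sub>0\<close> times
  \<open>\<partial>\<^sup>\<beta> u\<close> is in the Lebesgue space with exponent \<open>q\<^sub>j\<close> whenever \<open>|\<beta>| + j \<le> m\<close>.  By the
  Leibniz rule it remains to estimate \<open>\<partial>\<^sup>\<beta> u \<partial>\<^sup>\<gamma> v\<close> with \<open>|\<beta>| + |\<gamma>| \<le> m\<close>; use
  Hoelder's inequality with \<open>q\<^sub>i\<close> and \<open>q\<^sub>j\<close> for \<open>i = m - |\<beta>|\<close> and \<open>j = |\<beta>|\<close>, since
  \<open>1 / q\<^sub>i + 1 / q\<^sub>j = 2 / p - m / d = 1 / t\<close>.  The condition \<open>t > 1\<close> is what makes these products locally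
  integrable and the Leibniz rule, proved by mollifying one factor, available.\<close>

section \<open>Real powers of extended nonnegative reals and Hoelder's inequality\<close>

text \<open>The domain and the weight enter only through cutoffs of powers of \<open>rho\<close>
  which vanish near the singular set and far out, and whose gradients are bounded, uniformly in the
  cutoff parameter, by the next lower power of \<open>rho\<close>. The Sobolev inequality in use is
  homogeneous, so no covering of the domain is needed, and Fatou's lemma removes the cutoff. The
  upper bound on m keeps 1/q_j positive up to j = m; hence every step of the iteration starts from
  an exponent below d. With the Hoelder exponents of the overview the powers of \<open>rho\<close>
  add up to |\<beta>| + |\<gamma>| - (2 a0 - m), whatever \<beta> and \<gamma> are. As
  \<open>rho\<close> is at most 1, lowering 2 a0 - m to a1 can only decrease the left-hand side.
  Constants must be found before u and v are given. Therefore the terms of the Leibniz formula are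
  fixed as a list depending on \<alpha> alone, and the norm estimates are inequalities in
  \<open>ennreal\<close> between integrals, with the data bounded by a free parameter that may be
  \<open>top\<close>.\<close>

text \<open>In contrast to \<^const>\<open>powr\<close>, the convention is \<open>0\<^sup>0 = 1\<close>.\<close>

definition epowr :: "ennreal \<Rightarrow> real \<Rightarrow> ennreal"
  where "epowr x a = (if a = 0 then 1 else if x = top then top else ennreal (enn2real x powr a))"

lemma epowr_zero_right [simp]: "epowr x 0 = 1"
  by (simp add: epowr_def)

lemma epowr_one [simp]: "epowr 1 a = 1"
  by (simp add: epowr_def)

lemma epowr_one_right [simp]: "epowr x 1 = x"
  by (cases x) (auto simp: epowr_def powr_one)

lemma epowr_top [simp]: "a \<noteq> 0 \<Longrightarrow> epowr top a = top"
  by (simp add: epowr_def)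

lemma epowr_zero [simp]: "a \<noteq> 0 \<Longrightarrow> epowr 0 a = 0"
  by (simp add: epowr_def)

lemma epowr_ennreal: "0 \<le> r \<Longrightarrow> a \<noteq> 0 \<Longrightarrow> epowr (ennreal r) a = ennreal (r powr a)"
  by (simp add: epowr_def)

lemma epowr_ennreal_pos: "0 \<le> r \<Longrightarrow> 0 < a \<Longrightarrow> epowr (ennreal r) a = ennreal (r powr a)"
  by (simp add: epowr_def)

lemma epowr_eq_0_iff: "epowr x a = 0 \<longleftrightarrow> a \<noteq> 0 \<and> x = 0"
  by (cases x) (auto simp: epowr_def ennreal_eq_0_iff)

lemma epowr_eq_top_iff: "epowr x a = top \<longleftrightarrow> a \<noteq> 0 \<and> x = top"
  by (cases x) (auto simp: epowr_def)

lemma epowr_mult: "0 \<le> a \<Longrightarrow> epowr (x * y) a = epowr x a * epowr y a"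
proof (cases "a = 0")
  case False
  assume a: "0 \<le> a"
  show ?thesis
  proof (cases "x = top \<or> y = top")
    case True
    then show ?thesis
      using False by (auto simp: ennreal_mult_top ennreal_top_mult epowr_eq_0_iff)
  next
    case xy: False
    then obtain r s where "x = ennreal r" "y = ennreal s" "0 \<le> r" "0 \<le> s"
      by (metis ennreal_cases)
    then show ?thesis
      using False by (simp add: epowr_ennreal powr_mult flip: ennreal_mult)
  qed
qed simp

lemma epowr_add: "0 \<le> a \<Longrightarrow> 0 \<le> b \<Longrightarrow> epowr x (a + b) = epowr x a * epowr x b"
  by (cases "a = 0"; cases "b = 0"; cases x)
     (auto simp: epowr_ennreal powr_add ennreal_mult' ennreal_top_mult add_nonneg_eq_0_iff)

lemma epowr_epowr: "0 \<le> a \<Longrightarrow> 0 \<le> b \<Longrightarrow> epowr (epowr x a) b = epowr x (a * b)"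
  by (cases "a = 0"; cases "b = 0"; cases x) (auto simp: epowr_ennreal powr_powr)

lemma epowr_mono: "x \<le> y \<Longrightarrow> 0 \<le> a \<Longrightarrow> epowr x a \<le> epowr y a"
  by (cases "a = 0"; cases x; cases y) (auto simp: epowr_ennreal top_unique intro!: ennreal_leI powr_mono2)

lemma borel_measurable_epowr [measurable (raw)]:
  assumes [measurable]: "f \<in> borel_measurable M"
  shows "(\<lambda>x. epowr (f x) a) \<in> borel_measurable M"
proof (cases "a = 0")
  case False
  then have "(\<lambda>x. epowr (f x) a) = (\<lambda>x. if f x = top then top else ennreal (enn2real (f x) powr a))"
    by (simp add: epowr_def)
  then show ?thesis
    by simp
qed simp

text \<open>Jensen's inequality for \<open>exp\<close> at the points \<open>ln (y j)\<close>. A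
  vanishing \<open>y j\<close> is split off, since then the product is 0.\<close>

lemma weighted_AM_GM:
  fixes y w :: "'i \<Rightarrow> real"
  assumes "finite J" "(\<Sum>j\<in>J. w j) = 1" "\<And>j. j \<in> J \<Longrightarrow> 0 < w j" "\<And>j. j \<in> J \<Longrightarrow> 0 \<le> y j"
  shows "(\<Prod>j\<in>J. y j powr w j) \<le> (\<Sum>j\<in>J. w j * y j)"
proof (cases "\<exists>j\<in>J. y j = 0")
  case True
  then have "(\<Prod>j\<in>J. y j powr w j) = 0"
    using assms(1) by auto
  moreover have "0 \<le> (\<Sum>j\<in>J. w j * y j)"
    using assms by (intro sum_nonneg mult_nonneg_nonneg) (auto simp: less_imp_le)
  ultimately show ?thesis
    by simp
next
  case False
  then have pos: "0 < y j" if "j \<in> J" for j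
    using assms(4)[OF that] that by (metis order_le_less)
  have "J \<noteq> {}"
    using assms(2) by auto
  then have "exp (\<Sum>j\<in>J. w j *\<^sub>R ln (y j)) \<le> (\<Sum>j\<in>J. w j * exp (ln (y j)))"
    using assms by (intro convex_on_sum[OF _ _ exp_convex]) (auto simp: less_imp_le)
  also have "exp (\<Sum>j\<in>J. w j *\<^sub>R ln (y j)) = (\<Prod>j\<in>J. y j powr w j)"
    using assms(1) pos by (simp add: exp_sum powr_def less_imp_neq[THEN not_sym])
  also have "(\<Sum>j\<in>J. w j * exp (ln (y j))) = (\<Sum>j\<in>J. w j * y j)"
    by (rule sum.cong) (auto simp: pos)
  finally show ?thesis .
qed

text \<open>Divide each \<open>f j\<close> by its integral, apply the weighted AM-GM inequality
  pointwise and integrate: the right-hand side becomes the sum of the weights, which is 1. This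
  needs all integrals to lie strictly between 0 and \<open>top\<close>; a zero integral makes the
  product vanish a.e., and an infinite one, with none equal to 0, makes the bound trivial.\<close>

lemma nn_integral_Hoelder:
  fixes f :: "'i \<Rightarrow> 'a \<Rightarrow> ennreal" and w :: "'i \<Rightarrow> real"
  assumes fin: "finite J" and w1: "(\<Sum>j\<in>J. w j) = 1" and w0: "\<And>j. j \<in> J \<Longrightarrow> 0 \<le> w j"
    and [measurable]: "\<And>j. j \<in> J \<Longrightarrow> f j \<in> borel_measurable M"
  shows "(\<integral>\<^sup>+x. (\<Prod>j\<in>J. epowr (f j x) (w j)) \<partial>M) \<le> (\<Prod>j\<in>J. epowr (\<integral>\<^sup>+x. f j x \<partial>M) (w j))"
proof -
  \<comment> \<open>Indices of weight 0 contribute the factor 1 on both sides, even when the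
    integral is 0 or \<open>top\<close>; on \<open>K\<close> all weights are positive.\<close>
  define K where "K = {j\<in>J. w j \<noteq> 0}"
  define A where "A j = (\<integral>\<^sup>+x. f j x \<partial>M)" for j
  have K: "finite K" "K \<subseteq> J" "\<And>j. j \<in> K \<Longrightarrow> 0 < w j" "(\<Sum>j\<in>K. w j) = 1"
  proof -
    show "finite K" "K \<subseteq> J"
      using fin by (auto simp: K_def)
    show "0 < w j" if "j \<in> K" for j
      using w0[of j] that by (auto simp: K_def)
    have "(\<Sum>j\<in>K. w j) = (\<Sum>j\<in>J. w j)"
      using fin by (intro sum.mono_neutral_left) (auto simp: K_def)
    then show "(\<Sum>j\<in>K. w j) = 1"
      using w1 by simp
  qed
  have [measurable]: "\<And>j. j \<in> K \<Longrightarrow> f j \<in> borel_measurable M"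
    using K by auto
  have JK: "(\<Prod>j\<in>J. epowr (g j) (w j)) = (\<Prod>j\<in>K. epowr (g j) (w j))" for g
    using fin by (intro prod.mono_neutral_right) (auto simp: K_def)
  consider (zero) j where "j \<in> K" "A j = 0" | (top) j where "j \<in> K" "A j = top" "\<forall>i\<in>K. A i \<noteq> 0"
    | (fin) "\<And>j. j \<in> K \<Longrightarrow> A j \<noteq> 0 \<and> A j \<noteq> top"
    by blast
  then have "(\<integral>\<^sup>+x. (\<Prod>j\<in>K. epowr (f j x) (w j)) \<partial>M) \<le> (\<Prod>j\<in>K. epowr (A j) (w j))"
  proof cases
    case zero
    have "AE x in M. f j x = 0"
      using zero by (subst (asm) A_def, subst (asm) nn_integral_0_iff_AE) auto
    then have "AE x in M. (\<Prod>j\<in>K. epowr (f j x) (w j)) = 0"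
    proof eventually_elim
      case (elim x)
      have "\<exists>i\<in>K. epowr (f i x) (w i) = 0"
        using elim zero K(3)[of j] by (intro bexI[of _ j]) (auto simp: epowr_eq_0_iff)
      then show ?case
        using K(1) by (meson prod_zero)
    qed
    then have "(\<integral>\<^sup>+x. (\<Prod>j\<in>K. epowr (f j x) (w j)) \<partial>M) = (\<integral>\<^sup>+x. 0 \<partial>M)"
      by (rule nn_integral_cong_AE)
    then show ?thesis
      by simp
  next
    case top
    have "(\<Prod>j\<in>K. epowr (A j) (w j)) = top"
      using top K(1,3) by (subst ennreal_prod_eq_top) (force simp: epowr_eq_0_iff epowr_eq_top_iff)
    then show ?thesis
      by simp
  next
    case fin
    have "(\<integral>\<^sup>+x. (\<Prod>j\<in>K. epowr (f j x) (w j)) \<partial>M)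
        \<le> (\<integral>\<^sup>+x. (\<Prod>j\<in>K. epowr (A j) (w j)) * (\<Sum>j\<in>K. ennreal (w j) * (f j x / A j)) \<partial>M)"
    proof (rule nn_integral_mono)
      fix x
      show "(\<Prod>j\<in>K. epowr (f j x) (w j))
          \<le> (\<Prod>j\<in>K. epowr (A j) (w j)) * (\<Sum>j\<in>K. ennreal (w j) * (f j x / A j))"
      proof (cases "\<exists>j\<in>K. f j x = top")
        case True
        then obtain j where j: "j \<in> K" "f j x = top" by auto
        have "ennreal (w j) * (f j x / A j) = top"
          using j fin[OF j(1)] K(3)[OF j(1)] by (simp add: ennreal_top_divide ennreal_mult_top)
        then have "(\<Sum>j\<in>K. ennreal (w j) * (f j x / A j)) = top"
          using j K(1) by (auto simp: ennreal_sum_eq_top intro!: bexI[of _ j])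
        moreover have "(\<Prod>j\<in>K. epowr (A j) (w j)) \<noteq> 0"
          using K(1) fin by (induction K rule: finite_induct) (auto simp: epowr_eq_0_iff)
        ultimately have "(\<Prod>j\<in>K. epowr (A j) (w j)) * (\<Sum>j\<in>K. ennreal (w j) * (f j x / A j)) = top"
          by (simp only: ennreal_mult_top) simp
        then show ?thesis
          by (metis top_greatest)
      next
        case False
        define a r where "a j = enn2real (A j)" and "r j = enn2real (f j x)" for j
        have a: "A j = ennreal (a j)" "0 < a j" if "j \<in> K" for j
          using fin[OF that] by (auto simp: a_def less_top enn2real_positive_iff zero_less_iff_neq_zero)
        have r: "f j x = ennreal (r j)" "0 \<le> r j" if "j \<in> K" for j
          using False that by (auto simp: r_def less_top)
        have "(\<Prod>j\<in>K. epowr (f j x) (w j)) = (\<Prod>j\<in>K. ennreal (r j powr w j))"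
          using r K(3) by (intro prod.cong) (auto simp: epowr_ennreal_pos)
        also have "\<dots> = ennreal (\<Prod>j\<in>K. r j powr w j)"
          by (simp add: prod_ennreal)
        also have "(\<Prod>j\<in>K. r j powr w j) = (\<Prod>j\<in>K. a j powr w j) * (\<Prod>j\<in>K. (r j / a j) powr w j)"
          unfolding prod.distrib[symmetric]
        proof (intro prod.cong refl)
          fix j assume "j \<in> K"
          then show "r j powr w j = a j powr w j * (r j / a j) powr w j"
            using a(2)[of j] r(2)[of j] by (simp add: powr_divide)
        qed
        also have "\<dots> \<le> (\<Prod>j\<in>K. a j powr w j) * (\<Sum>j\<in>K. w j * (r j / a j))"
          using a r K by (intro mult_left_mono weighted_AM_GM prod_nonneg) (auto simp: less_imp_le)
        also have "ennreal \<dots> = (\<Prod>j\<in>K. ennreal (a j powr w j)) * (\<Sum>j\<in>K. ennreal (w j * (r j / a j)))"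
          using a r K
          by (subst ennreal_mult) (auto intro!: prod_nonneg sum_nonneg simp: less_imp_le prod_ennreal sum_ennreal)
        also have "(\<Prod>j\<in>K. ennreal (a j powr w j)) = (\<Prod>j\<in>K. epowr (A j) (w j))"
          using a K(3) by (intro prod.cong) (auto simp: epowr_ennreal_pos less_imp_le)
        also have "(\<Sum>j\<in>K. ennreal (w j * (r j / a j))) = (\<Sum>j\<in>K. ennreal (w j) * (f j x / A j))"
        proof (intro sum.cong refl)
          fix j assume j: "j \<in> K"
          have "ennreal (w j * (r j / a j)) = ennreal (w j) * ennreal (r j / a j)"
            using a(2)[OF j] r(2)[OF j] K(3)[OF j] by (intro ennreal_mult) auto
          then show "ennreal (w j * (r j / a j)) = ennreal (w j) * (f j x / A j)"
            using a[OF j] r[OF j] by (simp add: divide_ennreal)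
        qed
        finally show ?thesis
          by (simp add: ennreal_leI)
      qed
    qed
    also have "\<dots> = (\<Prod>j\<in>K. epowr (A j) (w j)) * (\<Sum>j\<in>K. ennreal (w j) * (A j / A j))"
      by (simp add: nn_integral_cmult nn_integral_sum nn_integral_divide A_def)
    also have "(\<Sum>j\<in>K. ennreal (w j) * (A j / A j)) = (\<Sum>j\<in>K. ennreal (w j))"
      using fin by (intro sum.cong) (auto simp: ennreal_divide_self less_top)
    also have "\<dots> = 1"
      using K by (simp add: sum_ennreal less_imp_le)
    finally show ?thesis
      by simp
  qed
  then show ?thesis
    unfolding JK A_def .
qed

lemma nn_integral_Hoelder2:
  assumes [measurable]: "f \<in> borel_measurable M" "g \<in> borel_measurable M"
    and "0 \<le> v" "0 \<le> w" "v + w = 1"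
  shows "(\<integral>\<^sup>+x. epowr (f x) v * epowr (g x) w \<partial>M) \<le> epowr (\<integral>\<^sup>+x. f x \<partial>M) v * epowr (\<integral>\<^sup>+x. g x \<partial>M) w"
  using nn_integral_Hoelder[of UNIV "\<lambda>b. if b then v else w" "\<lambda>b. if b then f else g" M] assms
  by (simp add: UNIV_bool mult.commute add.commute)

section \<open>The Gagliardo--Nirenberg--Sobolev inequality\<close>

lemma (in product_sigma_finite) measurable_marginal:
  assumes j: "j \<in> J" and f: "f \<in> borel_measurable (Pi\<^sub>M J M)"
  shows "(\<lambda>x. \<integral>\<^sup>+y. f (x(j := y)) \<partial>M j) \<in> borel_measurable (Pi\<^sub>M J M)"
proof -
  interpret Mj: sigma_finite_measure "M j" by (rule sigma_finite_measures)
  have "(\<lambda>z. (fst z)(j := snd z)) \<in> Pi\<^sub>M J M \<Otimes>\<^sub>M M j \<rightarrow>\<^sub>M Pi\<^sub>M J M"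
    using j by (intro measurable_fun_upd[of J J]) auto
  from measurable_compose[OF this f]
  have [measurable]: "(\<lambda>(x, y). f (x(j := y))) \<in> borel_measurable (Pi\<^sub>M J M \<Otimes>\<^sub>M M j)"
    by (simp add: split_beta')
  show ?thesis
    by measurable
qed

text \<open>Integrating the inequality over one coordinate at a time, Hoelder's inequality turns the
  left-hand side for \<open>f\<close> into the same expression for the marginal of \<open>f\<close>.  For \<open>c = 1 / (card I - 1)\<close>
  the first factor disappears.\<close>

lemma (in product_sigma_finite) nn_integral_prod_marginals_le:
  assumes "finite I" "0 \<le> c" "(real (card I) - 1) * c \<le> 1"
    and "f \<in> borel_measurable (Pi\<^sub>M I M)"
  shows "(\<integral>\<^sup>+x. epowr (f x) (1 - (real (card I) - 1) * c) *
            (\<Prod>i\<in>I. epowr (\<integral>\<^sup>+y. f (x(i := y)) \<partial>M i) c) \<partial>Pi\<^sub>M I M)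
       \<le> epowr (\<integral>\<^sup>+x. f x \<partial>Pi\<^sub>M I M) (1 + c)"
  using assms(1,3,4)
proof (induction I arbitrary: f rule: finite_induct)
  case empty
  show ?case
    by (simp add: nn_integral_empty)
next
  case (insert i I f)
  note [measurable] = insert.prems(2)
  have [simp]: "finite I" "i \<notin> I"
    by fact+
  define k where "k = real (card I)"
  have kc: "k * c \<le> 1" "0 \<le> k"
    using insert.prems insert.hyps by (auto simp: k_def)
  define g where "g x = (\<integral>\<^sup>+y. f (x(i := y)) \<partial>M i)" for x
  interpret Mi: sigma_finite_measure "M j" for j by (rule sigma_finite_measures)
  have [measurable]: "g \<in> borel_measurable (Pi\<^sub>M I M)"
    unfolding g_def by measurable
  have "(\<integral>\<^sup>+x. epowr (f x) (1 - (real (card (insert i I)) - 1) * c) *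
            (\<Prod>j\<in>insert i I. epowr (\<integral>\<^sup>+y. f (x(j := y)) \<partial>M j) c) \<partial>Pi\<^sub>M (insert i I) M)
      = (\<integral>\<^sup>+x. \<integral>\<^sup>+z. epowr (f (x(i := z))) (1 - k * c) *
            (\<Prod>j\<in>insert i I. epowr (\<integral>\<^sup>+y. f (x(i := z, j := y)) \<partial>M j) c) \<partial>M i \<partial>Pi\<^sub>M I M)"
    by (subst product_nn_integral_insert)
       (auto simp: k_def intro!: borel_measurable_times_ennreal borel_measurable_prod_ennreal borel_measurable_epowr measurable_marginal)
  also have "\<dots> \<le> (\<integral>\<^sup>+x. epowr (g x) (1 - (k - 1) * c) *
            (\<Prod>j\<in>I. epowr (\<integral>\<^sup>+y. g (x(j := y)) \<partial>M j) c) \<partial>Pi\<^sub>M I M)"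
  proof (rule nn_integral_mono)
    fix x assume [measurable, simp]: "x \<in> space (Pi\<^sub>M I M)"
    have upd: "(\<lambda>z. x(i := z)) \<in> M i \<rightarrow>\<^sub>M Pi\<^sub>M (insert i I) M"
      by measurable
    have [measurable]: "(\<lambda>z. \<integral>\<^sup>+y. f (x(i := z, j := y)) \<partial>M j) \<in> borel_measurable (M i)" if "j \<in> I" for j
      using measurable_compose[OF upd measurable_marginal[of j "insert i I" f]] that by simp
    \<comment> \<open>Hoelder in the single variable \<open>z\<close> for \<open>card I + 1\<close>
      functions: weight \<open>1 - k * c\<close> for \<open>f\<close> itself and weight
      \<open>c\<close> for each of the \<open>k\<close> marginals, in total 1.\<close>
    have "(\<integral>\<^sup>+z. epowr (f (x(i := z))) (1 - k * c) *
            (\<Prod>j\<in>I. epowr (\<integral>\<^sup>+y. f (x(i := z, j := y)) \<partial>M j) c) \<partial>M i)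
       = (\<integral>\<^sup>+z. (\<Prod>j\<in>insert i I. epowr (if j = i then f (x(i := z)) else \<integral>\<^sup>+y. f (x(i := z, j := y)) \<partial>M j)
             (if j = i then 1 - k * c else c)) \<partial>M i)"
      by (intro nn_integral_cong) (auto intro!: arg_cong2[where f="(*)"] prod.cong)
    also have "\<dots> \<le> (\<Prod>j\<in>insert i I. epowr (\<integral>\<^sup>+z. (if j = i then f (x(i := z)) else \<integral>\<^sup>+y. f (x(i := z, j := y)) \<partial>M j) \<partial>M i)
             (if j = i then 1 - k * c else c))"
    proof (rule nn_integral_Hoelder)
      have "(\<Sum>j\<in>I. if j = i then 1 - k * c else c) = (\<Sum>j\<in>I. c)"
        by (intro sum.cong) auto
      then show "(\<Sum>j\<in>insert i I. if j = i then 1 - k * c else c) = 1"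
        by (simp add: k_def)
    next
      fix j assume "j \<in> insert i I"
      then show "(\<lambda>z. if j = i then f (x(i := z)) else \<integral>\<^sup>+y. f (x(i := z, j := y)) \<partial>M j) \<in> borel_measurable (M i)"
        by (cases "j = i") auto
    qed (use kc \<open>0 \<le> c\<close> in auto)
    also have "\<dots> = epowr (g x) (1 - k * c) * (\<Prod>j\<in>I. epowr (\<integral>\<^sup>+z. \<integral>\<^sup>+y. f (x(i := z, j := y)) \<partial>M j \<partial>M i) c)"
      by (auto simp: g_def intro!: arg_cong2[where f="(*)"] prod.cong)
    also have "(\<Prod>j\<in>I. epowr (\<integral>\<^sup>+z. \<integral>\<^sup>+y. f (x(i := z, j := y)) \<partial>M j \<partial>M i) c)
        = (\<Prod>j\<in>I. epowr (\<integral>\<^sup>+y. g (x(j := y)) \<partial>M j) c)"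
    proof (rule prod.cong[OF refl])
      fix j assume j: "j \<in> I"
      interpret P: pair_sigma_finite "M i" "M j" ..
      have "(\<lambda>z. x(i := fst z, j := snd z)) \<in> M i \<Otimes>\<^sub>M M j \<rightarrow>\<^sub>M Pi\<^sub>M (insert i I) M"
        using j by (intro measurable_fun_upd[of _ "insert i I"] measurable_fun_upd[of _ I]) auto
      then have [measurable]: "(\<lambda>(z, y). f (x(i := z, j := y))) \<in> borel_measurable (M i \<Otimes>\<^sub>M M j)"
        using measurable_compose[OF _ insert.prems(2)] by (simp add: split_beta')
      have "i \<noteq> j"
        using j insert.hyps(2) by blast
      have "(\<integral>\<^sup>+z. \<integral>\<^sup>+y. f (x(i := z, j := y)) \<partial>M j \<partial>M i) = (\<integral>\<^sup>+y. \<integral>\<^sup>+z. f (x(i := z, j := y)) \<partial>M i \<partial>M j)"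
        by (rule P.Fubini'[symmetric]) measurable
      also have "\<dots> = (\<integral>\<^sup>+y. g (x(j := y)) \<partial>M j)"
        by (simp add: g_def fun_upd_twist[OF \<open>i \<noteq> j\<close>])
      finally show "epowr (\<integral>\<^sup>+z. \<integral>\<^sup>+y. f (x(i := z, j := y)) \<partial>M j \<partial>M i) c = epowr (\<integral>\<^sup>+y. g (x(j := y)) \<partial>M j) c"
        by simp
    qed
    finally have le: "(\<integral>\<^sup>+z. epowr (f (x(i := z))) (1 - k * c) *
            (\<Prod>j\<in>I. epowr (\<integral>\<^sup>+y. f (x(i := z, j := y)) \<partial>M j) c) \<partial>M i)
        \<le> epowr (g x) (1 - k * c) * (\<Prod>j\<in>I. epowr (\<integral>\<^sup>+y. g (x(j := y)) \<partial>M j) c)" .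
    \<comment> \<open>The marginal in direction \<open>i\<close> does not depend on
      \<open>z\<close>. It leaves the integral as \<open>epowr (g x) c\<close> and merges with
      \<open>epowr (g x) (1 - k * c)\<close> to the exponent that the induction hypothesis asks
      for.\<close>
    have "(\<integral>\<^sup>+z. epowr (f (x(i := z))) (1 - k * c) *
            (\<Prod>j\<in>insert i I. epowr (\<integral>\<^sup>+y. f (x(i := z, j := y)) \<partial>M j) c) \<partial>M i)
        = (\<integral>\<^sup>+z. epowr (g x) c * (epowr (f (x(i := z))) (1 - k * c) *
            (\<Prod>j\<in>I. epowr (\<integral>\<^sup>+y. f (x(i := z, j := y)) \<partial>M j) c)) \<partial>M i)"
      by (simp add: g_def ac_simps)
    also have "\<dots> = epowr (g x) c * (\<integral>\<^sup>+z. epowr (f (x(i := z))) (1 - k * c) *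
            (\<Prod>j\<in>I. epowr (\<integral>\<^sup>+y. f (x(i := z, j := y)) \<partial>M j) c) \<partial>M i)"
      by (rule nn_integral_cmult) measurable
    also have "\<dots> \<le> epowr (g x) c * (epowr (g x) (1 - k * c) * (\<Prod>j\<in>I. epowr (\<integral>\<^sup>+y. g (x(j := y)) \<partial>M j) c))"
      by (rule mult_left_mono[OF le]) simp
    also have "\<dots> = epowr (g x) (c + (1 - k * c)) * (\<Prod>j\<in>I. epowr (\<integral>\<^sup>+y. g (x(j := y)) \<partial>M j) c)"
      using kc \<open>0 \<le> c\<close> by (subst epowr_add) (auto simp: mult.assoc)
    also have "c + (1 - k * c) = 1 - (k - 1) * c"
      by (simp add: algebra_simps)
    finally show "(\<integral>\<^sup>+z. epowr (f (x(i := z))) (1 - k * c) *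
            (\<Prod>j\<in>insert i I. epowr (\<integral>\<^sup>+y. f (x(i := z, j := y)) \<partial>M j) c) \<partial>M i)
        \<le> epowr (g x) (1 - (k - 1) * c) * (\<Prod>j\<in>I. epowr (\<integral>\<^sup>+y. g (x(j := y)) \<partial>M j) c)" .
  qed
  also have "\<dots> \<le> epowr (\<integral>\<^sup>+x. g x \<partial>Pi\<^sub>M I M) (1 + c)"
    unfolding k_def using kc \<open>0 \<le> c\<close>
    by (intro insert.IH) (auto simp: k_def algebra_simps)
  also have "(\<integral>\<^sup>+x. g x \<partial>Pi\<^sub>M I M) = (\<integral>\<^sup>+x. f x \<partial>Pi\<^sub>M (insert i I) M)"
    unfolding g_def by (subst product_nn_integral_insert) auto
  finally show ?case .
qed

section \<open>Derivatives along coordinate lines and the inequality for powers of the norm\<close>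

lemma has_derivative_imp_partial_deriv:
  assumes "(g has_derivative D) (at x)"
  shows "partial_deriv i g x = D (axis i 1)"
proof -
  interpret D: bounded_linear D
    using assms by (rule has_derivative_bounded_linear)
  have "((\<lambda>s. x + s *\<^sub>R axis i 1) has_derivative (\<lambda>s. s *\<^sub>R axis i 1)) (at 0)"
    by (auto intro!: derivative_eq_intros)
  moreover have "(g has_derivative D) (at (x + 0 *\<^sub>R axis i 1))"
    using assms by simp
  ultimately have "((\<lambda>s. g (x + s *\<^sub>R axis i 1)) has_derivative (\<lambda>s. D (s *\<^sub>R axis i 1))) (at 0)"
    by (rule has_derivative_compose)
  then have "((\<lambda>s. g (x + s *\<^sub>R axis i 1)) has_vector_derivative D (axis i 1)) (at 0)"
    by (simp add: has_vector_derivative_def D.scaleR)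
  then show ?thesis
    unfolding partial_deriv_def by (rule vector_derivative_at)
qed

lemma has_vector_derivative_line:
  assumes "g differentiable at (x + (s - c) *\<^sub>R axis i 1)"
  shows "((\<lambda>s. g (x + (s - c) *\<^sub>R axis i 1)) has_vector_derivative
           partial_deriv i g (x + (s - c) *\<^sub>R axis i 1)) (at s)"
proof -
  let ?y = "x + (s - c) *\<^sub>R axis i 1"
  obtain D where D: "(g has_derivative D) (at ?y)"
    using assms by (auto simp: differentiable_def)
  interpret D: bounded_linear D
    using D by (rule has_derivative_bounded_linear)
  have "((\<lambda>s. x + (s - c) *\<^sub>R axis i 1) has_derivative (\<lambda>s. s *\<^sub>R axis i 1)) (at s)"
    by (auto intro!: derivative_eq_intros)
  from has_derivative_compose[OF this D]
  show ?thesis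
    by (simp add: has_vector_derivative_def D.scaleR has_derivative_imp_partial_deriv[OF D])
qed

text \<open>The norm is not differentiable at 0, but its power with exponent above 1 is. At a zero
  of \<open>h\<close> the difference quotient is, up to sign, the product of a positive power of the
  norm, which tends to 0, and a quotient tending to the norm of \<open>h'\<close>; so the derivative
  there is 0.\<close>

lemma norm_powr_has_derivative:
  fixes h :: "real \<Rightarrow> 'b::real_inner"
  assumes \<gamma>: "1 < \<gamma>" and h: "(h has_vector_derivative h') (at s)"
  shows "\<exists>D. ((\<lambda>s. norm (h s) powr \<gamma>) has_real_derivative D) (at s) \<and>
             \<bar>D\<bar> \<le> \<gamma> * norm (h s) powr (\<gamma> - 1) * norm h'"
proof (cases "h s = 0")
  case False
  have "((\<lambda>s. norm (h s)) has_derivative (\<lambda>k. sgn (h s) \<bullet> (k *\<^sub>R h'))) (at s)"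
    using has_derivative_compose[OF h[unfolded has_vector_derivative_def] has_derivative_norm[OF False]]
    by (simp add: inner_commute)
  then have "((\<lambda>s. norm (h s)) has_real_derivative (sgn (h s) \<bullet> h')) (at s)"
    by (simp add: has_field_derivative_def mult.commute[of _ "sgn (h s) \<bullet> h'"])
  moreover have "((\<lambda>z. z powr \<gamma>) has_real_derivative \<gamma> * norm (h s) powr (\<gamma> - 1)) (at (norm (h s)))"
    using False by (intro has_real_derivative_powr) simp
  ultimately have "((\<lambda>s. norm (h s) powr \<gamma>) has_real_derivative
      \<gamma> * norm (h s) powr (\<gamma> - 1) * (sgn (h s) \<bullet> h')) (at s)"
    by (rule DERIV_chain2[rotated])
  moreover have "\<bar>sgn (h s) \<bullet> h'\<bar> \<le> norm (sgn (h s)) * norm h'"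
    by (rule Cauchy_Schwarz_ineq2)
  then have "\<bar>\<gamma> * norm (h s) powr (\<gamma> - 1) * (sgn (h s) \<bullet> h')\<bar> \<le> \<gamma> * norm (h s) powr (\<gamma> - 1) * norm h'"
    using False \<gamma> by (simp add: abs_mult norm_sgn mult_left_mono)
  ultimately show ?thesis
    by blast
next
  case True
  have "((\<lambda>k. norm (h (s + k) - h s - k *\<^sub>R h') / norm k) \<longlongrightarrow> 0) (at 0)"
    using h by (simp add: has_vector_derivative_def has_derivative_at)
  moreover have "norm (h (s + k) - h s - k *\<^sub>R h') / norm k = norm ((h (s + k) - h s) /\<^sub>R k - h')"
    if "k \<noteq> 0" for k
  proof -
    have "h (s + k) - h s - k *\<^sub>R h' = k *\<^sub>R ((h (s + k) - h s) /\<^sub>R k - h')"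
      using that by (simp add: scaleR_diff_right)
    then show ?thesis
      using that by simp
  qed
  then have "\<forall>\<^sub>F k in at 0. norm (h (s + k) - h s - k *\<^sub>R h') / norm k = norm ((h (s + k) - h s) /\<^sub>R k - h')"
    by (simp add: eventually_at_filter)
  ultimately have "((\<lambda>k. norm ((h (s + k) - h s) /\<^sub>R k - h')) \<longlongrightarrow> 0) (at 0)"
    by (rule Lim_transform_eventually)
  then have "((\<lambda>k. (h (s + k) - h s) /\<^sub>R k) \<longlongrightarrow> h') (at 0)"
    by (simp add: tendsto_norm_zero_iff LIM_zero_iff)
  from tendsto_norm[OF this]
  have lim1: "((\<lambda>k. norm (h (s + k)) / \<bar>k\<bar>) \<longlongrightarrow> norm h') (at 0)"
    using True by (simp add: divide_inverse_commute)
  have "isCont h s"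
    using h by (rule has_vector_derivative_continuous)
  then have "((\<lambda>k. h (s + k)) \<longlongrightarrow> 0) (at 0)"
    using True by (simp add: isCont_iff)
  then have lim2: "((\<lambda>k. norm (h (s + k)) powr (\<gamma> - 1)) \<longlongrightarrow> 0) (at 0)"
    using \<gamma> by (intro tendsto_zero_powrI[where b="\<gamma> - 1"] tendsto_norm_zero) auto
  have eq: "norm (h (s + k)) powr \<gamma> = norm (h (s + k)) powr (\<gamma> - 1) * norm (h (s + k))" for k
    by (cases "h (s + k) = 0") (auto simp: powr_diff)
  have "((\<lambda>k. norm ((norm (h (s + k)) powr \<gamma> - norm (h s) powr \<gamma>) / k)) \<longlongrightarrow> 0) (at 0)"
    using tendsto_mult[OF lim2 lim1] True by (simp add: eq)
  then have "((\<lambda>s. norm (h s) powr \<gamma>) has_real_derivative 0) (at s)"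
    unfolding DERIV_def by (simp only: tendsto_norm_zero_iff)
  then show ?thesis
    using True \<gamma> by (intro exI[of _ 0]) auto
qed

text \<open>The fundamental theorem of calculus, started at a point where \<open>h\<close> still
  vanishes. The derivative \<open>D\<close> is known only through its bound, so the gauge integral
  is used, for which a derivative is always integrable; just the continuous majorant
  \<open>B\<close> is carried over to the Lebesgue integral.\<close>

lemma norm_powr_le_nn_integral:
  fixes h h' :: "real \<Rightarrow> 'b::real_inner"
  assumes \<gamma>: "1 < \<gamma>" and h: "\<And>s. (h has_vector_derivative h' s) (at s)"
    and cont: "continuous_on UNIV h'" and a: "\<And>s. s \<le> a \<Longrightarrow> h s = 0"
  shows "ennreal (norm (h b) powr \<gamma>)
    \<le> (\<integral>\<^sup>+s. ennreal (\<gamma> * norm (h s) powr (\<gamma> - 1) * norm (h' s)) \<partial>lborel)"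
proof (cases "b \<le> a")
  case True
  then show ?thesis
    using a by simp
next
  case False
  define B where "B s = \<gamma> * norm (h s) powr (\<gamma> - 1) * norm (h' s)" for s
  obtain D where D: "\<And>s. ((\<lambda>s. norm (h s) powr \<gamma>) has_real_derivative D s) (at s)" "\<And>s. \<bar>D s\<bar> \<le> B s"
    using norm_powr_has_derivative[OF \<gamma> h] unfolding B_def by metis
  have "continuous_on UNIV h"
    using h by (intro continuous_at_imp_continuous_on) (auto intro: has_vector_derivative_continuous)
  then have B: "continuous_on UNIV B"
    unfolding B_def using \<gamma> cont by (intro continuous_intros continuous_on_powr') auto
  have "(D has_integral (norm (h b) powr \<gamma> - norm (h a) powr \<gamma>)) {a..b}"
    using False D(1)
    by (intro fundamental_theorem_of_calculus)
       (auto simp: has_real_derivative_iff_has_vector_derivative[symmetric] intro: has_field_derivative_at_within)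
  then have D': "(D has_integral norm (h b) powr \<gamma>) {a..b}"
    using a by simp
  have Bint: "set_integrable lborel {a..b} B"
    by (rule borel_integrable_atLeastAtMost') (rule continuous_on_subset[OF B], simp)
  have "norm (h b) powr \<gamma> = norm (integral {a..b} D)"
    using D' by (simp add: integral_unique)
  also have "\<dots> \<le> integral {a..b} B"
    using D' D(2) Bint
    by (intro integral_norm_bound_integral) (auto intro: set_borel_integral_eq_integral(1))
  also have "\<dots> = (LINT s|lborel. indicator {a..b} s * B s)"
    using set_borel_integral_eq_integral(2)[OF Bint] by (simp add: set_lebesgue_integral_def)
  finally have "ennreal (norm (h b) powr \<gamma>) \<le> ennreal (LINT s|lborel. indicator {a..b} s * B s)"
    by (rule ennreal_leI)
  also have "\<dots> = (\<integral>\<^sup>+s. ennreal (indicator {a..b} s * B s) \<partial>lborel)"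
    using Bint \<gamma>
    by (intro nn_integral_eq_integral[symmetric]) (auto simp: set_integrable_def B_def)
  also have "\<dots> \<le> (\<integral>\<^sup>+s. ennreal (B s) \<partial>lborel)"
    using \<gamma> by (intro nn_integral_mono ennreal_leI) (auto simp: indicator_def B_def)
  finally show ?thesis
    by (simp add: B_def)
qed

lemma nn_integral_lborel_PiM:
  assumes [measurable]: "F \<in> borel_measurable borel"
  shows "(\<integral>\<^sup>+x. F x \<partial>lborel) =
    (\<integral>\<^sup>+X. F (\<Sum>b\<in>Basis. X b *\<^sub>R b) \<partial>(\<Pi>\<^sub>M b\<in>(Basis::'a::euclidean_space set). lborel :: real measure))"
  unfolding lborel_def[where 'a='a] lborel_eq_real[symmetric]
  by (subst nn_integral_distr) auto

text \<open>The same \<open>F\<close> bounds the power of the norm by a line integral in each of the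
  d coordinate directions, because it contains the sum of all partial derivatives. Multiplying the d
  bounds, each to the power \<open>c = 1 / (d - 1)\<close>, produces a product of marginals of
  \<open>F\<close>, and \<open>(d - 1) * c = 1\<close> removes the extra factor in
  \<open>nn_integral_prod_marginals_le\<close>.\<close>

lemma GNS_norm_powr:
  fixes g :: "(real, 'n::finite) vec \<Rightarrow> 'b::real_inner"
  assumes d: "2 \<le> CARD('n)" and \<gamma>: "1 < \<gamma>"
    and diff: "\<And>x. g differentiable at x" and cont: "\<And>i. continuous_on UNIV (partial_deriv i g)"
    and supp: "\<And>x. R < norm x \<Longrightarrow> g x = 0"
  shows "(\<integral>\<^sup>+x. ennreal (norm (g x) powr (\<gamma> * (CARD('n) / (real CARD('n) - 1)))) \<partial>lborel)
    \<le> epowr (\<integral>\<^sup>+x. ennreal (\<gamma> * norm (g x) powr (\<gamma> - 1) * (\<Sum>i\<in>UNIV. norm (partial_deriv i g x))) \<partial>lborel)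
        (CARD('n) / (real CARD('n) - 1))"
proof -
  define F where "F x = ennreal (\<gamma> * norm (g x) powr (\<gamma> - 1) * (\<Sum>i\<in>UNIV. norm (partial_deriv i g x)))" for x
  define e where "e X = (\<Sum>b\<in>(Basis::(real, 'n) vec set). X b *\<^sub>R b)" for X
  define c where "c = 1 / (real CARD('n) - 1)"
  have c: "0 < c" "(real CARD('n) - 1) * c = 1" "1 + c = CARD('n) / (real CARD('n) - 1)"
    "c * CARD('n) = CARD('n) / (real CARD('n) - 1)"
    using d by (auto simp: c_def field_simps)
  have g: "continuous_on UNIV g"
    using diff by (simp add: continuous_at_imp_continuous_on differentiable_imp_continuous_within)
  have "continuous_on UNIV (\<lambda>x. \<gamma> * norm (g x) powr (\<gamma> - 1) * (\<Sum>i\<in>UNIV. norm (partial_deriv i g x)))"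
    using \<gamma> g cont by (intro continuous_intros continuous_on_powr') auto
  from borel_measurable_continuous_onI[OF this]
  have F[measurable]: "F \<in> borel_measurable borel"
    unfolding F_def by (rule measurable_compose) (rule measurable_ennreal)
  have [measurable]: "g \<in> borel_measurable borel"
    using g by (rule borel_measurable_continuous_onI)
  interpret product_sigma_finite "\<lambda>b::(real, 'n) vec. lborel :: real measure" ..
  have line: "ennreal (norm (g (e X)) powr \<gamma>) \<le> (\<integral>\<^sup>+s. F (e (X(b := s))) \<partial>lborel)"
    if b: "b \<in> Basis" for X b
  proof -
    obtain i where i: "b = axis i 1"
      using b by (auto simp: Basis_vec_def)
    have e: "e (X(b := s)) = e X + (s - X b) *\<^sub>R b" for s
    proof -
      have "e (X(b := s)) - e X = (\<Sum>b'\<in>Basis. if b' = b then (s - X b) *\<^sub>R b else 0)"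
        unfolding e_def sum_subtractf[symmetric] by (intro sum.cong) (auto simp: algebra_simps)
      also have "\<dots> = (s - X b) *\<^sub>R b"
        using b by simp
      finally show ?thesis
        by (simp add: algebra_simps)
    qed
    define h where "h s = g (e X + (s - X b) *\<^sub>R b)" for s
    define h' where "h' s = partial_deriv i g (e X + (s - X b) *\<^sub>R b)" for s
    have "ennreal (norm (h (X b)) powr \<gamma>)
      \<le> (\<integral>\<^sup>+s. ennreal (\<gamma> * norm (h s) powr (\<gamma> - 1) * norm (h' s)) \<partial>lborel)"
    proof (rule norm_powr_le_nn_integral[OF \<gamma>])
      show "(h has_vector_derivative h' s) (at s)" for s
        unfolding h_def h'_def i using diff by (intro has_vector_derivative_line)
      show "continuous_on UNIV h'"
        unfolding h'_def by (intro continuous_on_compose2[OF cont]) (auto intro!: continuous_intros)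
      \<comment> \<open>Moving back along the line by more than the norm of \<open>e X\<close> plus
        \<open>R\<close> leaves the ball of radius \<open>R\<close>, by the triangle
        inequality.\<close>
      show "h s = 0" if "s \<le> X b - (norm (e X) + \<bar>R\<bar> + 1)" for s
      proof -
        have "norm ((s - X b) *\<^sub>R b) \<le> norm (e X + (s - X b) *\<^sub>R b) + norm (e X)"
          by (metis add_diff_cancel_left' norm_triangle_ineq4)
        then show ?thesis
          unfolding h_def using that b by (intro supp) auto
      qed
    qed
    also have "\<dots> \<le> (\<integral>\<^sup>+s. F (e (X(b := s))) \<partial>lborel)"
      unfolding F_def e h_def h'_def using \<gamma>
      by (intro nn_integral_mono ennreal_leI mult_left_mono member_le_sum) auto
    finally show ?thesis
      by (simp add: h_def)
  qed
  have card: "card (Basis :: (real, 'n) vec set) = CARD('n)"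
    by simp
  have pe: "ennreal (norm y powr (\<gamma> * (CARD('n) / (real CARD('n) - 1)))) =
      (\<Prod>b\<in>(Basis::(real, 'n) vec set). epowr (ennreal (norm y powr \<gamma>)) c)" for y :: 'b
  proof -
    have "((norm y powr \<gamma>) powr c) ^ CARD('n) = norm y powr (real CARD('n) * (\<gamma> * c))"
      by (cases "y = 0") (auto simp: powr_powr powr_power)
    also have "real CARD('n) * (\<gamma> * c) = \<gamma> * (CARD('n) / (real CARD('n) - 1))"
      using c(4) by (simp add: ac_simps)
    finally show ?thesis
      using c(1) by (simp add: card epowr_ennreal_pos ennreal_power)
  qed
  have "(\<integral>\<^sup>+x. ennreal (norm (g x) powr (\<gamma> * (CARD('n) / (real CARD('n) - 1)))) \<partial>lborel)
      = (\<integral>\<^sup>+X. (\<Prod>b\<in>(Basis::(real, 'n) vec set). epowr (ennreal (norm (g (e X)) powr \<gamma>)) c) 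
           \<partial>(\<Pi>\<^sub>M b\<in>(Basis::(real, 'n) vec set). lborel))"
    by (subst nn_integral_lborel_PiM) (simp_all only: e_def pe, measurable)
  also have "\<dots> \<le> (\<integral>\<^sup>+X. (\<Prod>b\<in>(Basis::(real, 'n) vec set). epowr (\<integral>\<^sup>+s. F (e (X(b := s))) \<partial>lborel) c) 
           \<partial>(\<Pi>\<^sub>M b\<in>(Basis::(real, 'n) vec set). lborel))"
    using c(1) line by (intro nn_integral_mono prod_mono_ennreal epowr_mono) auto
  also have "\<dots> \<le> epowr (\<integral>\<^sup>+X. F (e X) \<partial>(\<Pi>\<^sub>M b\<in>(Basis::(real, 'n) vec set). lborel)) (1 + c)"
    using nn_integral_prod_marginals_le[of "Basis :: (real, 'n) vec set" c "\<lambda>X. F (e X)"] c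
    by (simp add: card e_def)
  also have "(\<integral>\<^sup>+X. F (e X) \<partial>(\<Pi>\<^sub>M b\<in>(Basis::(real, 'n) vec set). lborel)) = (\<integral>\<^sup>+x. F x \<partial>lborel)"
    unfolding e_def by (rule nn_integral_lborel_PiM[symmetric]) measurable
  finally show ?thesis
    by (simp only: F_def c)
qed

text \<open>Apply the previous inequality to \<open>\<gamma> = p (d - 1) / (d - p)\<close>, for which
  \<open>\<gamma> d / (d - 1) = p\<^sup>*\<close> and \<open>(\<gamma> - 1) p / (p - 1) = p\<^sup>*\<close>, and absorb.\<close>

lemma Sobolev_C1:
  fixes g :: "(real, 'n::finite) vec \<Rightarrow> 'b::real_inner" and p q :: real
  assumes p: "1 < p" "p < CARD('n)" and q: "1 / q = 1 / p - 1 / CARD('n)"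
    and diff: "\<And>x. g differentiable at x" and cont: "\<And>i. continuous_on UNIV (partial_deriv i g)"
    and supp: "\<And>x. R < norm x \<Longrightarrow> g x = 0"
  shows "(\<integral>\<^sup>+x. ennreal (norm (g x) powr q) \<partial>lborel)
    \<le> ennreal ((q * (1 - 1 / CARD('n))) powr q) *
       epowr (\<integral>\<^sup>+x. ennreal ((\<Sum>i\<in>UNIV. norm (partial_deriv i g x)) powr p) \<partial>lborel) (q / p)"
proof -
  define d where "d = real CARD('n)"
  define \<gamma> where "\<gamma> = q * (1 - 1 / d)"
  define S where "S x = (\<Sum>i\<in>UNIV. norm (partial_deriv i g x))" for x
  have d: "1 < d" "p < d"
    using p by (auto simp: d_def)
  have q_eq: "q = p * d / (d - p)"
  proof -
    have "1 / q = (d - p) / (p * d)"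
      using q p d by (simp add: d_def[symmetric] field_simps)
    then show ?thesis
      by (metis inverse_divide inverse_eq_divide div_by_1)
  qed
  have dp: "d < p * d"
    using p d by simp
  then have pd: "d - p < p * d"
    using p by linarith
  have q0: "0 < q" "1 < q"
  proof -
    show "1 < q"
      using p d pd by (simp add: q_eq)
    then show "0 < q"
      by simp
  qed
  have \<gamma>_eq: "\<gamma> = p * (d - 1) / (d - p)"
    using p d by (simp add: \<gamma>_def q_eq field_simps)
  have "p * (d - 1) = p * d - p"
    by (simp add: algebra_simps)
  with dp have "d - p < p * (d - 1)"
    by linarith
  then have \<gamma>: "1 < \<gamma>"
    using d by (simp add: \<gamma>_eq)
  have e1: "\<gamma> * (d / (d - 1)) = q"
  proof -
    have "(1 - 1 / d) * (d / (d - 1)) = 1"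
      using d by (simp add: field_simps)
    then show ?thesis
      by (simp only: \<gamma>_def mult.assoc mult_1_right)
  qed
  have e2: "\<gamma> - 1 = q * (1 - 1 / p)"
  proof -
    have "q * (1 / p - 1 / d) = 1"
      using q0 by (simp add: d_def flip: q)
    then show ?thesis
      by (simp add: \<gamma>_def right_diff_distrib)
  qed
  have S0: "0 \<le> S x" for x
    by (auto simp: S_def sum_nonneg)
  have g: "continuous_on UNIV g"
    using diff by (simp add: continuous_at_imp_continuous_on differentiable_imp_continuous_within)
  have [measurable]: "g \<in> borel_measurable borel" "S \<in> borel_measurable borel"
    unfolding S_def using g cont by (auto intro!: borel_measurable_continuous_onI continuous_intros)
  define A where "A = (\<integral>\<^sup>+x. ennreal (norm (g x) powr q) \<partial>lborel)"
  define B where "B = (\<integral>\<^sup>+x. ennreal (S x powr p) \<partial>lborel)"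
  \<comment> \<open>The power of \<open>A\<close> on the right-hand side of \<open>le\<close> can be
    absorbed only if \<open>A\<close> is finite. It is, since \<open>g\<close> is continuous and
    vanishes outside a ball.\<close>
  have "A < top"
  proof -
    have "bounded (g ` cball 0 R)"
      using g by (intro compact_imp_bounded compact_continuous_image) (auto intro: continuous_on_subset)
    then obtain M where "\<forall>x\<in>cball 0 R. norm (g x) \<le> M"
      by (auto simp: bounded_iff)
    then have M: "norm (g x) \<le> M" if "norm x \<le> R" for x
      using that by simp
    have "A \<le> (\<integral>\<^sup>+x. ennreal (M powr q) * indicator (cball (0::(real, 'n) vec) R) x \<partial>lborel)"
      unfolding A_def
    proof (rule nn_integral_mono)
      fix x :: "(real, 'n) vec"
      show "ennreal (norm (g x) powr q) \<le> ennreal (M powr q) * indicator (cball 0 R) x"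
        using M[of x] supp[of x] q0 by (cases "norm x \<le> R") (auto intro!: ennreal_leI powr_mono2)
    qed
    also have "\<dots> = ennreal (M powr q) * emeasure lborel (cball (0::(real, 'n) vec) R)"
      by (simp add: nn_integral_cmult_indicator)
    also have "\<dots> < top"
      using emeasure_lborel_cball_finite[of "0::(real, 'n) vec" R] by (simp add: ennreal_mult_less_top less_top)
    finally show ?thesis .
  qed
  then obtain a where a: "A = ennreal a" "0 \<le> a"
    by (cases A) auto
  have "2 \<le> CARD('n)"
    using d by (simp add: d_def)
  then have "A \<le> epowr (\<integral>\<^sup>+x. ennreal (\<gamma> * norm (g x) powr (\<gamma> - 1) * S x) \<partial>lborel) (d / (d - 1))"
    using GNS_norm_powr[of \<gamma> g R] \<gamma> diff cont supp
    unfolding A_def S_def d_def[symmetric] e1 by simp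
  also have "(\<integral>\<^sup>+x. ennreal (\<gamma> * norm (g x) powr (\<gamma> - 1) * S x) \<partial>lborel)
     = ennreal \<gamma> * (\<integral>\<^sup>+x. epowr (ennreal (norm (g x) powr q)) (1 - 1 / p) * epowr (ennreal (S x powr p)) (1 / p) \<partial>lborel)"
    using \<gamma> p S0
    by (subst nn_integral_cmult[symmetric])
       (auto simp: epowr_ennreal powr_powr e2 ennreal_mult'' mult.assoc intro!: nn_integral_cong)
  finally have le1: "A \<le> epowr (ennreal \<gamma> * (\<integral>\<^sup>+x. epowr (ennreal (norm (g x) powr q)) (1 - 1 / p) *
      epowr (ennreal (S x powr p)) (1 / p) \<partial>lborel)) (d / (d - 1))" .
  have le2: "(\<integral>\<^sup>+x. epowr (ennreal (norm (g x) powr q)) (1 - 1 / p) * epowr (ennreal (S x powr p)) (1 / p) \<partial>lborel)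
      \<le> epowr A (1 - 1 / p) * epowr B (1 / p)"
    unfolding A_def B_def using p by (intro nn_integral_Hoelder2) auto
  have le: "A \<le> epowr (ennreal \<gamma> * (epowr A (1 - 1 / p) * epowr B (1 / p))) (d / (d - 1))"
    using d by (intro order_trans[OF le1] epowr_mono mult_left_mono[OF le2]) auto
  have "A \<le> ennreal (\<gamma> powr q) * epowr B (q / p)"
  proof (cases "B = top \<or> A = 0")
    case True
    then show ?thesis
      using \<gamma> q0 p by (auto simp: ennreal_mult_top)
  next
    case False
    then obtain b where b: "B = ennreal b" "0 \<le> b"
      by (cases B) auto
    have "0 < a"
      using False a by (cases "a = 0") auto
    have "a \<le> (\<gamma> * (a powr (1 - 1 / p) * b powr (1 / p))) powr (d / (d - 1))"
      using le p d \<gamma> \<open>0 < a\<close> b(2) by (simp add: a(1) b(1) epowr_ennreal flip: ennreal_mult)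
    then have "a powr ((d - 1) / d) \<le> ((\<gamma> * (a powr (1 - 1 / p) * b powr (1 / p))) powr (d / (d - 1))) powr ((d - 1) / d)"
      using d \<open>0 < a\<close> by (intro powr_mono2) auto
    also have "\<dots> = \<gamma> * b powr (1 / p) * a powr (1 - 1 / p)"
      using d \<gamma> \<open>0 < a\<close> b by (simp add: powr_powr)
    finally have "a powr ((d - 1) / d) / a powr (1 - 1 / p) \<le> \<gamma> * b powr (1 / p)"
      using \<open>0 < a\<close> by (simp add: divide_le_eq)
    \<comment> \<open>The power of \<open>a\<close> that survives the absorption: the left-hand
      side, brought to the exponent \<open>(d - 1) / d\<close>, minus the share
      \<open>1 - 1 / p\<close> that Hoelder put on the right.\<close>
    moreover have "(d - 1) / d - (1 - 1 / p) = 1 / q"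
      using d p q by (simp add: d_def[symmetric] diff_divide_distrib)
    ultimately have "a powr (1 / q) \<le> \<gamma> * b powr (1 / p)"
      by (simp add: powr_diff[symmetric])
    then have "(a powr (1 / q)) powr q \<le> (\<gamma> * b powr (1 / p)) powr q"
      using q0 by (intro powr_mono2) auto
    then have "a \<le> \<gamma> powr q * b powr (q / p)"
      using q0 \<open>0 < a\<close> \<gamma> b by (simp add: powr_powr powr_mult)
    then show ?thesis
      using q0 p b by (simp add: a(1) epowr_ennreal ennreal_mult'[symmetric])
  qed
  then show ?thesis
    by (simp add: A_def B_def S_def \<gamma>_def d_def)
qed

section \<open>Smooth functions\<close>

lemma differentiable_imp_partial_deriv:
  "g differentiable at x \<Longrightarrow> (g has_derivative (\<lambda>h. \<Sum>i\<in>UNIV. (h $ i) *\<^sub>R partial_deriv i g x)) (at x)"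
proof -
  assume "g differentiable at x"
  then obtain D where D: "(g has_derivative D) (at x)"
    by (auto simp: differentiable_def)
  interpret D: bounded_linear D
    using D by (rule has_derivative_bounded_linear)
  have "D h = (\<Sum>i\<in>UNIV. (h $ i) *\<^sub>R partial_deriv i g x)" for h
  proof -
    have "D h = D (\<Sum>i\<in>UNIV. (h $ i) *\<^sub>R axis i 1)"
      by (simp add: basis_expansion flip: scalar_mult_eq_scaleR)
    then show ?thesis
      by (simp add: D.sum D.scaleR has_derivative_imp_partial_deriv[OF D])
  qed
  then have "D = (\<lambda>h. \<Sum>i\<in>UNIV. (h $ i) *\<^sub>R partial_deriv i g x)"
    by (rule ext)
  with D show ?thesis
    by simp
qed

lemma partial_deriv_const [simp]: "partial_deriv i (\<lambda>x. c) x = 0"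
  by (rule has_derivative_imp_partial_deriv) (rule has_derivative_const)

lemma partial_deriv_add:
  assumes "f differentiable at x" "g differentiable at x"
  shows "partial_deriv i (\<lambda>x. f x + g x) x = partial_deriv i f x + partial_deriv i g x"
proof -
  from assms obtain D E where D: "(f has_derivative D) (at x)" and E: "(g has_derivative E) (at x)"
    by (auto simp: differentiable_def)
  show ?thesis
    using has_derivative_imp_partial_deriv[OF has_derivative_add[OF D E], of i]
    by (simp add: has_derivative_imp_partial_deriv[OF D] has_derivative_imp_partial_deriv[OF E])
qed

lemma partial_deriv_linear:
  assumes "bounded_linear L" "f differentiable at x"
  shows "partial_deriv i (\<lambda>x. L (f x)) x = L (partial_deriv i f x)"
proof -
  from assms(2) obtain D where D: "(f has_derivative D) (at x)"
    by (auto simp: differentiable_def)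
  show ?thesis
    using has_derivative_imp_partial_deriv[OF bounded_linear.has_derivative[OF assms(1) D], of i]
    by (simp add: has_derivative_imp_partial_deriv[OF D])
qed

lemma partial_deriv_bilinear:
  assumes "bounded_bilinear B" "f differentiable at x" "g differentiable at x"
  shows "partial_deriv i (\<lambda>x. B (f x) (g x)) x = B (f x) (partial_deriv i g x) + B (partial_deriv i f x) (g x)"
proof -
  from assms(2,3) obtain D E where D: "(f has_derivative D) (at x)" and E: "(g has_derivative E) (at x)"
    by (auto simp: differentiable_def)
  from bounded_bilinear.FDERIV[OF assms(1) this]
  show ?thesis
    by (simp add: has_derivative_imp_partial_deriv[OF D] has_derivative_imp_partial_deriv[OF E]
          has_derivative_imp_partial_deriv)
qed

lemma differentiable_bilinear:
  assumes "bounded_bilinear B" "f differentiable at x" "g differentiable at x"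
  shows "(\<lambda>x. B (f x) (g x)) differentiable at x"
  using assms(2,3) bounded_bilinear.FDERIV[OF assms(1)] unfolding differentiable_def by blast

lemma partial_deriv_compose_real:
  fixes q :: "(real, 'n::finite) vec \<Rightarrow> real" and F :: "real \<Rightarrow> real"
  assumes "q differentiable at x" "(F has_real_derivative F') (at (q x))"
  shows "(\<lambda>x. F (q x)) differentiable at x"
    and "partial_deriv i (\<lambda>x. F (q x)) x = F' * partial_deriv i q x"
proof -
  from assms(1) obtain D where D: "(q has_derivative D) (at x)"
    by (auto simp: differentiable_def)
  have *: "((\<lambda>x. F (q x)) has_derivative (\<lambda>h. F' * D h)) (at x)"
    using has_derivative_compose[OF D] assms(2) by (simp add: has_field_derivative_def)
  then show "(\<lambda>x. F (q x)) differentiable at x"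
    by (auto simp: differentiable_def)
  show "partial_deriv i (\<lambda>x. F (q x)) x = F' * partial_deriv i q x"
    by (simp add: has_derivative_imp_partial_deriv[OF *] has_derivative_imp_partial_deriv[OF D])
qed

lemma partial_deriv_reflect:
  assumes "f differentiable at (a - y)"
  shows "(\<lambda>y. f (a - y)) differentiable at y"
    and "partial_deriv i (\<lambda>y. f (a - y)) y = - partial_deriv i f (a - y)"
proof -
  from assms obtain D where D: "(f has_derivative D) (at (a - y))"
    by (auto simp: differentiable_def)
  interpret D: bounded_linear D
    using D by (rule has_derivative_bounded_linear)
  have "((\<lambda>y. a - y) has_derivative (\<lambda>h. - h)) (at y)"
    by (auto intro!: derivative_eq_intros)
  from has_derivative_compose[OF this D]
  have *: "((\<lambda>y. f (a - y)) has_derivative (\<lambda>h. D (- h))) (at y)" .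
  then show "(\<lambda>y. f (a - y)) differentiable at y"
    by (auto simp: differentiable_def)
  show "partial_deriv i (\<lambda>y. f (a - y)) y = - partial_deriv i f (a - y)"
    by (simp add: has_derivative_imp_partial_deriv[OF *] has_derivative_imp_partial_deriv[OF D]
          D.scaleR[of "-1", simplified])
qed

lemma partial_deriv_nth: "partial_deriv i (\<lambda>x. x $ j) x = (if i = j then 1 else 0)"
proof -
  have "((\<lambda>x. x $ j) has_derivative (\<lambda>h. h $ j)) (at x)"
    by (rule bounded_linear_imp_has_derivative) (rule bounded_linear_vec_nth)
  from has_derivative_imp_partial_deriv[OF this] show ?thesis
    by (simp add: axis_def)
qed

lemma partial_deriv_eq_0_outside:
  assumes "closed K" "\<And>x. x \<notin> K \<Longrightarrow> f x = 0" "x \<notin> K"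
  shows "partial_deriv i f x = 0"
proof (rule has_derivative_imp_partial_deriv[where D="\<lambda>_. 0", simplified])
  have "((\<lambda>_. 0) has_derivative (\<lambda>_. 0)) (at x)"
    by simp
  then show "(f has_derivative (\<lambda>_. 0)) (at x)"
    by (rule has_derivative_transform_within_open[where s="- K"]) (use assms in auto)
qed

text \<open>Differentiability of finite order makes closure properties of \<^const>\<open>smooth\<close> accessible to
  induction.\<close>

primrec diffk :: "nat \<Rightarrow> ((real, 'n::finite) vec \<Rightarrow> 'b::real_normed_vector) \<Rightarrow> bool"
  where
    "diffk 0 f \<longleftrightarrow> True"
  | "diffk (Suc k) f \<longleftrightarrow> (\<forall>x. f differentiable at x) \<and> (\<forall>i. diffk k (partial_deriv i f))"

lemma diffk_iff:
  fixes f :: "(real, 'n::finite) vec \<Rightarrow> 'b::real_normed_vector"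
  shows "diffk k f \<longleftrightarrow> (\<forall>(is :: 'n list) x. length is < k \<longrightarrow> foldr partial_deriv is f differentiable at x)"
proof (induction k arbitrary: f)
  case (Suc k)
  show ?case
  proof (intro iffI allI impI)
    fix "is" :: "'n list" and x assume *: "diffk (Suc k) f" "length is < Suc k"
    \<comment> \<open>\<open>foldr\<close> applies the last entry of the list first, so the
      derivative split off by \<open>diffk\<close> is the last entry; hence the case distinction
      from the right.\<close>
    show "foldr partial_deriv is f differentiable at x"
      using * Suc by (cases "is" rule: rev_cases) auto
  next
    assume *: "\<forall>(is :: 'n list) x. length is < Suc k \<longrightarrow> foldr partial_deriv is f differentiable at x"
    have "foldr partial_deriv is (partial_deriv i f) differentiable at x" if "length is < k" for "is" i x
      using *[rule_format, of "is @ [i]" x] that by simp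
    then show "diffk (Suc k) f"
      using *[rule_format, of "[]"] Suc by simp
  qed
qed simp

lemma smooth_iff_diffk: "smooth f \<longleftrightarrow> (\<forall>k. diffk k f)"
  unfolding smooth_def diffk_iff by blast

lemma smooth_partial_deriv: "smooth f \<Longrightarrow> smooth (partial_deriv i f)"
  unfolding smooth_iff_diffk by (metis diffk.simps(2))

lemma smooth_differentiable: "smooth f \<Longrightarrow> f differentiable at x"
  unfolding smooth_iff_diffk by (metis diffk.simps(2))

lemma smooth_continuous_on: "smooth f \<Longrightarrow> continuous_on S f"
  by (simp add: continuous_at_imp_continuous_on differentiable_imp_continuous_within smooth_differentiable)

lemma diffk_SucD: "diffk (Suc k) f \<Longrightarrow> diffk k f"
  unfolding diffk_iff by simp

lemma diffk_const: "diffk k (\<lambda>x::(real, 'n::finite) vec. c :: 'b::real_normed_vector)"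
proof (induction k arbitrary: c)
  case (Suc k)
  have "partial_deriv i (\<lambda>x. c) = (\<lambda>x. 0)" for i :: 'n
    by (rule ext) simp
  then show ?case
    using Suc by simp
qed simp

lemma diffk_add: "diffk k f \<Longrightarrow> diffk k g \<Longrightarrow> diffk k (\<lambda>x. f x + g x)"
proof (induction k arbitrary: f g)
  case (Suc k)
  then have "partial_deriv i (\<lambda>x. f x + g x) = (\<lambda>x. partial_deriv i f x + partial_deriv i g x)" for i
    by (intro ext partial_deriv_add) auto
  then show ?case
    using Suc by (auto intro: differentiable_add)
qed simp

lemma diffk_sum: "(\<And>j. j \<in> J \<Longrightarrow> diffk k (f j)) \<Longrightarrow> diffk k (\<lambda>x. \<Sum>j\<in>J. f j x)"
  by (induction J rule: infinite_finite_induct) (auto intro: diffk_add diffk_const)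

lemma diffk_bilinear:
  assumes B: "bounded_bilinear B"
  shows "diffk k f \<Longrightarrow> diffk k g \<Longrightarrow> diffk k (\<lambda>x. B (f x) (g x))"
proof (induction k arbitrary: f g)
  case (Suc k)
  then have "partial_deriv i (\<lambda>x. B (f x) (g x)) = (\<lambda>x. B (f x) (partial_deriv i g x) + B (partial_deriv i f x) (g x))" for i
    by (intro ext partial_deriv_bilinear[OF B]) auto
  then show ?case
    using differentiable_bilinear[OF B, of f _ g] Suc.prems diffk_SucD[OF Suc.prems(1)] diffk_SucD[OF Suc.prems(2)]
    by (auto intro!: diffk_add Suc.IH)
qed simp

lemma diffk_linear:
  assumes L: "bounded_linear L"
  shows "diffk k f \<Longrightarrow> diffk k (\<lambda>x. L (f x))"
proof (induction k arbitrary: f)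
  case (Suc k)
  then have "partial_deriv i (\<lambda>x. L (f x)) = (\<lambda>x. L (partial_deriv i f x))" for i
    by (intro ext partial_deriv_linear[OF L]) auto
  moreover have "(\<lambda>x. L (f x)) differentiable at x" for x
    using Suc.prems bounded_linear.has_derivative[OF L] unfolding differentiable_def diffk.simps by blast
  ultimately show ?case
    using Suc by auto
qed simp

lemma smooth_const: "smooth (\<lambda>x. c)"
  by (simp add: smooth_iff_diffk diffk_const)

lemma smooth_add: "smooth f \<Longrightarrow> smooth g \<Longrightarrow> smooth (\<lambda>x. f x + g x)"
  by (simp add: smooth_iff_diffk diffk_add)

lemma smooth_sum: "(\<And>j. j \<in> J \<Longrightarrow> smooth (f j)) \<Longrightarrow> smooth (\<lambda>x. \<Sum>j\<in>J. f j x)"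
  by (simp add: smooth_iff_diffk diffk_sum)

lemma smooth_mult:
  fixes f g :: "(real, 'n::finite) vec \<Rightarrow> 'b::real_normed_algebra"
  shows "smooth f \<Longrightarrow> smooth g \<Longrightarrow> smooth (\<lambda>x. f x * g x)"
  by (simp add: smooth_iff_diffk diffk_bilinear[OF bounded_bilinear_mult])

lemma smooth_linear: "bounded_linear L \<Longrightarrow> smooth f \<Longrightarrow> smooth (\<lambda>x. L (f x))"
  by (simp add: smooth_iff_diffk diffk_linear)

lemma diffk_reflect: "diffk k f \<Longrightarrow> diffk k (\<lambda>y. f (a - y))"
proof (induction k arbitrary: f)
  case (Suc k)
  then have "partial_deriv i (\<lambda>y. f (a - y)) = (\<lambda>y. - partial_deriv i f (a - y))" for i
    by (intro ext partial_deriv_reflect) auto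
  moreover have "diffk k (\<lambda>y. - partial_deriv i f (a - y))" for i
    using Suc by (intro diffk_linear[OF bounded_linear_minus[OF bounded_linear_ident]]) auto
  ultimately show ?case
    using Suc.prems by (auto intro: partial_deriv_reflect)
qed simp

lemma smooth_reflect: "smooth f \<Longrightarrow> smooth (\<lambda>y. f (a - y))"
  by (simp add: smooth_iff_diffk diffk_reflect)

lemma smooth_nth: "smooth (\<lambda>x. x $ j)"
proof -
  have "diffk k (\<lambda>x::(real, 'a) vec. x $ j)" for k
  proof (cases k)
    case (Suc k')
    have "partial_deriv i (\<lambda>x::(real, 'a) vec. x $ j) = (\<lambda>x. if i = j then 1 else 0)" for i
      by (rule ext) (rule partial_deriv_nth)
    moreover have "(\<lambda>x::(real, 'a) vec. x $ j) differentiable at x" for x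
      by (rule bounded_linear_imp_differentiable) (rule bounded_linear_vec_nth)
    ultimately show ?thesis
      by (simp add: Suc diffk_const)
  qed simp
  then show ?thesis
    by (simp add: smooth_iff_diffk)
qed

text \<open>The functions \<open>exp (- 1 / t) / t\<^sup>k\<close>, extended by \<open>0\<close>, span a space closed under
  differentiation.\<close>

definition flat :: "nat \<Rightarrow> real \<Rightarrow> real"
  where "flat k t = (if t \<le> 0 then 0 else exp (- 1 / t) / t ^ k)"

lemma flat_tendsto_0: "(flat k \<longlongrightarrow> 0) (at_right 0)"
proof -
  have "((\<lambda>t. (inverse t) ^ k / exp (inverse t)) \<longlongrightarrow> 0) (at_right (0::real))"
    by (rule filterlim_compose[OF tendsto_power_div_exp_0 filterlim_inverse_at_top_right])
  moreover have "\<forall>\<^sub>F t in at_right 0. (inverse t) ^ k / exp (inverse t) = flat k t"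
    unfolding eventually_at_right_field
    by (intro exI[of _ 1]) (auto simp: flat_def exp_minus field_simps)
  ultimately show ?thesis
    by (rule Lim_transform_eventually)
qed

lemma flat_has_derivative: "(flat k has_real_derivative - real k * flat (Suc k) t + flat (k + 2) t) (at t)"
proof -
  consider "t < 0" | "t > 0" | "t = 0"
    by linarith
  then show ?thesis
  proof cases
    case 1
    have "((\<lambda>_. 0) has_real_derivative 0) (at t)"
      by simp
    then have "(flat k has_real_derivative 0) (at t)"
      by (rule has_field_derivative_transform_within_open[where S="{..<0}"]) (use 1 in \<open>auto simp: flat_def\<close>)
    then show ?thesis
      using 1 by (simp add: flat_def)
  next
    case 2
    have "((\<lambda>t. exp (- 1 / t) / t ^ k) has_real_derivative
        (exp (- 1 / t) * (1 / t\<^sup>2) * t ^ k - exp (- 1 / t) * (real k * t ^ (k - 1))) / (t ^ k * t ^ k)) (at t)"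
      using 2 by (auto intro!: derivative_eq_intros simp: power2_eq_square)
    also have "(exp (- 1 / t) * (1 / t\<^sup>2) * t ^ k - exp (- 1 / t) * (real k * t ^ (k - 1))) / (t ^ k * t ^ k)
        = - real k * flat (Suc k) t + flat (k + 2) t"
      using 2 by (cases k) (simp_all add: flat_def field_simps power2_eq_square)
    finally show ?thesis
      by (rule has_field_derivative_transform_within_open[where S="{0<..}"]) (use 2 in \<open>auto simp: flat_def\<close>)
  next
    case 3
    have "((\<lambda>h. (flat k (0 + h) - flat k 0) / h) \<longlongrightarrow> 0) (at 0)"
      unfolding filterlim_at_split
    proof
      have "\<forall>\<^sub>F h in at_left 0. (flat k (0 + h) - flat k 0) / h = 0"
        unfolding eventually_at_left_field by (intro exI[of _ "-1"]) (auto simp: flat_def)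
      then show "((\<lambda>h. (flat k (0 + h) - flat k 0) / h) \<longlongrightarrow> 0) (at_left 0)"
        by (rule tendsto_eventually)
      \<comment> \<open>At 0 the difference quotient of \<open>flat k\<close> from the right is
        \<open>flat (Suc k)\<close>, whose limit is already known.\<close>
      have "\<forall>\<^sub>F h in at_right 0. flat (Suc k) h = (flat k (0 + h) - flat k 0) / h"
        unfolding eventually_at_right_field by (intro exI[of _ 1]) (auto simp: flat_def)
      then show "((\<lambda>h. (flat k (0 + h) - flat k 0) / h) \<longlongrightarrow> 0) (at_right 0)"
        by (rule Lim_transform_eventually[OF flat_tendsto_0])
    qed
    then show ?thesis
      by (simp add: 3 DERIV_def flat_def)
  qed
qed

lemma diffk_flat:
  assumes "smooth q"
  shows "diffk k (\<lambda>x. flat j (q x))"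
proof (induction k arbitrary: j)
  case (Suc k)
  have d: "q differentiable at x" for x
    using assms by (rule smooth_differentiable)
  have "partial_deriv i (\<lambda>x. flat j (q x))
      = (\<lambda>x. (- real j * flat (Suc j) (q x) + flat (j + 2) (q x)) * partial_deriv i q x)" for i
    by (intro ext partial_deriv_compose_real(2)[OF d flat_has_derivative])
  moreover have "diffk k (\<lambda>x. (- real j * flat (Suc j) (q x) + flat (j + 2) (q x)) * partial_deriv i q x)" for i
    using Suc smooth_partial_deriv[OF assms, of i] 
    by (intro diffk_bilinear[OF bounded_bilinear_mult] diffk_add diffk_const) (auto simp: smooth_iff_diffk)
  ultimately show ?case
    using partial_deriv_compose_real(1)[OF d flat_has_derivative] by simp
qed simp

lemma smooth_flat: "smooth q \<Longrightarrow> smooth (\<lambda>x. flat j (q x))"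
  by (simp add: smooth_iff_diffk diffk_flat)

section \<open>Symmetry of second partial derivatives\<close>

text \<open>The mean value theorem, once in direction \<open>i\<close> and once in direction
  \<open>j\<close>. The second difference is symmetric in \<open>i\<close> and \<open>j\<close>, so
  letting the side \<open>h\<close> of the square tend to 0 identifies the two mixed
  derivatives.\<close>

lemma mixed_difference:
  fixes f :: "(real, 'n::finite) vec \<Rightarrow> real"
  assumes f: "smooth f" and h: "0 < h"
  obtains y where "dist y x \<le> 2 * h"
    "f (x + h *\<^sub>R axis i 1 + h *\<^sub>R axis j 1) - f (x + h *\<^sub>R axis i 1) - (f (x + h *\<^sub>R axis j 1) - f x)
      = h\<^sup>2 * partial_deriv j (partial_deriv i f) y"
proof -
  have line: "((\<lambda>s. g (z + s *\<^sub>R axis k 1)) has_real_derivative partial_deriv k g (z + s *\<^sub>R axis k 1)) (at s)"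
    if "smooth g" for g :: "(real, 'n::finite) vec \<Rightarrow> real" and z k s
    using has_vector_derivative_line[of g z s 0 k] smooth_differentiable[OF that]
    by (simp add: has_real_derivative_iff_has_vector_derivative)
  define \<phi> where "\<phi> s = f ((x + h *\<^sub>R axis j 1) + s *\<^sub>R axis i 1) - f (x + s *\<^sub>R axis i 1)" for s
  have "(\<phi> has_real_derivative partial_deriv i f ((x + h *\<^sub>R axis j 1) + s *\<^sub>R axis i 1)
      - partial_deriv i f (x + s *\<^sub>R axis i 1)) (at s)" for s
    unfolding \<phi>_def by (intro DERIV_diff line f)
  then obtain s where s: "0 < s" "s < h" "\<phi> h - \<phi> 0 = h * (partial_deriv i f ((x + h *\<^sub>R axis j 1) + s *\<^sub>R axis i 1)
      - partial_deriv i f (x + s *\<^sub>R axis i 1))"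
    using MVT2[OF h, of \<phi> "\<lambda>s. partial_deriv i f ((x + h *\<^sub>R axis j 1) + s *\<^sub>R axis i 1)
      - partial_deriv i f (x + s *\<^sub>R axis i 1)"] by auto
  define \<psi> where "\<psi> t = partial_deriv i f ((x + s *\<^sub>R axis i 1) + t *\<^sub>R axis j 1)" for t
  have "(\<psi> has_real_derivative partial_deriv j (partial_deriv i f) ((x + s *\<^sub>R axis i 1) + t *\<^sub>R axis j 1)) (at t)" for t
    unfolding \<psi>_def by (intro line smooth_partial_deriv f)
  then obtain t where t: "0 < t" "t < h"
    "\<psi> h - \<psi> 0 = h * partial_deriv j (partial_deriv i f) ((x + s *\<^sub>R axis i 1) + t *\<^sub>R axis j 1)"
    using MVT2[OF h, of \<psi> "\<lambda>t. partial_deriv j (partial_deriv i f) ((x + s *\<^sub>R axis i 1) + t *\<^sub>R axis j 1)"]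
    by auto
  show ?thesis
  proof
    have "norm (s *\<^sub>R axis i 1 + t *\<^sub>R axis j 1 :: (real, 'n) vec) \<le> s * 1 + t * 1"
      using s t by (intro norm_triangle_le add_mono) auto
    then show "dist ((x + s *\<^sub>R axis i 1) + t *\<^sub>R axis j 1) x \<le> 2 * h"
      using s t by (simp add: dist_norm add.assoc)
    have "\<phi> h - \<phi> 0 = h * (\<psi> h - \<psi> 0)"
      by (simp add: s(3) \<psi>_def add_ac)
    also have "\<dots> = h\<^sup>2 * partial_deriv j (partial_deriv i f) ((x + s *\<^sub>R axis i 1) + t *\<^sub>R axis j 1)"
      by (simp add: t(3) power2_eq_square)
    finally show "f (x + h *\<^sub>R axis i 1 + h *\<^sub>R axis j 1) - f (x + h *\<^sub>R axis i 1) - (f (x + h *\<^sub>R axis j 1) - f x)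
      = h\<^sup>2 * partial_deriv j (partial_deriv i f) ((x + s *\<^sub>R axis i 1) + t *\<^sub>R axis j 1)"
      by (simp add: \<phi>_def add_ac)
  qed
qed

lemma partial_deriv_commute:
  fixes f :: "(real, 'n::finite) vec \<Rightarrow> real"
  assumes f: "smooth f"
  shows "partial_deriv i (partial_deriv j f) = partial_deriv j (partial_deriv i f)"
proof
  fix x
  define A where "A = partial_deriv j (partial_deriv i f)"
  define B where "B = partial_deriv i (partial_deriv j f)"
  have "\<exists>y z. dist y x \<le> 2 * h \<and> dist z x \<le> 2 * h \<and> A y = B z" if h: "0 < h" for h
  proof -
    obtain y where y: "dist y x \<le> 2 * h"
      "f (x + h *\<^sub>R axis i 1 + h *\<^sub>R axis j 1) - f (x + h *\<^sub>R axis i 1) - (f (x + h *\<^sub>R axis j 1) - f x) = h\<^sup>2 * A y"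
      using mixed_difference[OF f h, of x i j] unfolding A_def by metis
    obtain z where z: "dist z x \<le> 2 * h"
      "f (x + h *\<^sub>R axis j 1 + h *\<^sub>R axis i 1) - f (x + h *\<^sub>R axis j 1) - (f (x + h *\<^sub>R axis i 1) - f x) = h\<^sup>2 * B z"
      using mixed_difference[OF f h, of x j i] unfolding B_def by metis
    have "x + h *\<^sub>R axis j 1 + h *\<^sub>R axis i 1 = x + h *\<^sub>R axis i 1 + h *\<^sub>R axis j 1"
      by (simp add: add_ac)
    with z(2) have "f (x + h *\<^sub>R axis i 1 + h *\<^sub>R axis j 1) - f (x + h *\<^sub>R axis j 1) -
        (f (x + h *\<^sub>R axis i 1) - f x) = h\<^sup>2 * B z"
      by (simp only:)
    with y(2) have "h\<^sup>2 * A y = h\<^sup>2 * B z"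
      by linarith
    with h y z show ?thesis
      by auto
  qed
  then have "\<exists>y z. dist y x \<le> 2 * inverse (Suc n) \<and> dist z x \<le> 2 * inverse (Suc n) \<and> A y = B z" for n
    by simp
  then obtain y z where yz: "\<And>n. dist (y n) x \<le> 2 * inverse (Suc n)" "\<And>n. dist (z n) x \<le> 2 * inverse (Suc n)"
    "\<And>n. A (y n) = B (z n)"
    by metis
  have lim: "(\<lambda>n. 2 * inverse (real (Suc n))) \<longlonglongrightarrow> 0"
    using tendsto_mult[OF tendsto_const LIMSEQ_inverse_real_of_nat, of 2] by simp
  have "y \<longlonglongrightarrow> x" "z \<longlonglongrightarrow> x"
    by (rule tendsto_dist_iff[THEN iffD2], rule tendsto_sandwich[OF _ _ tendsto_const lim], use yz in auto)+
  moreover have "isCont A x" "isCont B x"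
    unfolding A_def B_def using f
    by (auto intro!: differentiable_imp_continuous_within smooth_differentiable smooth_partial_deriv)
  ultimately have "(\<lambda>n. A (y n)) \<longlonglongrightarrow> A x" "(\<lambda>n. B (z n)) \<longlonglongrightarrow> B x"
    by (auto intro: isCont_tendsto_compose)
  then show "B x = A x" unfolding yz(3) 
    by (rule LIMSEQ_unique[rotated])
qed

section \<open>Multi-indices and test functions\<close>

lemma smooth_foldr: "smooth f \<Longrightarrow> smooth (foldr partial_deriv is f)"
  by (induction "is") (auto intro: smooth_partial_deriv)

lemma foldr_partial_deriv_commute:
  fixes f :: "(real, 'n::finite) vec \<Rightarrow> real"
  shows "smooth f \<Longrightarrow> foldr partial_deriv is (partial_deriv i f) = partial_deriv i (foldr partial_deriv is f)"
  by (induction "is") (auto simp: partial_deriv_commute smooth_foldr)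

text \<open>\<open>mi_deriv\<close> differentiates in a fixed order of the coordinates. Raising
  \<open>\<alpha> i\<close> inserts a derivative in the middle of the list, and commutation moves it
  to the innermost place. This is what makes induction on the order of a multi-index
  possible.\<close>

lemma mi_deriv_Suc:
  fixes f :: "(real, 'n::{finite,linorder}) vec \<Rightarrow> real"
  assumes f: "smooth f"
  shows "mi_deriv (\<alpha>(i := Suc (\<alpha> i))) f = mi_deriv \<alpha> (partial_deriv i f)"
proof -
  have 1: "concat (map (\<lambda>k. replicate ((\<alpha>(i := Suc (\<alpha> i))) k) k) L) = concat (map (\<lambda>k. replicate (\<alpha> k) k) L)"
    if "i \<notin> set L" for L
    using that by (induction L) auto
  have "foldr partial_deriv (concat (map (\<lambda>k. replicate ((\<alpha>(i := Suc (\<alpha> i))) k) k) L)) f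
      = foldr partial_deriv (concat (map (\<lambda>k. replicate (\<alpha> k) k) L)) (partial_deriv i f)"
    if "distinct L" "i \<in> set L" for L
    using that
  proof (induction L)
    case (Cons k L)
    show ?case
    proof (cases "k = i")
      case True
      with Cons.prems 1[of L] show ?thesis
        using foldr_partial_deriv_commute[OF f, of "replicate (\<alpha> i) i @ concat (map (\<lambda>k. replicate (\<alpha> k) k) L)" i]
        by simp
    next
      case False
      with Cons show ?thesis
        by simp
    qed
  qed simp
  then show ?thesis
    unfolding mi_deriv_def by simp
qed

lemma mi_deriv_zero: "mi_deriv (\<lambda>_. 0) f = f"
proof -
  have "concat (map (\<lambda>k. replicate 0 k) L) = []" for L :: "'a list"
    by (induction L) auto
  then show ?thesis
    unfolding mi_deriv_def by (simp only: foldr.simps id_apply)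
qed

lemma mi_deriv_single:
  fixes f :: "(real, 'n::{finite,linorder}) vec \<Rightarrow> real"
  assumes "smooth f"
  shows "mi_deriv ((\<lambda>_. 0)(i := Suc 0)) f = partial_deriv i f"
  using mi_deriv_Suc[OF assms, of "\<lambda>_. 0" i] by (simp add: mi_deriv_zero)

lemma mi_order_Suc: "mi_order (\<alpha>(i := Suc (\<alpha> i))) = Suc (mi_order \<alpha>)"
proof -
  have "mi_order (\<alpha>(i := Suc (\<alpha> i))) = (\<Sum>k\<in>UNIV. \<alpha> k + (if k = i then 1 else 0))"
    unfolding mi_order_def by (intro sum.cong) auto
  then show ?thesis
    by (simp add: sum.distrib mi_order_def)
qed

lemma mi_order_zero [simp]: "mi_order (\<lambda>_. 0) = 0"
  by (simp add: mi_order_def)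

lemma mi_order_eq_0: "mi_order \<alpha> = 0 \<Longrightarrow> \<alpha> = (\<lambda>_. 0)"
  by (auto simp: mi_order_def)

lemma mi_order_SucE:
  assumes "mi_order \<beta> = Suc k"
  obtains \<alpha> i where "\<beta> = \<alpha>(i := Suc (\<alpha> i))" "mi_order \<alpha> = k"
proof -
  obtain i where i: "\<beta> i \<noteq> 0"
    using assms by (metis Zero_not_Suc mi_order_def sum.neutral)
  define \<alpha> where "\<alpha> = \<beta>(i := \<beta> i - 1)"
  have \<beta>: "\<beta> = \<alpha>(i := Suc (\<alpha> i))"
    using i by (auto simp: \<alpha>_def)
  moreover have "mi_order \<alpha> = k"
    using assms mi_order_Suc[of \<alpha> i] \<beta> by simp
  ultimately show ?thesis
    using that by blast
qed

lemma test_functionE: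
  assumes "\<phi> \<in> test_functions \<Omega>"
  obtains K where "smooth \<phi>" "compact K" "K \<subseteq> \<Omega>" "\<And>x. x \<notin> K \<Longrightarrow> \<phi> x = 0" "\<And>x i. x \<notin> K \<Longrightarrow> partial_deriv i \<phi> x = 0"
  using assms partial_deriv_eq_0_outside[OF compact_imp_closed] unfolding test_functions_def by blast

lemma test_function_partial_deriv: "\<phi> \<in> test_functions \<Omega> \<Longrightarrow> partial_deriv i \<phi> \<in> test_functions \<Omega>"
  by (erule test_functionE) (auto simp: test_functions_def intro: smooth_partial_deriv)

lemma test_function_foldr: "\<phi> \<in> test_functions \<Omega> \<Longrightarrow> foldr partial_deriv is \<phi> \<in> test_functions \<Omega>"
  by (induction "is") (auto intro: test_function_partial_deriv)

lemma test_function_mi_deriv: "\<phi> \<in> test_functions \<Omega> \<Longrightarrow> mi_deriv \<alpha> \<phi> \<in> test_functions \<Omega>"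
  unfolding mi_deriv_def by (rule test_function_foldr)

lemma test_function_mult:
  "\<phi> \<in> test_functions \<Omega> \<Longrightarrow> smooth f \<Longrightarrow> (\<lambda>x. \<phi> x * f x) \<in> test_functions \<Omega>"
  unfolding test_functions_def by (auto intro!: smooth_mult)

lemma test_function_bounded:
  assumes "\<phi> \<in> test_functions \<Omega>"
  obtains M where "0 \<le> M" "\<And>x. \<bar>\<phi> x\<bar> \<le> M"
proof -
  obtain K where K: "smooth \<phi>" "compact K" "\<And>x. x \<notin> K \<Longrightarrow> \<phi> x = 0"
    using assms by (auto elim: test_functionE)
  then have "bounded (\<phi> ` K)"
    by (intro compact_imp_bounded compact_continuous_image smooth_continuous_on)
  then obtain M where "\<forall>x\<in>K. \<bar>\<phi> x\<bar> \<le> M"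
    by (auto simp: bounded_iff)
  then have "\<bar>\<phi> x\<bar> \<le> max M 0" for x
    using K(3)[of x] by (cases "x \<in> K") (auto intro: max.coboundedI1)
  then show ?thesis
    using that[of "max M 0"] by simp
qed

section \<open>Bump functions\<close>

lemma mollifier_exists:
  assumes e: "0 < e"
  obtains \<psi> :: "(real, 'n::finite) vec \<Rightarrow> real"
  where "smooth \<psi>" "\<And>x. 0 \<le> \<psi> x" "\<And>x. e \<le> norm x \<Longrightarrow> \<psi> x = 0" "(\<integral>\<^sup>+x. ennreal (\<psi> x) \<partial>lborel) = 1"
proof -
  \<comment> \<open>\<open>q\<close> is positive exactly inside the ball of radius \<open>e\<close>.
    It is written as a polynomial in the coordinates so that the closure properties of
    \<open>smooth\<close> apply; composing with \<open>flat 0\<close> gives the usual bump.\<close>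
  define q where "q x = 1 + (- (1 / e\<^sup>2)) * (\<Sum>i\<in>UNIV. x $ i * x $ i)" for x :: "(real, 'n) vec"
  define \<eta> where "\<eta> x = flat 0 (q x)" for x
  have "smooth q"
    unfolding q_def by (intro smooth_add smooth_mult smooth_const smooth_sum smooth_nth)
  then have \<eta>: "smooth \<eta>"
    unfolding \<eta>_def by (rule smooth_flat)
  then have [measurable]: "\<eta> \<in> borel_measurable borel"
    by (rule borel_measurable_continuous_onI[OF smooth_continuous_on])
  have q: "q x = 1 - (norm x / e)\<^sup>2" for x
    by (simp add: q_def power_divide power2_norm_eq_inner inner_vec_def)
  have zero: "\<eta> x = 0" if "e \<le> norm x" for x
  proof -
    have "1 \<le> norm x / e"
      using that e by simp
    then have "1 \<le> (norm x / e)\<^sup>2"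
      by (rule one_le_power)
    then show ?thesis
      by (simp add: \<eta>_def q flat_def)
  qed
  have pos: "0 < \<eta> x" if "norm x < e" for x
  proof -
    have "(norm x / e)\<^sup>2 < 1"
      using that e by (intro power_less_one_iff[THEN iffD2]) auto
    then show ?thesis
      by (simp add: \<eta>_def q flat_def)
  qed
  have nonneg: "0 \<le> \<eta> x" and le1: "\<eta> x \<le> 1" for x
    by (auto simp: \<eta>_def flat_def)
  define c where "c = (\<integral>\<^sup>+x. ennreal (\<eta> x) \<partial>lborel)"
  have "c \<le> (\<integral>\<^sup>+x. indicator (cball (0::(real, 'n) vec) e) x \<partial>lborel)"
    unfolding c_def using zero le1 by (intro nn_integral_mono) (auto simp: indicator_def)
  also have "\<dots> < top"
    using emeasure_lborel_cball_finite[of "0::(real, 'n) vec" e] by (simp add: less_top)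
  finally obtain r where r: "c = ennreal r" "0 \<le> r"
    by (cases c) auto
  have "c \<noteq> 0"
  proof
    assume "c = 0"
    then have "AE x in lborel. \<eta> x = 0"
      using nonneg unfolding c_def by (subst (asm) nn_integral_0_iff_AE) (auto simp: ennreal_eq_0_iff dual_order.antisym elim!: eventually_mono)
    then have "AE x in lborel. x \<notin> ball (0::(real, 'n) vec) e"
      by eventually_elim (use pos in force)
    then have "ball (0::(real, 'n) vec) e \<in> null_sets lborel"
      by (subst AE_iff_null_sets) auto
    then have "negligible (ball (0::(real, 'n) vec) e)"
      by (simp add: negligible_iff_null_sets null_sets_completionI)
    then show False
      using e open_not_negligible[of "ball (0::(real, 'n) vec) e"] by auto
  qed
  with r have "0 < r"
    by (cases "r = 0") auto
  show ?thesis
  proof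
    show "smooth (\<lambda>x. \<eta> x * (1 / r))"
      by (intro smooth_mult \<eta> smooth_const)
    show "0 \<le> \<eta> x * (1 / r)" for x
      using nonneg \<open>0 < r\<close> by simp
    show "\<eta> x * (1 / r) = 0" if "e \<le> norm x" for x
      using zero[OF that] by simp
    have "(\<integral>\<^sup>+x. ennreal (\<eta> x * (1 / r)) \<partial>lborel) = (\<integral>\<^sup>+x. ennreal (\<eta> x) * ennreal (1 / r) \<partial>lborel)"
      using nonneg \<open>0 < r\<close> by (intro nn_integral_cong ennreal_mult) auto
    also have "\<dots> = ennreal r * ennreal (1 / r)"
      using r by (simp add: nn_integral_multc c_def)
    also have "\<dots> = 1"
      using \<open>0 < r\<close> by (simp flip: ennreal_mult)
    finally show "(\<integral>\<^sup>+x. ennreal (\<eta> x * (1 / r)) \<partial>lborel) = 1" .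
  qed
qed

section \<open>Mollification\<close>

lemma nn_integral_lborel_shift:
  fixes z :: "'a::euclidean_space"
  assumes [measurable]: "F \<in> borel_measurable borel"
  shows "(\<integral>\<^sup>+x. F (x - z) \<partial>lborel) = (\<integral>\<^sup>+x. F x \<partial>lborel)"
    and "(\<integral>\<^sup>+x. F (z - x) \<partial>lborel) = (\<integral>\<^sup>+x. F x \<partial>lborel)"
proof -
  have "(\<integral>\<^sup>+x. F x \<partial>lborel) = (\<integral>\<^sup>+x. F x \<partial>distr lborel borel ((+) (- z)))"
    by (simp only: lborel_distr_plus)
  also have "\<dots> = (\<integral>\<^sup>+x. F (- z + x) \<partial>lborel)"
    by (subst nn_integral_distr) auto
  finally show shift: "(\<integral>\<^sup>+x. F (x - z) \<partial>lborel) = (\<integral>\<^sup>+x. F x \<partial>lborel)"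
    by simp
  have "(\<integral>\<^sup>+x. F x \<partial>lborel) =
      (\<integral>\<^sup>+x. F x \<partial>density (distr lborel borel (\<lambda>x. z + (-1) *\<^sub>R x)) (\<lambda>_. ennreal (\<bar>-1\<bar> ^ DIM('a))))"
    by (subst lborel_affine[of "-1" z]) simp_all
  also have "\<dots> = (\<integral>\<^sup>+x. F (z - x) \<partial>lborel)"
    by (simp add: nn_integral_density nn_integral_distr)
  finally show "(\<integral>\<^sup>+x. F (z - x) \<partial>lborel) = (\<integral>\<^sup>+x. F x \<partial>lborel)" ..
qed

lemma compact_support_uniformly_continuous:
  fixes f :: "'a::euclidean_space \<Rightarrow> 'b::real_normed_vector"
  assumes "continuous_on UNIV f" "\<And>x. R < norm x \<Longrightarrow> f x = 0"
  shows "uniformly_continuous_on UNIV f"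
  unfolding uniformly_continuous_on_def
proof (intro allI impI)
  fix e :: real assume "0 < e"
  \<comment> \<open>The margin 1 guarantees that two points at distance below 1 lie either both in
    this ball or both where \<open>f\<close> vanishes.\<close>
  have "uniformly_continuous_on (cball 0 (R + 1)) f"
    by (intro compact_uniformly_continuous continuous_on_subset[OF assms(1)]) auto
  then obtain d where d: "0 < d"
    "\<And>x y. x \<in> cball 0 (R + 1) \<Longrightarrow> y \<in> cball 0 (R + 1) \<Longrightarrow> dist y x < d \<Longrightarrow> dist (f y) (f x) < e"
    using \<open>0 < e\<close> unfolding uniformly_continuous_on_def by metis
  have "dist (f y) (f x) < e" if xy: "dist y x < min d 1" for x y
  proof (cases "norm x \<le> R + 1 \<and> norm y \<le> R + 1")
    case True
    then show ?thesis
      using d(2)[of x y] xy by simp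
  next
    case False
    have "\<bar>norm y - norm x\<bar> < 1"
      using norm_triangle_ineq3[of y x] xy by (simp add: dist_norm)
    then have "R < norm x" "R < norm y"
      using False by auto
    then show ?thesis
      using assms(2) \<open>0 < e\<close> by simp
  qed
  then show "\<exists>d>0. \<forall>x\<in>UNIV. \<forall>x'\<in>UNIV. dist x' x < d \<longrightarrow> dist (f x') (f x) < e"
    using d(1) by (intro exI[of _ "min d 1"]) auto
qed

text \<open>The gradient is uniformly continuous because its support is compact, so the
  linearization error is small uniformly in \<open>z\<close>. Uniformity allows differentiation of a
  convolution with a function that is merely integrable.\<close>

lemma test_function_uniform_linearization:
  fixes \<psi> :: "(real, 'n::finite) vec \<Rightarrow> real"
  assumes \<psi>: "\<psi> \<in> test_functions UNIV" and e: "0 < e"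
  obtains \<delta> where "0 < \<delta>"
    "\<And>z h. norm h < \<delta> \<Longrightarrow> \<bar>\<psi> (z + h) - \<psi> z - (\<Sum>i\<in>UNIV. h $ i * partial_deriv i \<psi> z)\<bar> \<le> e * norm h"
proof -
  define G where "G x = (\<chi> i. partial_deriv i \<psi> x)" for x
  have inner: "h \<bullet> G x = (\<Sum>i\<in>UNIV. h $ i * partial_deriv i \<psi> x)" for h x
    by (simp add: G_def inner_vec_def)
  obtain K where K: "smooth \<psi>" "compact K" "\<And>x i. x \<notin> K \<Longrightarrow> partial_deriv i \<psi> x = 0"
    using \<psi> by (auto elim: test_functionE)
  obtain R where R: "\<And>x. x \<in> K \<Longrightarrow> norm x \<le> R"
    using compact_imp_bounded[OF K(2)] by (auto simp: bounded_iff)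
  have "continuous_on UNIV (partial_deriv i \<psi>)" for i
    using K(1) by (intro smooth_continuous_on smooth_partial_deriv)
  then have "continuous_on UNIV G"
    unfolding G_def by (intro continuous_on_vec_lambda) auto
  moreover have "G x = 0" if "R < norm x" for x
    using K(3)[of x] R[of x] that by (auto simp: G_def vec_eq_iff)
  ultimately have "uniformly_continuous_on UNIV G"
    by (rule compact_support_uniformly_continuous)
  from uniformly_continuous_onE[OF this e]
  obtain \<delta> where \<delta>: "0 < \<delta>" "\<And>x y. dist y x < \<delta> \<Longrightarrow> dist (G y) (G x) < e"
    by auto
  have "\<bar>\<psi> (z + h) - \<psi> z - h \<bullet> G z\<bar> \<le> e * norm h" if "norm h < \<delta>" for z h
  proof -
    \<comment> \<open>Subtracting the linear part at \<open>z\<close> leaves a function whose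
      derivative is a difference of gradients, hence of norm at most \<open>e\<close> on the
      ball.\<close>
    define k where "k w = \<psi> w - w \<bullet> G z" for w
    have "norm (k (z + h) - k z) \<le> e * norm (z + h - z)"
    proof (rule differentiable_bound[where S="ball z \<delta>" and f'="\<lambda>w h. h \<bullet> G w - h \<bullet> G z"])
      fix w assume w: "w \<in> ball z \<delta>"
      have "(\<psi> has_derivative (\<lambda>h. h \<bullet> G w)) (at w)"
        using differentiable_imp_partial_deriv[OF smooth_differentiable[OF K(1)], of w] by (simp add: inner)
      then show "(k has_derivative (\<lambda>h. h \<bullet> G w - h \<bullet> G z)) (at w within ball z \<delta>)"
        unfolding k_def by (auto intro!: derivative_eq_intros intro: has_derivative_at_withinI)
      show "onorm (\<lambda>h. h \<bullet> G w - h \<bullet> G z) \<le> e"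
      proof (rule onorm_le)
        fix h
        have "norm (h \<bullet> G w - h \<bullet> G z) \<le> norm h * norm (G w - G z)"
          unfolding inner_diff_right[symmetric] by (simp add: Cauchy_Schwarz_ineq2)
        also have "\<dots> \<le> norm h * e"
          using \<delta>(2)[of w z] w by (intro mult_left_mono) (auto simp: dist_norm norm_minus_commute)
        finally show "norm (h \<bullet> G w - h \<bullet> G z) \<le> e * norm h"
          by (simp add: mult.commute)
      qed
    qed (use that \<delta> in \<open>auto simp: dist_norm\<close>)
    then show ?thesis
      by (simp add: k_def inner_add_left algebra_simps)
  qed
  then show ?thesis
    using that[of \<delta>] \<delta>(1) by (simp add: inner)
qed

section \<open>Convolution with a test function\<close>

definition conv ::
  "((real, 'n::finite) vec \<Rightarrow> real) \<Rightarrow> ((real, 'n) vec \<Rightarrow> 'b::{banach,second_countable_topology}) \<Rightarrow> (real, 'n) vec \<Rightarrow> 'b"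
  where "conv \<psi> f x = (LINT y|lborel. \<psi> (x - y) *\<^sub>R f y)"

lemma test_function_measurable: "\<phi> \<in> test_functions \<Omega> \<Longrightarrow> \<phi> \<in> borel_measurable borel"
  by (auto simp: test_functions_def intro: borel_measurable_continuous_onI smooth_continuous_on)

lemma test_function_integrable:
  fixes f :: "(real, 'n::finite) vec \<Rightarrow> 'b::{banach,second_countable_topology}"
  assumes \<phi>: "\<phi> \<in> test_functions \<Omega>" and f: "integrable lborel f"
  shows "integrable lborel (\<lambda>y. \<phi> (x - y) *\<^sub>R f y)" "integrable lborel (\<lambda>y. \<phi> y *\<^sub>R f y)"
proof -
  obtain M where M: "0 \<le> M" "\<And>x. \<bar>\<phi> x\<bar> \<le> M"
    using test_function_bounded[OF \<phi>] by metis
  have [measurable]: "\<phi> \<in> borel_measurable borel" "f \<in> borel_measurable borel"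
    using \<phi> f by (auto intro: test_function_measurable dest: borel_measurable_integrable)
  show "integrable lborel (\<lambda>y. \<phi> (x - y) *\<^sub>R f y)" "integrable lborel (\<lambda>y. \<phi> y *\<^sub>R f y)"
    using M by (auto intro!: Bochner_Integration.integrable_bound[OF integrable_scaleR_right[OF f, of M]] AE_I2 mult_right_mono)
qed

lemma conv_has_derivative:
  fixes f :: "(real, 'n::finite) vec \<Rightarrow> 'b::{banach,second_countable_topology}"
  assumes \<psi>: "\<psi> \<in> test_functions UNIV" and f: "integrable lborel f"
  shows "(conv \<psi> f has_derivative (\<lambda>h. \<Sum>i\<in>UNIV. (h $ i) *\<^sub>R conv (partial_deriv i \<psi>) f x)) (at x)"
  unfolding has_derivative_at_alt
proof (intro conjI allI impI)
  show "bounded_linear (\<lambda>h. \<Sum>i\<in>UNIV. (h $ i) *\<^sub>R conv (partial_deriv i \<psi>) f x)"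
    by (intro bounded_linear_sum bounded_linear_scaleR_const bounded_linear_vec_nth)
  fix e :: real assume e: "0 < e"
  define I where "I = (LINT y|lborel. norm (f y))"
  have I: "0 \<le> I"
    by (simp add: I_def)
  \<comment> \<open>The error is multiplied by the L^1 norm \<open>I\<close> of \<open>f\<close>;
    the denominator \<open>I + 1\<close> also covers \<open>I = 0\<close>.\<close>
  obtain \<delta> where \<delta>: "0 < \<delta>"
    "\<And>z h. norm h < \<delta> \<Longrightarrow> \<bar>\<psi> (z + h) - \<psi> z - (\<Sum>i\<in>UNIV. h $ i * partial_deriv i \<psi> z)\<bar> \<le> e / (I + 1) * norm h"
    using test_function_uniform_linearization[OF \<psi>, of "e / (I + 1)"] e I by auto
  have "norm (conv \<psi> f y - conv \<psi> f x - (\<Sum>i\<in>UNIV. ((y - x) $ i) *\<^sub>R conv (partial_deriv i \<psi>) f x)) \<le> e * norm (y - x)"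
    if y: "norm (y - x) < \<delta>" for y
  proof -
    define g where "g u = \<psi> (y - u) - \<psi> (x - u) - (\<Sum>i\<in>UNIV. (y - x) $ i * partial_deriv i \<psi> (x - u))" for u
    have g: "\<bar>g u\<bar> \<le> e / (I + 1) * norm (y - x)" for u
      using \<delta>(2)[OF y, of "x - u"] by (simp add: g_def algebra_simps)
    have g_eq: "g u *\<^sub>R f u = \<psi> (y - u) *\<^sub>R f u - \<psi> (x - u) *\<^sub>R f u
        - (\<Sum>i\<in>UNIV. ((y - x) $ i) *\<^sub>R (partial_deriv i \<psi> (x - u) *\<^sub>R f u))" for u
      by (simp add: g_def scaleR_diff_left scaleR_sum_left)
    note int = test_function_integrable(1)[OF \<psi> f] test_function_integrable(1)[OF test_function_partial_deriv[OF \<psi>] f]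
    have "conv \<psi> f y - conv \<psi> f x - (\<Sum>i\<in>UNIV. ((y - x) $ i) *\<^sub>R conv (partial_deriv i \<psi>) f x) = (LINT u|lborel. g u *\<^sub>R f u)"
      unfolding g_eq conv_def using int by (simp del: scaleR_scaleR vector_minus_component)
    also have "norm \<dots> \<le> (LINT u|lborel. norm (g u *\<^sub>R f u))"
      by (rule integral_norm_bound)
    also have "\<dots> \<le> (LINT u|lborel. (e / (I + 1) * norm (y - x)) * norm (f u))"
    proof (rule integral_mono)
      show "integrable lborel (\<lambda>u. norm (g u *\<^sub>R f u))"
        unfolding g_eq using int by (simp del: scaleR_scaleR vector_minus_component)
      show "norm (g u *\<^sub>R f u) \<le> (e / (I + 1) * norm (y - x)) * norm (f u)" for u
        unfolding norm_scaleR using g[of u] by (intro mult_right_mono) (simp_all only: real_norm_def norm_ge_zero)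
    qed (use f in simp)
    also have "\<dots> = e * norm (y - x) * (I / (I + 1))"
      by (simp add: I_def)
    also have "\<dots> \<le> e * norm (y - x) * 1"
      using e I by (intro mult_left_mono) auto
    finally show ?thesis
      by simp
  qed
  then show "\<exists>d>0. \<forall>y. norm (y - x) < d \<longrightarrow>
      norm (conv \<psi> f y - conv \<psi> f x - (\<Sum>i\<in>UNIV. ((y - x) $ i) *\<^sub>R conv (partial_deriv i \<psi>) f x)) \<le> e * norm (y - x)"
    using \<delta>(1) by blast
qed

lemma partial_deriv_conv:
  assumes "\<psi> \<in> test_functions UNIV" "integrable lborel f"
  shows "partial_deriv i (conv \<psi> f) = conv (partial_deriv i \<psi>) f"
  by (rule ext) (simp add: has_derivative_imp_partial_deriv[OF conv_has_derivative[OF assms]] axis_def if_distrib[of "\<lambda>c. c *\<^sub>R _"] cong: if_cong)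

lemma smooth_conv:
  fixes f :: "(real, 'n::finite) vec \<Rightarrow> 'b::{banach,second_countable_topology}"
  assumes "\<psi> \<in> test_functions UNIV" and f: "integrable lborel f"
  shows "smooth (conv \<psi> f)"
proof -
  have "diffk k (conv \<psi> f)" for k
    using assms(1)
  proof (induction k arbitrary: \<psi>)
    case (Suc k)
    then show ?case
      using conv_has_derivative[OF Suc.prems f]
      by (auto simp: partial_deriv_conv[OF Suc.prems f] differentiable_def intro: test_function_partial_deriv)
  qed simp
  then show ?thesis
    by (simp add: smooth_iff_diffk)
qed

section \<open>Density of continuous functions and continuity of translations in L^p\<close>

lemma norm_add3_powr_le:
  fixes a b c :: "'b::real_normed_vector"
  assumes "0 < p"
  shows "norm (a + b + c) powr p \<le> 3 powr p * (norm a powr p + norm b powr p + norm c powr p)"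
proof -
  define m where "m = max (norm a) (max (norm b) (norm c))"
  have "norm (a + b + c) \<le> norm a + norm b + norm c"
    by (meson add_mono norm_triangle_ineq order_refl order_trans)
  also have "\<dots> \<le> 3 * m"
    by (auto simp: m_def)
  finally have "norm (a + b + c) powr p \<le> (3 * m) powr p"
    using assms by (intro powr_mono2) auto
  also have "\<dots> = 3 powr p * m powr p"
    by (rule powr_mult)
  also have "m powr p \<le> norm a powr p + norm b powr p + norm c powr p"
    by (auto simp: m_def max_def)
  finally show ?thesis
    by (simp add: mult_left_mono)
qed

text \<open>Truncating the argument and the value at \<open>k\<close> changes nothing at a given
  point once \<open>k\<close> is large, and the error is dominated by \<open>f\<close>
  itself.\<close>

lemma Lp_dense_bounded:
  fixes f :: "'a::euclidean_space \<Rightarrow> 'b::euclidean_space"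
  assumes [measurable]: "f \<in> borel_measurable borel" and p: "0 < p"
    and fin: "(\<integral>\<^sup>+x. ennreal (norm (f x) powr p) \<partial>lborel) < top" and e: "0 < e"
  obtains k :: nat where
    "(\<integral>\<^sup>+x. ennreal (norm (f x - (if norm x \<le> k \<and> norm (f x) \<le> k then f x else 0)) powr p) \<partial>lborel) < e"
proof -
  define u where "u k x = ennreal (norm (f x - (if norm x \<le> real k \<and> norm (f x) \<le> real k then f x else 0)) powr p)" for k :: nat and x
  have [measurable]: "u k \<in> borel_measurable borel" for k
    unfolding u_def by measurable
  have "(\<lambda>k. \<integral>\<^sup>+x. u k x \<partial>lborel) \<longlonglongrightarrow> (\<integral>\<^sup>+x. 0 \<partial>(lborel :: 'a measure))"
  proof (rule nn_integral_dominated_convergence[where w="\<lambda>x. ennreal (norm (f x) powr p)"])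
    show "AE x in lborel. u k x \<le> ennreal (norm (f x) powr p)" for k
      by (auto simp: u_def)
    have "(\<lambda>k. u k x) \<longlonglongrightarrow> 0" for x
    proof (rule tendsto_eventually)
      obtain N :: nat where "max (norm x) (norm (f x)) \<le> real N"
        using real_arch_simple by blast
      then show "\<forall>\<^sub>F k in sequentially. u k x = 0"
        by (intro eventually_sequentiallyI[of N]) (auto simp: u_def)
    qed
    then show "AE x in lborel. (\<lambda>k. u k x) \<longlonglongrightarrow> 0"
      by simp
  qed (use fin in \<open>auto simp: top.not_eq_extremum\<close>)
  then have "\<forall>\<^sub>F k in sequentially. (\<integral>\<^sup>+x. u k x \<partial>lborel) < e"
    using e by (intro order_tendstoD) auto
  then obtain k where "(\<integral>\<^sup>+x. u k x \<partial>lborel) < e"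
    by (auto simp: eventually_sequentially)
  then show ?thesis
    using that unfolding u_def by blast
qed

text \<open>Measurability provides continuous functions \<open>G n\<close> converging to
  \<open>h\<close> a.e., but without any bound. Projecting the values onto the ball of radius
  \<open>k\<close>, which leaves those of \<open>h\<close> fixed, and multiplying by the continuous
  \<open>c\<close>, which is 1 up to radius \<open>k\<close> and 0 beyond \<open>k + 1\<close>,
  makes the sequence dominated.\<close>

lemma Lp_dense_continuous_bounded:
  fixes h :: "'a::euclidean_space \<Rightarrow> 'b::euclidean_space"
  assumes [measurable]: "h \<in> borel_measurable borel" and p: "0 < p" and e: "0 < e"
    and k: "0 \<le> k" "\<And>x. norm (h x) \<le> k" "\<And>x. k < norm x \<Longrightarrow> h x = 0"
  obtains g where "continuous_on UNIV g" "\<And>x. k + 1 < norm x \<Longrightarrow> g x = 0"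
    "(\<integral>\<^sup>+x. ennreal (norm (h x - g x) powr p) \<partial>lborel) < e"
proof -
  have "h measurable_on UNIV"
    by (simp add: measurable_on_iff_borel_measurable lebesgue_on_UNIV_eq measurable_completion)
  then obtain N G where N: "negligible N" and G: "\<And>n. continuous_on UNIV (G n)"
    "\<And>x. x \<notin> N \<Longrightarrow> (\<lambda>n. G n x) \<longlonglongrightarrow> h x"
    by (auto simp: measurable_on_def)
  define P where "P = closest_point (cball (0::'b) k)"
  define c where "c x = max 0 (min 1 (k + 1 - norm x))" for x :: 'a
  define u where "u n x = c x *\<^sub>R P (G n x)" for n x
  have P: "continuous_on UNIV P" "norm (P y) \<le> k" "norm y \<le> k \<Longrightarrow> P y = y" for y
    using k(1) closest_point_in_set[of "cball (0::'b) k" y]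
    by (auto simp: P_def intro!: continuous_on_closest_point closest_point_self)
  have u: "continuous_on UNIV (u n)" for n
    unfolding u_def c_def by (intro continuous_intros continuous_on_compose2[OF P(1) G(1)]) auto
  have u0: "u n x = 0" if "k + 1 < norm x" for n x
    using that by (simp add: u_def c_def)
  have [measurable]: "u n \<in> borel_measurable borel" for n
    using u by (rule borel_measurable_continuous_onI)
  have uk: "norm (u n x) \<le> k" for n x
  proof -
    have "norm (u n x) \<le> 1 * k"
      unfolding u_def norm_scaleR by (rule mult_mono) (auto simp: c_def P(2))
    then show ?thesis by simp
  qed
  have "(\<lambda>n. \<integral>\<^sup>+x. ennreal (norm (h x - u n x) powr p) \<partial>lborel) \<longlonglongrightarrow> (\<integral>\<^sup>+x. 0 \<partial>(lborel :: 'a measure))"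
  proof (rule nn_integral_dominated_convergence[where w="\<lambda>x. ennreal ((2 * k) powr p) * indicator (cball 0 (k + 1)) x"])
    have "(\<integral>\<^sup>+x. ennreal ((2 * k) powr p) * indicator (cball (0::'a) (k + 1)) x \<partial>lborel)
        = ennreal ((2 * k) powr p) * emeasure lborel (cball (0::'a) (k + 1))"
      by (simp add: nn_integral_cmult_indicator)
    also have "\<dots> < top"
      using emeasure_lborel_cball_finite[of "0::'a" "k + 1"] by (simp add: ennreal_mult_less_top less_top)
    finally show "(\<integral>\<^sup>+x. ennreal ((2 * k) powr p) * indicator (cball (0::'a) (k + 1)) x \<partial>lborel) < \<infinity>"
      by simp
    have "ennreal (norm (h x - u n x) powr p) \<le> ennreal ((2 * k) powr p) * indicator (cball 0 (k + 1)) x" for n x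
    proof (cases "norm x \<le> k + 1")
      case True
      have "norm (h x - u n x) \<le> 2 * k"
        using norm_triangle_ineq4[of "h x" "u n x"] k(2)[of x] uk[of n x] by linarith
      then show ?thesis
        using True p by (auto intro!: ennreal_leI powr_mono2)
    next
      case False
      then show ?thesis
        using u0[of x n] k(3)[of x] p by simp
    qed
    then show "AE x in lborel. ennreal (norm (h x - u n x) powr p) \<le> ennreal ((2 * k) powr p) * indicator (cball 0 (k + 1)) x" for n
      by simp
    have lim: "(\<lambda>n. ennreal (norm (h x - u n x) powr p)) \<longlonglongrightarrow> 0" if "x \<notin> N" for x
    proof -
      have "(\<lambda>n. u n x) \<longlonglongrightarrow> c x *\<^sub>R P (h x)"
        unfolding u_def using G(2)[OF that] P(1)
        by (intro tendsto_intros continuous_on_tendsto_compose[OF P(1)]) auto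
      also have "c x *\<^sub>R P (h x) = h x"
        using P(3)[OF k(2)[of x]] k(3)[of x] by (cases "norm x \<le> k") (auto simp: c_def)
      finally have "(\<lambda>n. norm (h x - u n x)) \<longlonglongrightarrow> 0"
        by (simp add: LIM_zero_iff tendsto_norm_zero_iff norm_minus_commute[of "h x"])
      then have "(\<lambda>n. norm (h x - u n x) powr p) \<longlonglongrightarrow> 0"
        using p by (intro tendsto_zero_powrI[where b=p]) auto
      then show ?thesis
        using tendsto_ennrealI by fastforce
    qed
    have "AE x in lebesgue. x \<notin> N"
      using N by (intro AE_not_in) (simp add: negligible_iff_null_sets)
    then have "AE x in lborel. x \<notin> N"
      by (simp only: AE_completion_iff)
    then show "AE x in lborel. (\<lambda>n. ennreal (norm (h x - u n x) powr p)) \<longlonglongrightarrow> 0"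
      by eventually_elim (rule lim)
    show "(\<lambda>x. ennreal (norm (h x - u n x) powr p)) \<in> borel_measurable lborel" for n
      by measurable
    show "(\<lambda>x. ennreal ((2 * k) powr p) * indicator (cball 0 (k + 1)) x) \<in> borel_measurable (lborel :: 'a measure)"
      by (intro borel_measurable_times_ennreal borel_measurable_const borel_measurable_indicator) simp
  qed simp
  then have "\<forall>\<^sub>F n in sequentially. (\<integral>\<^sup>+x. ennreal (norm (h x - u n x) powr p) \<partial>lborel) < e"
    using e by (intro order_tendstoD) auto
  then obtain n where "(\<integral>\<^sup>+x. ennreal (norm (h x - u n x) powr p) \<partial>lborel) < e"
    by (auto simp: eventually_sequentially)
  then show ?thesis
    using that[of "u n"] u u0 by blast
qed

lemma Lp_dense_continuous:
  fixes f :: "'a::euclidean_space \<Rightarrow> 'b::euclidean_space"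
  assumes [measurable]: "f \<in> borel_measurable borel" and p: "0 < p"
    and fin: "(\<integral>\<^sup>+x. ennreal (norm (f x) powr p) \<partial>lborel) < top" and e: "0 < (e :: real)"
  obtains g R where "continuous_on UNIV g" "\<And>x. R < norm x \<Longrightarrow> g x = 0"
    "(\<integral>\<^sup>+x. ennreal (norm (f x - g x) powr p) \<partial>lborel) < ennreal e"
proof -
  \<comment> \<open>Two errors below \<open>d\<close>, each multiplied by the factor
    \<open>3 powr p\<close> of \<open>norm_add3_powr_le\<close>, give \<open>e\<close>.\<close>
  define d where "d = e / (2 * 3 powr p)"
  have d: "0 < ennreal d"
    using e by (simp add: d_def)
  obtain k :: nat where k:
    "(\<integral>\<^sup>+x. ennreal (norm (f x - (if norm x \<le> k \<and> norm (f x) \<le> k then f x else 0)) powr p) \<partial>lborel) < ennreal d"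
    by (rule Lp_dense_bounded[OF assms(1) p fin d])
  define h where "h x = (if norm x \<le> k \<and> norm (f x) \<le> k then f x else 0)" for x
  have [measurable]: "h \<in> borel_measurable borel"
    unfolding h_def by measurable
  obtain g where g: "continuous_on UNIV g" "\<And>x. real k + 1 < norm x \<Longrightarrow> g x = 0"
    "(\<integral>\<^sup>+x. ennreal (norm (h x - g x) powr p) \<partial>lborel) < ennreal d"
    by (rule Lp_dense_continuous_bounded[of h p "ennreal d" "real k"]) (use p d in \<open>auto simp: h_def\<close>)
  have [measurable]: "g \<in> borel_measurable borel"
    using g(1) by (rule borel_measurable_continuous_onI)
  have "(\<integral>\<^sup>+x. ennreal (norm (f x - g x) powr p) \<partial>lborel)
      \<le> (\<integral>\<^sup>+x. ennreal (3 powr p) * (ennreal (norm (f x - h x) powr p) + ennreal (norm (h x - g x) powr p)) \<partial>lborel)"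
    using norm_add3_powr_le[OF p, of "f x - h x" "h x - g x" 0 for x] p
    by (intro nn_integral_mono) (auto simp flip: ennreal_plus ennreal_mult intro!: ennreal_leI)
  also have "\<dots> = ennreal (3 powr p) * ((\<integral>\<^sup>+x. ennreal (norm (f x - h x) powr p) \<partial>lborel)
      + (\<integral>\<^sup>+x. ennreal (norm (h x - g x) powr p) \<partial>lborel))"
    by (simp add: nn_integral_cmult nn_integral_add)
  also have "\<dots> < ennreal (3 powr p) * (ennreal d + ennreal d)"
    using g(3) k by (intro ennreal_mult_strict_left_mono add_strict_mono) (auto simp: h_def)
  also have "\<dots> = ennreal e"
    using e by (simp add: d_def flip: ennreal_plus ennreal_mult)
  finally show ?thesis
    using that[OF g(1,2)] by blast
qed

lemma translation_continuous_Lp: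
  fixes f :: "'a::euclidean_space \<Rightarrow> 'b::euclidean_space"
  assumes [measurable]: "f \<in> borel_measurable borel" and p: "0 < p"
    and fin: "(\<integral>\<^sup>+x. ennreal (norm (f x) powr p) \<partial>lborel) < top" and e: "0 < (e :: real)"
  obtains \<delta> where "0 < \<delta>"
    "\<And>z. norm z < \<delta> \<Longrightarrow> (\<integral>\<^sup>+x. ennreal (norm (f (x - z) - f x) powr p) \<partial>lborel) \<le> ennreal e"
proof -
  \<comment> \<open>Two approximation errors and one translation error of \<open>g\<close>, each at
    most \<open>d\<close> and multiplied by \<open>3 powr p\<close>, add up to
    \<open>e\<close>.\<close>
  define d where "d = e / (3 * 3 powr p)"
  have d: "0 < d"
    using e by (simp add: d_def)
  obtain g R where g: "continuous_on UNIV g" "\<And>x. R < norm x \<Longrightarrow> g x = 0"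
    "(\<integral>\<^sup>+x. ennreal (norm (f x - g x) powr p) \<partial>lborel) < ennreal d"
    by (rule Lp_dense_continuous[OF assms(1) p fin d]) (rule that, assumption, blast, assumption)
  have [measurable]: "g \<in> borel_measurable borel"
    using g(1) by (rule borel_measurable_continuous_onI)
  define V where "V = measure lborel (cball (0::'a) (R + 1))"
  have V: "emeasure lborel (cball (0::'a) (R + 1)) = ennreal V" "0 \<le> V"
    using emeasure_lborel_cball_finite[of "0::'a" "R + 1"] by (auto simp: V_def emeasure_eq_ennreal_measure)
  \<comment> \<open>For shifts shorter than 1 the difference of \<open>g\<close> and its translate
    is supported in the ball of radius \<open>R + 1\<close> with volume \<open>V\<close>. A
    pointwise bound \<open>\<eta>\<close> there contributes at most \<open>d\<close>; the
    denominator \<open>V + 1\<close> avoids a division by 0.\<close>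
  define \<eta> where "\<eta> = (d / (V + 1)) powr (1 / p)"
  have \<eta>: "0 < \<eta>" "\<eta> powr p = d / (V + 1)"
    using d V p by (auto simp: \<eta>_def powr_powr)
  have "uniformly_continuous_on UNIV g"
    using g(1,2) by (rule compact_support_uniformly_continuous)
  from uniformly_continuous_onE[OF this \<eta>(1)]
  obtain \<delta> where \<delta>: "0 < \<delta>" "\<And>x y. dist y x < \<delta> \<Longrightarrow> dist (g y) (g x) < \<eta>"
    by auto
  have "(\<integral>\<^sup>+x. ennreal (norm (f (x - z) - f x) powr p) \<partial>lborel) \<le> ennreal e" if z: "norm z < min \<delta> 1" for z
  proof -
    have "(\<integral>\<^sup>+x. ennreal (norm (g (x - z) - g x) powr p) \<partial>lborel)
        \<le> (\<integral>\<^sup>+x. ennreal (\<eta> powr p) * indicator (cball (0::'a) (R + 1)) x \<partial>lborel)"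
    proof (rule nn_integral_mono)
      fix x :: 'a
      show "ennreal (norm (g (x - z) - g x) powr p) \<le> ennreal (\<eta> powr p) * indicator (cball 0 (R + 1)) x"
      proof (cases "norm x \<le> R + 1")
        case True
        have "norm (g (x - z) - g x) \<le> \<eta>"
          using \<delta>(2)[of "x - z" x] z by (simp add: dist_norm)
        then show ?thesis
          using True p by (auto intro!: ennreal_leI powr_mono2)
      next
        case False
        then have "R < norm (x - z)"
          using norm_triangle_ineq2[of x z] z by simp
        then show ?thesis
          using False g(2)[of x] g(2)[of "x - z"] p by simp
      qed
    qed
    also have "\<dots> = ennreal (d / (V + 1) * V)"
      using V d by (simp add: nn_integral_cmult_indicator \<eta>(2) flip: ennreal_mult)
    also have "\<dots> \<le> ennreal d"
      using V d by (intro ennreal_leI) (simp add: field_simps)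
    finally have gz: "(\<integral>\<^sup>+x. ennreal (norm (g (x - z) - g x) powr p) \<partial>lborel) \<le> ennreal d" .
    have "(\<integral>\<^sup>+x. ennreal (norm (f (x - z) - f x) powr p) \<partial>lborel)
      \<le> (\<integral>\<^sup>+x. ennreal (3 powr p) * (ennreal (norm (f (x - z) - g (x - z)) powr p)
          + ennreal (norm (g (x - z) - g x) powr p) + ennreal (norm (f x - g x) powr p)) \<partial>lborel)"
    proof (rule nn_integral_mono)
      fix x
      have "norm (f (x - z) - f x) powr p \<le> 3 powr p * (norm (f (x - z) - g (x - z)) powr p
          + norm (g (x - z) - g x) powr p + norm (f x - g x) powr p)"
        using norm_add3_powr_le[OF p, of "f (x - z) - g (x - z)" "g (x - z) - g x" "g x - f x"]
        by (simp add: norm_minus_commute[of "g x"])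
      from ennreal_leI[OF this]
      show "ennreal (norm (f (x - z) - f x) powr p) \<le> ennreal (3 powr p) * (ennreal (norm (f (x - z) - g (x - z)) powr p)
          + ennreal (norm (g (x - z) - g x) powr p) + ennreal (norm (f x - g x) powr p))"
        by (simp add: ennreal_mult ennreal_plus)
    qed
    also have "\<dots> = ennreal (3 powr p) * ((\<integral>\<^sup>+x. ennreal (norm (f (x - z) - g (x - z)) powr p) \<partial>lborel)
          + (\<integral>\<^sup>+x. ennreal (norm (g (x - z) - g x) powr p) \<partial>lborel)
          + (\<integral>\<^sup>+x. ennreal (norm (f x - g x) powr p) \<partial>lborel))"
      by (simp add: nn_integral_cmult nn_integral_add)
    also have "(\<integral>\<^sup>+x. ennreal (norm (f (x - z) - g (x - z)) powr p) \<partial>lborel) = (\<integral>\<^sup>+x. ennreal (norm (f x - g x) powr p) \<partial>lborel)"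
      by (rule nn_integral_lborel_shift(1)[where F="\<lambda>x. ennreal (norm (f x - g x) powr p)"]) measurable
    also have "ennreal (3 powr p) * ((\<integral>\<^sup>+x. ennreal (norm (f x - g x) powr p) \<partial>lborel)
          + (\<integral>\<^sup>+x. ennreal (norm (g (x - z) - g x) powr p) \<partial>lborel)
          + (\<integral>\<^sup>+x. ennreal (norm (f x - g x) powr p) \<partial>lborel)) \<le> ennreal (3 powr p) * (ennreal d + ennreal d + ennreal d)"
      using g(3) gz by (intro mult_left_mono add_mono) auto
    also have "\<dots> = ennreal (3 powr p * (d + d + d))"
      using d by (simp only: ennreal_mult ennreal_plus add_nonneg_nonneg powr_ge_zero less_imp_le)
    also have "3 powr p * (d + d + d) = e"
      by (simp add: d_def)
    finally show ?thesis .
  qed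
  then show ?thesis
    using that[of "min \<delta> 1"] \<delta>(1) by auto
qed

section \<open>Convergence of mollifications in L^p\<close>

definition moll :: "nat \<Rightarrow> (real, 'n::finite) vec \<Rightarrow> real"
  where "moll n = (SOME \<psi>. smooth \<psi> \<and> (\<forall>x. 0 \<le> \<psi> x) \<and> (\<forall>x. inverse (Suc n) \<le> norm x \<longrightarrow> \<psi> x = 0) \<and>
           (\<integral>\<^sup>+x. ennreal (\<psi> x) \<partial>lborel) = 1)"

lemma moll:
  fixes x :: "(real, 'n::finite) vec"
  shows moll_smooth: "smooth (moll n :: (real, 'n) vec \<Rightarrow> real)" and moll_nonneg: "0 \<le> moll n x"
    and moll_eq_0: "inverse (Suc n) \<le> norm x \<Longrightarrow> moll n x = 0"
    and nn_integral_moll: "(\<integral>\<^sup>+x. ennreal (moll n (x :: (real, 'n) vec)) \<partial>lborel) = 1"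
proof -
  let ?P = "\<lambda>\<psi>::(real, 'n) vec \<Rightarrow> real. smooth \<psi> \<and> (\<forall>x. 0 \<le> \<psi> x) \<and> (\<forall>x. inverse (Suc n) \<le> norm x \<longrightarrow> \<psi> x = 0) \<and>
           (\<integral>\<^sup>+x. ennreal (\<psi> x) \<partial>lborel) = 1"
  have "\<exists>\<psi>. ?P \<psi>"
    by (rule mollifier_exists[of "inverse (real (Suc n))"]) (auto simp del: of_nat_Suc)
  then have "?P (moll n)"
    unfolding moll_def by (rule someI_ex)
  then show "smooth (moll n :: (real, 'n) vec \<Rightarrow> real)" "0 \<le> moll n x" "inverse (Suc n) \<le> norm x \<Longrightarrow> moll n x = 0"
    "(\<integral>\<^sup>+x. ennreal (moll n (x :: (real, 'n) vec)) \<partial>lborel) = 1"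
    by blast+
qed

lemma moll_test: "moll n \<in> test_functions UNIV"
proof -
  have "\<forall>x. x \<notin> cball 0 (inverse (Suc n)) \<longrightarrow> moll n x = 0"
    by (auto intro: moll_eq_0 simp del: of_nat_Suc)
  then show ?thesis
    unfolding test_functions_def by (intro CollectI conjI moll_smooth exI[of _ "cball 0 (inverse (Suc n))"]) auto
qed

text \<open>Jensen's inequality for the probability density \<open>moll n (x - y)\<close>, obtained
  from Hoelder with weights \<open>1 / p\<close> and \<open>1 - 1 / p\<close> after the density has
  been split accordingly. For \<open>p = 1\<close> the second factor is 1.\<close>

lemma conv_moll_error:
  fixes f :: "(real, 'n::finite) vec \<Rightarrow> 'b::euclidean_space"
  assumes f: "integrable lborel f" and p: "1 \<le> p"
  shows "ennreal (norm (conv (moll n) f x - f x) powr p)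
    \<le> (\<integral>\<^sup>+z. ennreal (moll n z) * ennreal (norm (f (x - z) - f x) powr p) \<partial>lborel)"
proof -
  have [measurable]: "f \<in> borel_measurable borel"
    using borel_measurable_integrable[OF f] by simp
  have [measurable]: "(moll n :: (real, 'n) vec \<Rightarrow> real) \<in> borel_measurable borel"
    by (rule test_function_measurable[OF moll_test])
  let ?\<psi> = "\<lambda>y. moll n (x - y)"
  have one: "(\<integral>\<^sup>+y. ennreal (?\<psi> y) \<partial>lborel) = 1"
    using nn_integral_lborel_shift(2)[of "\<lambda>y. ennreal (moll n y)" x] by (simp add: nn_integral_moll)
  have \<psi>: "integrable lborel ?\<psi>" "(LINT y|lborel. ?\<psi> y) = 1"
    using one by (auto simp: integrable_iff_bounded integral_eq_nn_integral moll_nonneg)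
  have int: "integrable lborel (\<lambda>y. ?\<psi> y *\<^sub>R f y)" "integrable lborel (\<lambda>y. ?\<psi> y *\<^sub>R f x)"
    using \<psi>(1) by (auto intro: test_function_integrable(1)[OF moll_test f])
  have eq: "conv (moll n) f x - f x = (LINT y|lborel. ?\<psi> y *\<^sub>R f y - ?\<psi> y *\<^sub>R f x)"
    using int \<psi> by (simp add: conv_def)
  have "ennreal (norm (conv (moll n) f x - f x)) \<le> (\<integral>\<^sup>+y. ennreal (norm (?\<psi> y *\<^sub>R f y - ?\<psi> y *\<^sub>R f x)) \<partial>lborel)"
    unfolding eq by (intro integral_norm_bound_ennreal Bochner_Integration.integrable_diff int)
  also have "\<dots> = (\<integral>\<^sup>+y. epowr (ennreal (?\<psi> y) * ennreal (norm (f y - f x) powr p)) (1 / p) * epowr (ennreal (?\<psi> y)) (1 - 1 / p) \<partial>lborel)"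
  proof (intro nn_integral_cong)
    fix y
    show "ennreal (norm (?\<psi> y *\<^sub>R f y - ?\<psi> y *\<^sub>R f x))
        = epowr (ennreal (?\<psi> y) * ennreal (norm (f y - f x) powr p)) (1 / p) * epowr (ennreal (?\<psi> y)) (1 - 1 / p)"
    proof -
      have "epowr (ennreal (?\<psi> y) * ennreal (norm (f y - f x) powr p)) (1 / p) * epowr (ennreal (?\<psi> y)) (1 - 1 / p)
        = (epowr (ennreal (?\<psi> y)) (1 / p) * epowr (ennreal (?\<psi> y)) (1 - 1 / p)) * epowr (ennreal (norm (f y - f x) powr p)) (1 / p)"
        using p by (simp add: epowr_mult ac_simps)
      also have "epowr (ennreal (?\<psi> y)) (1 / p) * epowr (ennreal (?\<psi> y)) (1 - 1 / p) = ennreal (?\<psi> y)"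
        using p by (simp flip: epowr_add)
      also have "epowr (ennreal (norm (f y - f x) powr p)) (1 / p) = ennreal (norm (f y - f x))"
        using p by (simp add: epowr_ennreal powr_powr)
      finally show ?thesis
        by (simp add: moll_nonneg ennreal_mult' flip: scaleR_diff_right)
    qed
  qed
  also have "\<dots> \<le> epowr (\<integral>\<^sup>+y. ennreal (?\<psi> y) * ennreal (norm (f y - f x) powr p) \<partial>lborel) (1 / p)
       * epowr (\<integral>\<^sup>+y. ennreal (?\<psi> y) \<partial>lborel) (1 - 1 / p)"
    using p by (intro nn_integral_Hoelder2) auto
  finally have "epowr (ennreal (norm (conv (moll n) f x - f x))) p
     \<le> epowr (epowr (\<integral>\<^sup>+y. ennreal (?\<psi> y) * ennreal (norm (f y - f x) powr p) \<partial>lborel) (1 / p)) p"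
    using p by (intro epowr_mono) (simp_all add: one)
  also have "\<dots> = (\<integral>\<^sup>+y. ennreal (?\<psi> y) * ennreal (norm (f y - f x) powr p) \<partial>lborel)"
    using p by (subst epowr_epowr) auto
  also have "\<dots> = (\<integral>\<^sup>+z. ennreal (moll n z) * ennreal (norm (f (x - z) - f x) powr p) \<partial>lborel)"
    using nn_integral_lborel_shift(2)[of "\<lambda>y. ennreal (?\<psi> y) * ennreal (norm (f y - f x) powr p)" x] by simp
  finally show ?thesis
    using p by (simp add: epowr_ennreal)
qed

text \<open>Integrating the pointwise error and exchanging the integrals leaves an average, over
  shifts \<open>z\<close> shorter than \<open>inverse (Suc n)\<close>, of the translation errors of
  \<open>f\<close> in L^p.\<close>

theorem conv_moll_tendsto_Lp:
  fixes f :: "(real, 'n::finite) vec \<Rightarrow> 'b::euclidean_space"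
  assumes f: "integrable lborel f" and p: "1 \<le> p"
    and fin: "(\<integral>\<^sup>+x. ennreal (norm (f x) powr p) \<partial>lborel) < top"
  shows "(\<lambda>n. \<integral>\<^sup>+x. ennreal (norm (conv (moll n) f x - f x) powr p) \<partial>lborel) \<longlonglongrightarrow> 0"
proof (rule order_tendstoI)
  fix a :: ennreal assume a: "0 < a"
  obtain e where e: "0 < e" "ennreal e < a"
  proof (cases a)
    case (real r)
    then show ?thesis
      using a that[of "r / 2"] by (simp add: ennreal_less_iff)
  next
    case top
    then show ?thesis
      using that[of 1] by simp
  qed
  have [measurable]: "f \<in> borel_measurable borel"
    using borel_measurable_integrable[OF f] by simp
  have [measurable]: "(moll n :: (real, 'n) vec \<Rightarrow> real) \<in> borel_measurable borel" for n
    by (rule test_function_measurable[OF moll_test])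
  obtain \<delta> where \<delta>: "0 < \<delta>"
    "\<And>z. norm z < \<delta> \<Longrightarrow> (\<integral>\<^sup>+x. ennreal (norm (f (x - z) - f x) powr p) \<partial>lborel) \<le> ennreal e"
    by (rule translation_continuous_Lp[of f p e]) (use p fin e in auto)
  obtain N where N: "inverse (real (Suc N)) < \<delta>"
    using reals_Archimedean[OF \<delta>(1)] by blast
  have "(\<integral>\<^sup>+x. ennreal (norm (conv (moll n) f x - f x) powr p) \<partial>lborel) < a" if "N \<le> n" for n
  proof -
    have n: "inverse (real (Suc n)) < \<delta>"
      using that N by (intro le_less_trans[OF _ N] le_imp_inverse_le) auto
    have "(\<integral>\<^sup>+x. ennreal (norm (conv (moll n) f x - f x) powr p) \<partial>lborel)
        \<le> (\<integral>\<^sup>+x. \<integral>\<^sup>+z. ennreal (moll n z) * ennreal (norm (f (x - z) - f x) powr p) \<partial>lborel \<partial>lborel)"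
      by (intro nn_integral_mono conv_moll_error f p)
    also have "\<dots> = (\<integral>\<^sup>+z. \<integral>\<^sup>+x. ennreal (moll n z) * ennreal (norm (f (x - z) - f x) powr p) \<partial>lborel \<partial>lborel)"
      by (rule lborel_pair.Fubini'[symmetric]) measurable
    also have "\<dots> = (\<integral>\<^sup>+z. ennreal (moll n z) * (\<integral>\<^sup>+x. ennreal (norm (f (x - z) - f x) powr p) \<partial>lborel) \<partial>lborel)"
      by (intro nn_integral_cong nn_integral_cmult) measurable
    also have "\<dots> \<le> (\<integral>\<^sup>+z. ennreal (moll n z) * ennreal e \<partial>(lborel :: (real, 'n) vec measure))"
    proof (rule nn_integral_mono)
      fix z :: "(real, 'n) vec"
      show "ennreal (moll n z) * (\<integral>\<^sup>+x. ennreal (norm (f (x - z) - f x) powr p) \<partial>lborel) \<le> ennreal (moll n z) * ennreal e"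
      proof (cases "norm z < inverse (Suc n)")
        case True
        then show ?thesis
          using n by (intro mult_left_mono \<delta>(2)) auto
      next
        case False
        then show ?thesis
          using moll_eq_0[of n z] by (simp del: of_nat_Suc)
      qed
    qed
    also have "\<dots> = ennreal e"
      by (simp add: nn_integral_multc nn_integral_moll)
    finally show ?thesis
      using e by simp
  qed
  then show "\<forall>\<^sub>F n in sequentially. (\<integral>\<^sup>+x. ennreal (norm (conv (moll n) f x - f x) powr p) \<partial>lborel) < a"
    unfolding eventually_sequentially by blast
qed simp

section \<open>Weak derivatives\<close>

lemma open_compact_exhaustion:
  fixes \<Omega> :: "'a::euclidean_space set"
  assumes "open \<Omega>"
  obtains C :: "nat \<Rightarrow> 'a set" where "\<forall>n. compact (C n) \<and> C n \<subseteq> \<Omega>" "incseq C" "(\<Union>n. C n) = \<Omega>"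
proof -
  obtain D where D: "countable D" "D \<subseteq> Pow \<Omega>" "\<And>X. X \<in> D \<Longrightarrow> \<exists>a b. X = cbox a b" "\<Union>D = \<Omega>"
    by (rule open_countable_Union_open_cbox[OF assms]) (rule that; simp)
  \<comment> \<open>The empty set is added to make the family nonempty, as its enumeration by
    \<open>from_nat_into\<close> requires, also when \<Omega> is empty.\<close>
  define E where "E = insert {} D"
  have E: "countable E" "E \<noteq> {}" "\<And>X. X \<in> E \<Longrightarrow> compact X" "\<And>X. X \<in> E \<Longrightarrow> X \<subseteq> \<Omega>" "\<Union>E = \<Omega>"
  proof -
    show "compact X" if "X \<in> E" for X
      using that D(3)[of X] compact_cbox by (auto simp: E_def)
  qed (use D in \<open>auto simp: E_def\<close>)
  define C where "C n = (\<Union>i\<le>n. from_nat_into E i)" for n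
  show ?thesis
  proof (rule that[of C])
    have "compact (C n)" "C n \<subseteq> \<Omega>" for n
      unfolding C_def using E(3,4) from_nat_into[OF E(2)] by (auto intro!: compact_UN)
    then show "\<forall>n. compact (C n) \<and> C n \<subseteq> \<Omega>"
      by blast
    show "incseq C"
      unfolding incseq_def C_def by (intro allI impI UN_mono) auto
    show "(\<Union>n. C n) = \<Omega>"
    proof -
      have "(\<Union>n. C n) = \<Union>(range (from_nat_into E))"
        by (auto simp: C_def)
      then show ?thesis
        by (simp add: range_from_nat_into[OF E(2,1)] E(5))
    qed
  qed
qed

lemma compact_neighbourhood:
  fixes K :: "'a::heine_borel set"
  assumes "compact K" "open \<Omega>" "K \<subseteq> \<Omega>"
  obtains K' \<epsilon> where "0 < \<epsilon>" "compact K'" "K' \<subseteq> \<Omega>" "K \<subseteq> K'" "\<forall>x\<in>K. cball x \<epsilon> \<subseteq> K'"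
proof -
  obtain \<epsilon> where \<epsilon>: "0 < \<epsilon>" "(\<Union>x\<in>K. ball x \<epsilon>) \<subseteq> \<Omega>"
    using compact_subset_open_imp_ball_epsilon_subset[OF assms] .
  have "cball x (\<epsilon> / 2) \<subseteq> ball x \<epsilon>" for x :: 'a
    using \<epsilon>(1) by auto
  then show ?thesis
    using \<epsilon> compact_minkowski_sum_cball[OF assms(1), of "\<epsilon> / 2"]
    by (intro that[of "\<epsilon> / 2" "\<Union>x\<in>K. cball x (\<epsilon> / 2)"]) (auto 0 3)
qed

section \<open>Borel representatives and the weak derivatives expressed by them\<close>

definition loc_int :: "'a::euclidean_space set \<Rightarrow> ('a \<Rightarrow> 'b::{banach,second_countable_topology}) \<Rightarrow> bool"
  where "loc_int \<Omega> f \<longleftrightarrow> f \<in> borel_measurable borel \<and> (\<forall>x. x \<notin> \<Omega> \<longrightarrow> f x = 0) \<and>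
    (\<forall>K. compact K \<and> K \<subseteq> \<Omega> \<longrightarrow> integrable lborel (\<lambda>x. indicator K x *\<^sub>R f x))"

definition repr :: "'a::euclidean_space set \<Rightarrow> ('a \<Rightarrow> 'b::{banach,second_countable_topology}) \<Rightarrow> ('a \<Rightarrow> 'b) \<Rightarrow> bool"
  where "repr \<Omega> u f \<longleftrightarrow> loc_int \<Omega> f \<and> (\<lambda>x. indicator \<Omega> x *\<^sub>R u x) \<in> borel_measurable lebesgue \<and>
    (AE x in lborel. x \<in> \<Omega> \<longrightarrow> u x = f x)"

text \<open>Weak derivatives in terms of Borel representatives that vanish off \<open>\<Omega>\<close>; for these,
  integration over \<open>\<Omega>\<close> with respect to \<^term>\<open>lebesgue\<close> can be replaced by integration with respect to
  \<^term>\<open>lborel\<close>, for which Fubini's theorem is available.\<close>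

definition weakd ::
  "(real, 'n::{finite,linorder}) vec set \<Rightarrow> ('n \<Rightarrow> nat) \<Rightarrow>
    ((real, 'n) vec \<Rightarrow> 'b::{banach,second_countable_topology}) \<Rightarrow> ((real, 'n) vec \<Rightarrow> 'b) \<Rightarrow> bool"
  where "weakd \<Omega> \<alpha> f w \<longleftrightarrow> loc_int \<Omega> f \<and> loc_int \<Omega> w \<and>
    (\<forall>\<phi>\<in>test_functions \<Omega>. (LINT x|lborel. mi_deriv \<alpha> \<phi> x *\<^sub>R f x) =
        (- 1) ^ mi_order \<alpha> *\<^sub>R (LINT x|lborel. \<phi> x *\<^sub>R w x))"

text \<open>Local integrability speaks of compact sets one at a time; measurability on all of
  \<Omega> follows as a limit along a compact exhaustion.\<close>

lemma locally_integrable_measurable: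
  fixes u :: "(real, 'n::finite) vec \<Rightarrow> 'b::{banach,second_countable_topology}"
  assumes "open \<Omega>" "locally_integrable \<Omega> u"
  shows "(\<lambda>x. indicator \<Omega> x *\<^sub>R u x) \<in> borel_measurable lebesgue"
proof -
  obtain C :: "nat \<Rightarrow> (real, 'n) vec set" where C: "\<forall>n. compact (C n) \<and> C n \<subseteq> \<Omega>" "incseq C" "(\<Union>n. C n) = \<Omega>"
    using open_compact_exhaustion[OF assms(1)] .
  show ?thesis
  proof (rule borel_measurable_LIMSEQ_metric)
    show "(\<lambda>x. indicator (C n) x *\<^sub>R u x) \<in> borel_measurable lebesgue" for n
      using assms(2) C(1) unfolding locally_integrable_def set_integrable_def
      by (auto dest: borel_measurable_integrable)
    show "(\<lambda>n. indicator (C n) x *\<^sub>R u x) \<longlonglongrightarrow> indicator \<Omega> x *\<^sub>R u x" for x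
      using LIMSEQ_indicator_incseq[OF C(2), of x] unfolding C(3) by (intro tendsto_intros) auto
  qed
qed

lemma lebesgue_Borel_representative:
  fixes g :: "'a::euclidean_space \<Rightarrow> 'b::euclidean_space"
  assumes "g \<in> borel_measurable lebesgue"
  obtains f where "f \<in> borel_measurable borel" "AE x in lborel. g x = f x"
proof -
  have "\<exists>f'\<in>borel_measurable lborel. AE x in lborel. g x \<bullet> b = f' x" for b
    using assms by (intro completion_ex_borel_measurable_real) auto
  then obtain F where F: "\<And>b. F b \<in> borel_measurable lborel" "\<And>b. AE x in lborel. g x \<bullet> b = F b x"
    by metis
  have [measurable]: "F b \<in> borel_measurable borel" for b
    using F(1)[of b] by simp
  have "AE x in lborel. \<forall>b\<in>Basis. g x \<bullet> b = F b x"
    using F(2) by (intro AE_finite_allI) auto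
  then have "AE x in lborel. g x = (\<Sum>b\<in>Basis. F b x *\<^sub>R b)"
  proof eventually_elim
    case (elim x)
    have "g x = (\<Sum>b\<in>Basis. (g x \<bullet> b) *\<^sub>R b)"
      by (simp add: euclidean_representation)
    with elim show ?case
      by simp
  qed
  then show ?thesis
    using that[of "\<lambda>x. \<Sum>b\<in>Basis. F b x *\<^sub>R b"] by measurable
qed

lemma compact_indicator_integrable_iff:
  fixes u f :: "'a::euclidean_space \<Rightarrow> 'b::{banach,second_countable_topology}"
  assumes f: "f \<in> borel_measurable borel" and u: "(\<lambda>x. indicator \<Omega> x *\<^sub>R u x) \<in> borel_measurable lebesgue"
    and ae: "AE x in lborel. x \<in> \<Omega> \<longrightarrow> u x = f x" and K: "compact K" "K \<subseteq> \<Omega>"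
  shows "set_integrable lebesgue K u \<longleftrightarrow> integrable lborel (\<lambda>x. indicator K x *\<^sub>R f x)"
proof -
  have [measurable]: "K \<in> sets borel"
    using K(1) by (rule borel_compact)
  have eq: "(\<lambda>x. indicator K x *\<^sub>R u x) = (\<lambda>x. indicator K x *\<^sub>R (indicator \<Omega> x *\<^sub>R u x))"
    using K(2) by (auto simp: fun_eq_iff split: split_indicator)
  have fK: "(\<lambda>x. indicator K x *\<^sub>R f x) \<in> borel_measurable lborel"
    using f by measurable
  have "set_integrable lebesgue K u \<longleftrightarrow> integrable lebesgue (\<lambda>x. indicator K x *\<^sub>R f x)"
    unfolding set_integrable_def
  proof (rule integrable_cong_AE)
    show "(\<lambda>x. indicator K x *\<^sub>R u x) \<in> borel_measurable lebesgue"
      unfolding eq by (intro borel_measurable_scaleR[OF _ u] borel_measurable_indicator) auto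
    show "(\<lambda>x. indicator K x *\<^sub>R f x) \<in> borel_measurable lebesgue"
      using fK by (rule measurable_completion)
    show "AE x in lebesgue. indicator K x *\<^sub>R u x = indicator K x *\<^sub>R f x"
      unfolding AE_completion_iff using ae by eventually_elim (use K(2) in \<open>auto simp: indicator_def\<close>)
  qed
  then show ?thesis
    by (simp only: integrable_completion[OF fK])
qed

lemma repr_exists:
  fixes u :: "(real, 'n::finite) vec \<Rightarrow> 'b::euclidean_space"
  assumes "open \<Omega>" "locally_integrable \<Omega> u"
  obtains f where "repr \<Omega> u f"
proof -
  note u = locally_integrable_measurable[OF assms]
  obtain g where g: "g \<in> borel_measurable borel" "AE x in lborel. indicator \<Omega> x *\<^sub>R u x = g x"
    using lebesgue_Borel_representative[OF u] .
  have [measurable]: "\<Omega> \<in> sets borel" "g \<in> borel_measurable borel"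
    using assms(1) g(1) by auto
  define f where "f x = indicator \<Omega> x *\<^sub>R g x" for x
  have f: "f \<in> borel_measurable borel"
    unfolding f_def by measurable
  have ae: "AE x in lborel. x \<in> \<Omega> \<longrightarrow> u x = f x"
    using g(2) by eventually_elim (auto simp: f_def)
  have "loc_int \<Omega> f"
    unfolding loc_int_def using f assms(2) compact_indicator_integrable_iff[OF f u ae]
    by (auto simp: f_def locally_integrable_def)
  then show ?thesis
    using that u ae by (simp add: repr_def)
qed

lemma repr_locally_integrable: "repr \<Omega> u f \<Longrightarrow> locally_integrable \<Omega> u"
  unfolding repr_def locally_integrable_def loc_int_def
  using compact_indicator_integrable_iff by blast

lemma repr_self: "open \<Omega> \<Longrightarrow> loc_int \<Omega> f \<Longrightarrow> repr \<Omega> f f"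
  unfolding repr_def by (auto simp: loc_int_def intro!: measurable_completion borel_measurable_scaleR)

lemma repr_LINT:
  fixes u f :: "(real, 'n::finite) vec \<Rightarrow> 'b::{banach,second_countable_topology}"
  assumes r: "repr \<Omega> u f" and \<phi>: "\<phi> \<in> borel_measurable borel"
  shows "(LINT x:\<Omega>|lebesgue. \<phi> x *\<^sub>R u x) = (LINT x|lborel. \<phi> x *\<^sub>R f x)"
proof -
  have f: "(\<lambda>x. \<phi> x *\<^sub>R f x) \<in> borel_measurable lborel"
    using r \<phi> by (auto simp: repr_def loc_int_def)
  have "(LINT x:\<Omega>|lebesgue. \<phi> x *\<^sub>R u x) = (LINT x|lebesgue. \<phi> x *\<^sub>R (indicator \<Omega> x *\<^sub>R u x))"
    unfolding set_lebesgue_integral_def by (simp add: mult.commute)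
  also have "\<dots> = (LINT x|lebesgue. \<phi> x *\<^sub>R f x)"
  proof (rule integral_cong_AE)
    show "(\<lambda>x. \<phi> x *\<^sub>R (indicator \<Omega> x *\<^sub>R u x)) \<in> borel_measurable lebesgue"
    proof (rule borel_measurable_scaleR)
      show "\<phi> \<in> borel_measurable lebesgue"
        using \<phi> by (intro measurable_completion) simp
    qed (use r in \<open>simp only: repr_def\<close>)
    show "(\<lambda>x. \<phi> x *\<^sub>R f x) \<in> borel_measurable lebesgue"
      using f by (rule measurable_completion)
    have "AE x in lborel. x \<in> \<Omega> \<longrightarrow> u x = f x" "\<And>x. x \<notin> \<Omega> \<Longrightarrow> f x = 0"
      using r by (auto simp: repr_def loc_int_def)
    then show "AE x in lebesgue. \<phi> x *\<^sub>R (indicator \<Omega> x *\<^sub>R u x) = \<phi> x *\<^sub>R f x"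
      unfolding AE_completion_iff by (auto simp: indicator_def elim!: eventually_mono)
  qed
  also have "\<dots> = (LINT x|lborel. \<phi> x *\<^sub>R f x)"
    by (rule integral_completion[OF f])
  finally show ?thesis .
qed

lemma has_weak_deriv_iff_weakd:
  fixes u f :: "(real, 'n::{finite,linorder}) vec \<Rightarrow> 'b::{banach,second_countable_topology}"
  assumes "repr \<Omega> u f" "repr \<Omega> w g"
  shows "has_weak_deriv \<Omega> \<alpha> u w \<longleftrightarrow> weakd \<Omega> \<alpha> f g"
proof -
  have "(LINT x:\<Omega>|lebesgue. mi_deriv \<alpha> \<phi> x *\<^sub>R u x) = (LINT x|lborel. mi_deriv \<alpha> \<phi> x *\<^sub>R f x)"
    "(LINT x:\<Omega>|lebesgue. \<phi> x *\<^sub>R w x) = (LINT x|lborel. \<phi> x *\<^sub>R g x)" if "\<phi> \<in> test_functions \<Omega>" for \<phi>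
    using that assms by (auto intro!: repr_LINT dest: test_function_measurable test_function_mi_deriv)
  then show ?thesis
    using assms repr_locally_integrable[OF assms(1)] repr_locally_integrable[OF assms(2)]
    unfolding has_weak_deriv_def weakd_def by (auto simp: repr_def)
qed

lemma loc_int_test_integrable:
  fixes f :: "(real, 'n::finite) vec \<Rightarrow> 'b::{banach,second_countable_topology}"
  assumes "loc_int \<Omega> f" "\<phi> \<in> test_functions \<Omega>"
  shows "integrable lborel (\<lambda>x. \<phi> x *\<^sub>R f x)"
proof -
  obtain K where K: "compact K" "K \<subseteq> \<Omega>" "\<And>x. x \<notin> K \<Longrightarrow> \<phi> x = 0"
    using assms(2) by (auto elim: test_functionE)
  have "integrable lborel (\<lambda>x. \<phi> x *\<^sub>R (indicator K x *\<^sub>R f x))"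
    using assms K by (intro test_function_integrable(2)[OF assms(2)]) (auto simp: loc_int_def)
  also have "(\<lambda>x. \<phi> x *\<^sub>R (indicator K x *\<^sub>R f x)) = (\<lambda>x. \<phi> x *\<^sub>R f x)"
  proof
    fix x show "\<phi> x *\<^sub>R (indicator K x *\<^sub>R f x) = \<phi> x *\<^sub>R f x"
      using K(3)[of x] by (cases "x \<in> K") auto
  qed
  finally show ?thesis .
qed

lemma moll_eq_0_outside:
  assumes "cball x (inverse (Suc n)) \<subseteq> K'" "y \<notin> K'"
  shows "moll n (x - y) = 0"
proof -
  have "\<not> dist x y \<le> inverse (Suc n)"
    using assms unfolding mem_cball[symmetric] by blast
  then show ?thesis
    by (intro moll_eq_0) (simp add: dist_norm del: of_nat_Suc)
qed

lemma test_function_reflect_moll: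
  assumes "compact K'" "K' \<subseteq> \<Omega>" "cball x (inverse (Suc n)) \<subseteq> K'"
  shows "(\<lambda>y. moll n (x - y)) \<in> test_functions \<Omega>"
proof -
  have "moll n (x - y) = 0" if "y \<notin> K'" for y
    using assms(3) that by (rule moll_eq_0_outside)
  then show ?thesis
    using assms(1,2) smooth_reflect[OF moll_smooth] unfolding test_functions_def by blast
qed

text \<open>Use \<open>y \<mapsto> moll n (x - y)\<close> as a test function.\<close>

lemma partial_deriv_conv_moll:
  fixes f w :: "(real, 'n::{finite,linorder}) vec \<Rightarrow> 'b::{banach,second_countable_topology}"
  assumes w: "weakd \<Omega> ((\<lambda>_. 0)(i := Suc 0)) f w"
    and K': "compact K'" "K' \<subseteq> \<Omega>" "cball x (inverse (Suc n)) \<subseteq> K'"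
  shows "partial_deriv i (conv (moll n) (\<lambda>y. indicator K' y *\<^sub>R f y)) x = conv (moll n) (\<lambda>y. indicator K' y *\<^sub>R w y) x"
proof -
  let ?\<phi> = "\<lambda>y. moll n (x - y)"
  have \<phi>: "?\<phi> \<in> test_functions \<Omega>"
    by (rule test_function_reflect_moll[OF K'])
  \<comment> \<open>The sign from reflecting the mollifier will cancel the sign in the definition of
    the weak derivative.\<close>
  have d\<phi>: "partial_deriv i ?\<phi> y = - partial_deriv i (moll n) (x - y)" for y
    by (intro partial_deriv_reflect smooth_differentiable moll_smooth)
  have supp: "?\<phi> y = 0" if "y \<notin> K'" for y
    using K'(3) that by (rule moll_eq_0_outside)
  then have dsupp: "partial_deriv i ?\<phi> y = 0" if "y \<notin> K'" for y
    using that by (rule partial_deriv_eq_0_outside[OF compact_imp_closed[OF K'(1)]])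
  have int: "integrable lborel (\<lambda>y. indicator K' y *\<^sub>R f y)"
    using w K' by (auto simp: weakd_def loc_int_def)
  have ord: "mi_order ((\<lambda>_. 0)(i := Suc 0)) = 1"
    using mi_order_Suc[of "\<lambda>_. 0" i] by simp
  have "partial_deriv i (conv (moll n) (\<lambda>y. indicator K' y *\<^sub>R f y)) x
      = (LINT y|lborel. partial_deriv i (moll n) (x - y) *\<^sub>R (indicator K' y *\<^sub>R f y))"
    by (subst partial_deriv_conv[OF moll_test int]) (simp add: conv_def)
  also have "\<dots> = (LINT y|lborel. - (partial_deriv i ?\<phi> y *\<^sub>R f y))"
    using dsupp by (intro Bochner_Integration.integral_cong refl) (auto simp: d\<phi> indicator_def)
  also have "\<dots> = - (LINT y|lborel. mi_deriv ((\<lambda>_. 0)(i := Suc 0)) ?\<phi> y *\<^sub>R f y)"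
    by (simp add: mi_deriv_single smooth_reflect moll_smooth)
  also have "\<dots> = (LINT y|lborel. ?\<phi> y *\<^sub>R w y)"
    using w \<phi> by (simp add: weakd_def ord)
  also have "\<dots> = conv (moll n) (\<lambda>y. indicator K' y *\<^sub>R w y) x"
    unfolding conv_def using supp by (intro Bochner_Integration.integral_cong refl) (auto simp: indicator_def)
  finally show ?thesis .
qed

section \<open>Uniqueness and iteration of weak derivatives\<close>

text \<open>For \<open>x\<close> in a compact \<open>K\<close> and large \<open>n\<close> the
  reflected mollifier is a test function, so the mollifications of \<open>h\<close> vanish on
  \<open>K\<close>. They converge to \<open>h\<close> in L^1 near \<open>K\<close>, which forces
  \<open>h\<close> to be 0 a.e. on \<open>K\<close>, and \<Omega> is a countable union of such
  sets.\<close>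

lemma fundamental_lemma:
  fixes h :: "(real, 'n::{finite,linorder}) vec \<Rightarrow> 'b::euclidean_space"
  assumes \<Omega>: "open \<Omega>" and h: "loc_int \<Omega> h"
    and zero: "\<And>\<phi>. \<phi> \<in> test_functions \<Omega> \<Longrightarrow> (LINT x|lborel. \<phi> x *\<^sub>R h x) = 0"
  shows "AE x in lborel. h x = 0"
proof -
  have [measurable]: "h \<in> borel_measurable borel"
    using h by (simp add: loc_int_def)
  have K0: "AE x in lborel. x \<in> K \<longrightarrow> h x = 0" if K: "compact K" "K \<subseteq> \<Omega>" for K
  proof -
    obtain K' \<epsilon> where K': "0 < \<epsilon>" "compact K'" "K' \<subseteq> \<Omega>" "K \<subseteq> K'" "\<forall>x\<in>K. cball x \<epsilon> \<subseteq> K'"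
      using compact_neighbourhood[OF K(1) \<Omega> K(2)] .
    have [measurable]: "K \<in> sets borel" "K' \<in> sets borel"
      using K(1) K'(2) by (auto intro: borel_compact)
    define H where "H y = indicator K' y *\<^sub>R h y" for y
    have H: "integrable lborel H"
      unfolding H_def using h K' by (simp add: loc_int_def)
    obtain N where N: "inverse (real (Suc N)) < \<epsilon>"
      using reals_Archimedean[OF K'(1)] by blast
    have conv0: "conv (moll n) H x = 0" if "N \<le> n" "x \<in> K" for n x
    proof -
      have "inverse (real (Suc n)) \<le> \<epsilon>"
        using that N le_imp_inverse_le[of "real (Suc N)" "real (Suc n)"] by linarith
      then have sub: "cball x (inverse (Suc n)) \<subseteq> K'"
        using K'(5) that(2) subset_cball[of _ \<epsilon> x] by (meson order_trans)
      have supp: "moll n (x - y) = 0" if "y \<notin> K'" for y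
        using sub that by (rule moll_eq_0_outside)
      have "conv (moll n) H x = (LINT y|lborel. moll n (x - y) *\<^sub>R h y)"
        unfolding conv_def H_def using supp by (intro Bochner_Integration.integral_cong refl) (auto simp: indicator_def)
      also have "\<dots> = 0"
        by (intro zero test_function_reflect_moll[OF K'(2,3) sub])
      finally show ?thesis .
    qed
    have "(\<integral>\<^sup>+x. ennreal (norm (H x)) * indicator K x \<partial>lborel) \<le> (\<integral>\<^sup>+x. ennreal (norm (conv (moll n) H x - H x) powr 1) \<partial>lborel)"
      if "N \<le> n" for n
      using conv0[OF that] by (intro nn_integral_mono) (auto simp: indicator_def)
    moreover have "(\<lambda>n. \<integral>\<^sup>+x. ennreal (norm (conv (moll n) H x - H x) powr 1) \<partial>lborel) \<longlonglongrightarrow> 0"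
      using H by (intro conv_moll_tendsto_Lp) (auto simp: integrable_iff_bounded)
    ultimately have "(\<integral>\<^sup>+x. ennreal (norm (H x)) * indicator K x \<partial>lborel) \<le> 0"
      by (intro tendsto_lowerbound[where F=sequentially]) (auto simp: eventually_sequentially)
    moreover have [measurable]: "H \<in> borel_measurable borel"
      unfolding H_def by measurable
    ultimately have "AE x in lborel. ennreal (norm (H x)) * indicator K x = 0"
      by (subst nn_integral_0_iff_AE[symmetric]) auto
    then show ?thesis
      by eventually_elim (use K'(4) in \<open>auto simp: H_def indicator_def split: if_splits\<close>)
  qed
  obtain C :: "nat \<Rightarrow> (real, 'n) vec set" where C: "\<forall>n. compact (C n) \<and> C n \<subseteq> \<Omega>" "incseq C" "(\<Union>n. C n) = \<Omega>"
    using open_compact_exhaustion[OF \<Omega>] .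
  have "AE x in lborel. \<forall>n. x \<in> C n \<longrightarrow> h x = 0"
    unfolding AE_all_countable using K0 C(1) by blast
  then show ?thesis
    by eventually_elim (use C(3) h in \<open>auto simp: loc_int_def\<close>)
qed

lemma loc_int_diff: "loc_int \<Omega> f \<Longrightarrow> loc_int \<Omega> g \<Longrightarrow> loc_int \<Omega> (\<lambda>x. f x - g x)"
  by (auto simp: loc_int_def scaleR_diff_right)

lemma loc_int_add: "loc_int \<Omega> f \<Longrightarrow> loc_int \<Omega> g \<Longrightarrow> loc_int \<Omega> (\<lambda>x. f x + g x)"
  by (auto simp: loc_int_def scaleR_add_right)

lemma weakd_unique:
  fixes f w w' :: "(real, 'n::{finite,linorder}) vec \<Rightarrow> 'b::euclidean_space"
  assumes "open \<Omega>" "weakd \<Omega> \<alpha> f w" "weakd \<Omega> \<alpha> f w'"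
  shows "AE x in lborel. w x = w' x"
proof -
  have "AE x in lborel. w x - w' x = 0"
  proof (rule fundamental_lemma[OF assms(1)])
    show "loc_int \<Omega> (\<lambda>x. w x - w' x)"
      using assms by (auto simp: weakd_def intro: loc_int_diff)
    fix \<phi> assume \<phi>: "\<phi> \<in> test_functions \<Omega>"
    have "(- 1) ^ mi_order \<alpha> *\<^sub>R (LINT x|lborel. \<phi> x *\<^sub>R w x) = (- 1) ^ mi_order \<alpha> *\<^sub>R (LINT x|lborel. \<phi> x *\<^sub>R w' x)"
      using assms(2,3) \<phi> by (simp add: weakd_def)
    then have "(LINT x|lborel. \<phi> x *\<^sub>R w x) = (LINT x|lborel. \<phi> x *\<^sub>R w' x)"
      by simp
    moreover have "(LINT x|lborel. \<phi> x *\<^sub>R (w x - w' x)) = (LINT x|lborel. \<phi> x *\<^sub>R w x) - (LINT x|lborel. \<phi> x *\<^sub>R w' x)"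
      unfolding scaleR_diff_right using assms(2,3)
      by (intro Bochner_Integration.integral_diff loc_int_test_integrable[OF _ \<phi>]) (auto simp: weakd_def)
    ultimately show "(LINT x|lborel. \<phi> x *\<^sub>R (w x - w' x)) = 0"
      by simp
  qed
  then show ?thesis
    by simp
qed

lemma weakd_zero: "loc_int \<Omega> f \<Longrightarrow> weakd \<Omega> (\<lambda>_. 0) f f"
  by (simp add: weakd_def mi_deriv_zero)

text \<open>Insert the test function \<open>partial_deriv i \<phi>\<close> in the definition of
  \<open>w\<close>. Higher weak derivatives are thereby reached one order at a time, so that the
  Sobolev inequality and the product rule are needed only for first derivatives.\<close>

lemma weakd_Suc_iff:
  fixes f w w' :: "(real, 'n::{finite,linorder}) vec \<Rightarrow> 'b::{banach,second_countable_topology}"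
  assumes w: "weakd \<Omega> \<alpha> f w"
  shows "weakd \<Omega> (\<alpha>(i := Suc (\<alpha> i))) f w' \<longleftrightarrow> weakd \<Omega> ((\<lambda>_. 0)(i := Suc 0)) w w'"
proof -
  have ord: "mi_order ((\<lambda>_. 0)(i := Suc 0)) = 1"
    using mi_order_Suc[of "\<lambda>_. 0" i] by simp
  have "(LINT x|lborel. mi_deriv (\<alpha>(i := Suc (\<alpha> i))) \<phi> x *\<^sub>R f x)
      = (- 1) ^ mi_order \<alpha> *\<^sub>R (LINT x|lborel. mi_deriv ((\<lambda>_. 0)(i := Suc 0)) \<phi> x *\<^sub>R w x)"
    if \<phi>: "\<phi> \<in> test_functions \<Omega>" for \<phi>
  proof -
    have "smooth \<phi>"
      using \<phi> by (auto elim: test_functionE)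
    with w test_function_partial_deriv[OF \<phi>, of i] show ?thesis
      by (simp add: weakd_def mi_deriv_Suc mi_deriv_single)
  qed
  moreover have "(- 1) ^ mi_order \<alpha> *\<^sub>R a = (- 1) ^ Suc (mi_order \<alpha>) *\<^sub>R b \<longleftrightarrow> a = (- 1) ^ 1 *\<^sub>R b" for a b :: 'b
    by (cases "even (mi_order \<alpha>)") (auto simp: minus_equation_iff)
  ultimately show ?thesis
    using w unfolding weakd_def mi_order_Suc ord by auto
qed

section \<open>The product rule\<close>

definition loc_Lp :: "'a::euclidean_space set \<Rightarrow> real \<Rightarrow> ('a \<Rightarrow> 'b::real_normed_vector) \<Rightarrow> bool"
  where "loc_Lp \<Omega> r f \<longleftrightarrow>
    (\<forall>K. compact K \<and> K \<subseteq> \<Omega> \<longrightarrow> (\<integral>\<^sup>+x\<in>K. ennreal (norm (f x) powr r) \<partial>lborel) < top)"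

lemma epowr_tendsto_0:
  assumes "(X \<longlongrightarrow> 0) F" "0 < a"
  shows "((\<lambda>n. epowr (X n) a) \<longlongrightarrow> 0) F"
proof (rule order_tendstoI)
  fix e :: ennreal assume "0 < e"
  then have "0 < epowr e (1 / a)"
    using epowr_eq_0_iff[of e "1 / a"] by (auto simp: zero_less_iff_neq_zero)
  then have "\<forall>\<^sub>F n in F. X n < epowr e (1 / a)"
    using assms(1) by (intro order_tendstoD)
  then show "\<forall>\<^sub>F n in F. epowr (X n) a < e"
  proof eventually_elim
    case (elim n)
    show ?case
    proof (rule ccontr)
      assume "\<not> epowr (X n) a < e"
      then have "epowr e (1 / a) \<le> epowr (epowr (X n) a) (1 / a)"
        using assms(2) by (intro epowr_mono) auto
      with elim assms(2) show False
        by (simp add: epowr_epowr)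
    qed
  qed
qed simp

text \<open>Hoelder with three functions: the indicator of \<open>K\<close> is the third and takes
  the weight left over when \<open>1 / r + 1 / s\<close> is less than 1.\<close>

lemma nn_integral_mult_le_Lp:
  fixes f g :: "'a::euclidean_space \<Rightarrow> 'b::{real_normed_algebra,second_countable_topology}"
  assumes [measurable]: "f \<in> borel_measurable borel" "g \<in> borel_measurable borel" "K \<in> sets borel"
    and r: "1 \<le> r" "1 \<le> s" "1 / r + 1 / s \<le> 1"
  shows "(\<integral>\<^sup>+x\<in>K. ennreal (norm (f x * g x)) \<partial>lborel)
    \<le> epowr (\<integral>\<^sup>+x\<in>K. ennreal (norm (f x) powr r) \<partial>lborel) (1 / r) *
       epowr (\<integral>\<^sup>+x\<in>K. ennreal (norm (g x) powr s) \<partial>lborel) (1 / s) *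
       epowr (emeasure lborel K) (1 - 1 / r - 1 / s)"
proof -
  define F where "F j x = (if j = 0 then ennreal (norm (f x) powr r) * indicator K x
     else if j = 1 then ennreal (norm (g x) powr s) * indicator K x else indicator K x)" for j :: nat and x
  define w where "w j = (if j = 0 then 1 / r else if j = 1 then 1 / s else 1 - 1 / r - 1 / s)" for j :: nat
  have J: "{..<3::nat} = {0, 1, 2}"
    by auto
  have [measurable]: "F j \<in> borel_measurable lborel" for j
    unfolding F_def by (cases "j = 0"; cases "j = 1") auto
  have "(\<integral>\<^sup>+x\<in>K. ennreal (norm (f x * g x)) \<partial>lborel) \<le> (\<integral>\<^sup>+x. (\<Prod>j<3. epowr (F j x) (w j)) \<partial>lborel)"
  proof (rule nn_integral_mono)
    fix x
    have "ennreal (norm (f x * g x)) \<le> ennreal (norm (f x)) * ennreal (norm (g x))"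
      by (simp add: norm_mult_ineq flip: ennreal_mult)
    also have "\<dots> = (\<Prod>j<3. epowr (F j x) (w j))" if "x \<in> K"
      using that r unfolding J by (simp add: F_def w_def epowr_ennreal powr_powr)
    finally show "ennreal (norm (f x * g x)) * indicator K x \<le> (\<Prod>j<3. epowr (F j x) (w j))"
      by (auto simp: indicator_def)
  qed
  also have "\<dots> \<le> (\<Prod>j<3. epowr (\<integral>\<^sup>+x. F j x \<partial>lborel) (w j))"
    using r unfolding J by (intro nn_integral_Hoelder) (auto simp: w_def)
  also have "\<dots> = epowr (\<integral>\<^sup>+x\<in>K. ennreal (norm (f x) powr r) \<partial>lborel) (1 / r) *
       epowr (\<integral>\<^sup>+x\<in>K. ennreal (norm (g x) powr s) \<partial>lborel) (1 / s) *
       epowr (emeasure lborel K) (1 - 1 / r - 1 / s)"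
    unfolding J by (simp add: F_def w_def mult.assoc)
  finally show ?thesis .
qed

lemma loc_int_mult:
  fixes f g :: "'a::euclidean_space \<Rightarrow> 'b::{real_normed_algebra,banach,second_countable_topology}"
  assumes "loc_int \<Omega> f" "loc_int \<Omega> g" "loc_Lp \<Omega> r f" "loc_Lp \<Omega> s g" "1 \<le> r" "1 \<le> s" "1 / r + 1 / s \<le> 1"
  shows "loc_int \<Omega> (\<lambda>x. f x * g x)"
  unfolding loc_int_def
proof (intro conjI allI impI)
  have [measurable]: "f \<in> borel_measurable borel" "g \<in> borel_measurable borel"
    using assms(1,2) by (auto simp: loc_int_def)
  show "(\<lambda>x. f x * g x) \<in> borel_measurable borel"
    by measurable
  show "f x * g x = 0" if "x \<notin> \<Omega>" for x
    using assms(1) that by (simp add: loc_int_def)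
  fix K assume K: "compact K \<and> K \<subseteq> \<Omega>"
  then have [measurable]: "K \<in> sets borel"
    by (auto intro: borel_compact)
  have "epowr (\<integral>\<^sup>+x\<in>K. ennreal (norm (f x) powr r) \<partial>lborel) (1 / r) < top"
    "epowr (\<integral>\<^sup>+x\<in>K. ennreal (norm (g x) powr s) \<partial>lborel) (1 / s) < top"
    "epowr (emeasure lborel K) (1 - 1 / r - 1 / s) < top"
    using K assms(3,4) emeasure_compact_finite[of K] by (auto simp: loc_Lp_def less_top[symmetric] epowr_eq_top_iff)
  then have "(\<integral>\<^sup>+x\<in>K. ennreal (norm (f x * g x)) \<partial>lborel) < top"
    by (intro le_less_trans[OF nn_integral_mult_le_Lp[OF _ _ _ assms(5-7)]]) (auto simp: ennreal_mult_less_top)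
  moreover have "ennreal (norm (indicator K x *\<^sub>R (f x * g x))) = ennreal (norm (f x * g x)) * indicator K x" for x
    by (simp split: split_indicator)
  ultimately have "(\<integral>\<^sup>+x. ennreal (norm (indicator K x *\<^sub>R (f x * g x))) \<partial>lborel) < top"
    by (simp only:)
  then show "integrable lborel (\<lambda>x. indicator K x *\<^sub>R (f x * g x))"
    by (simp add: integrable_iff_bounded)
qed

text \<open>Test functions are real while \<open>A\<close> has values in an algebra. Expanding
  \<open>A\<close> in the basis turns the product into test functions
  \<open>\<phi> x * (A x \<bullet> b)\<close>, to which weak derivatives can be applied.\<close>

lemma smooth_mult_test_integrable:
  fixes A G :: "(real, 'n::finite) vec \<Rightarrow> 'b::{euclidean_space,real_normed_algebra}"
  assumes \<phi>: "\<phi> \<in> test_functions \<Omega>" and A: "smooth A" and G: "loc_int \<Omega> G"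
  shows "integrable lborel (\<lambda>x. \<phi> x *\<^sub>R (A x * G x))"
    and "(LINT x|lborel. \<phi> x *\<^sub>R (A x * G x)) = (\<Sum>b\<in>Basis. b * (LINT x|lborel. (\<phi> x * (A x \<bullet> b)) *\<^sub>R G x))"
proof -
  have eq: "\<phi> x *\<^sub>R (A x * G x) = (\<Sum>b\<in>Basis. b * ((\<phi> x * (A x \<bullet> b)) *\<^sub>R G x))" for x
  proof -
    have "A x * G x = (\<Sum>b\<in>Basis. (A x \<bullet> b) *\<^sub>R b) * G x"
      by (simp add: euclidean_representation)
    then show ?thesis
      by (simp add: sum_distrib_right scaleR_sum_right)
  qed
  have int: "integrable lborel (\<lambda>x. (\<phi> x * (A x \<bullet> b)) *\<^sub>R G x)" for b
    by (rule loc_int_test_integrable[OF G test_function_mult[OF \<phi> smooth_linear[OF bounded_linear_inner_left A]]])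
  then show "integrable lborel (\<lambda>x. \<phi> x *\<^sub>R (A x * G x))"
    unfolding eq by (intro Bochner_Integration.integrable_sum integrable_mult_right)
  show "(LINT x|lborel. \<phi> x *\<^sub>R (A x * G x)) = (\<Sum>b\<in>Basis. b * (LINT x|lborel. (\<phi> x * (A x \<bullet> b)) *\<^sub>R G x))"
    unfolding eq using int
    by (subst Bochner_Integration.integral_sum) (auto intro!: integrable_mult_right sum.cong simp del: mult_scaleR_right)
qed

text \<open>Mollification converges in L^r on the whole space, \<open>G\<close> is in L^s near the
  support of \<open>\<phi>\<close>, and Hoelder turns this into convergence of the products in L^1.
  The indicator of \<open>K'\<close> makes the mollified function globally integrable without
  changing the limit on the support of \<open>\<phi>\<close>.\<close>

lemma conv_moll_mult_tendsto:
  fixes f G :: "(real, 'n::{finite,linorder}) vec \<Rightarrow> 'b::{euclidean_space,real_normed_algebra}"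
  assumes \<phi>: "\<phi> \<in> test_functions \<Omega>" and K': "compact K'" "K' \<subseteq> \<Omega>" "\<And>x. x \<notin> K' \<Longrightarrow> \<phi> x = 0"
    and f: "loc_int \<Omega> f" "loc_Lp \<Omega> r f" and G: "loc_int \<Omega> G" "loc_Lp \<Omega> s G"
    and r: "1 \<le> r" "1 \<le> s" "1 / r + 1 / s \<le> 1"
  shows "(\<lambda>n. LINT x|lborel. \<phi> x *\<^sub>R (conv (moll n) (\<lambda>y. indicator K' y *\<^sub>R f y) x * G x))
    \<longlonglongrightarrow> (LINT x|lborel. \<phi> x *\<^sub>R (f x * G x))"
proof -
  define H where "H y = indicator K' y *\<^sub>R f y" for y
  have [measurable]: "K' \<in> sets borel"
    using K'(1) by (rule borel_compact)
  have [measurable]: "f \<in> borel_measurable borel" "G \<in> borel_measurable borel"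
    using f G by (auto simp: loc_int_def)
  have [measurable]: "H \<in> borel_measurable borel"
    unfolding H_def by measurable
  have H: "integrable lborel H"
    using f K' by (simp add: H_def[abs_def] loc_int_def)
  have "ennreal (norm (H x) powr r) = ennreal (norm (f x) powr r) * indicator K' x" for x
    using r by (simp add: H_def split: split_indicator)
  then have Hr: "(\<integral>\<^sup>+x. ennreal (norm (H x) powr r) \<partial>lborel) < top"
    using f(2) K' by (simp add: loc_Lp_def)
  have [measurable]: "conv (moll n) H \<in> borel_measurable borel" for n
    by (intro borel_measurable_continuous_onI smooth_continuous_on smooth_conv moll_test H)
  have eq: "\<phi> x *\<^sub>R (f x * G x) = \<phi> x *\<^sub>R (H x * G x)" for x
    using K'(3)[of x] by (cases "x \<in> K'") (auto simp: H_def)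
  obtain M where M: "0 \<le> M" "\<And>x. \<bar>\<phi> x\<bar> \<le> M"
    using test_function_bounded[OF \<phi>] by metis
  define C where "C = epowr (\<integral>\<^sup>+x\<in>K'. ennreal (norm (G x) powr s) \<partial>lborel) (1 / s) *
       epowr (emeasure lborel K') (1 - 1 / r - 1 / s)"
  have "epowr (\<integral>\<^sup>+x\<in>K'. ennreal (norm (G x) powr s) \<partial>lborel) (1 / s) < top"
    "epowr (emeasure lborel K') (1 - 1 / r - 1 / s) < top"
    using K' G(2) emeasure_compact_finite[of K'] by (auto simp: loc_Lp_def less_top[symmetric] epowr_eq_top_iff)
  then have C: "C < top"
    unfolding C_def by (auto simp: ennreal_mult_less_top)
  show ?thesis
    unfolding eq H_def[symmetric]
  proof (rule tendsto_L1_int)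
    show "integrable lborel (\<lambda>x. \<phi> x *\<^sub>R (conv (moll n) H x * G x))" for n
      by (intro smooth_mult_test_integrable(1)[OF \<phi> _ G(1)] smooth_conv moll_test H)
    have "integrable lborel (\<lambda>x. \<phi> x *\<^sub>R (f x * G x))"
      by (rule loc_int_test_integrable[OF loc_int_mult[OF f(1) G(1) f(2) G(2) r] \<phi>])
    then show "integrable lborel (\<lambda>x. \<phi> x *\<^sub>R (H x * G x))"
      by (simp only: eq)
    define X where "X n = (\<integral>\<^sup>+x. ennreal (norm (conv (moll n) H x - H x) powr r) \<partial>lborel)" for n
    have le: "(\<integral>\<^sup>+x. ennreal (norm (\<phi> x *\<^sub>R (conv (moll n) H x * G x) - \<phi> x *\<^sub>R (H x * G x))) \<partial>lborel)
        \<le> (ennreal M * C) * epowr (X n) (1 / r)" for n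
    proof -
      have "(\<integral>\<^sup>+x. ennreal (norm (\<phi> x *\<^sub>R (conv (moll n) H x * G x) - \<phi> x *\<^sub>R (H x * G x))) \<partial>lborel)
          \<le> (\<integral>\<^sup>+x. ennreal M * (ennreal (norm ((conv (moll n) H x - H x) * G x)) * indicator K' x) \<partial>lborel)"
      proof (rule nn_integral_mono)
        fix x
        have "\<phi> x *\<^sub>R (conv (moll n) H x * G x) - \<phi> x *\<^sub>R (H x * G x) = \<phi> x *\<^sub>R ((conv (moll n) H x - H x) * G x)"
          by (simp add: left_diff_distrib scaleR_diff_right)
        then have "ennreal (norm (\<phi> x *\<^sub>R (conv (moll n) H x * G x) - \<phi> x *\<^sub>R (H x * G x)))
            = ennreal \<bar>\<phi> x\<bar> * ennreal (norm ((conv (moll n) H x - H x) * G x))"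
          by (simp add: ennreal_mult)
        also have "\<dots> \<le> ennreal M * (ennreal (norm ((conv (moll n) H x - H x) * G x)) * indicator K' x)"
          using M K'(3)[of x] by (cases "x \<in> K'") (auto intro!: mult_right_mono ennreal_leI)
        finally show "ennreal (norm (\<phi> x *\<^sub>R (conv (moll n) H x * G x) - \<phi> x *\<^sub>R (H x * G x)))
            \<le> ennreal M * (ennreal (norm ((conv (moll n) H x - H x) * G x)) * indicator K' x)" .
      qed
      also have "\<dots> = ennreal M * (\<integral>\<^sup>+x\<in>K'. ennreal (norm ((conv (moll n) H x - H x) * G x)) \<partial>lborel)"
        by (rule nn_integral_cmult) measurable
      also have "\<dots> \<le> ennreal M * (epowr (\<integral>\<^sup>+x\<in>K'. ennreal (norm (conv (moll n) H x - H x) powr r) \<partial>lborel) (1 / r) *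
         epowr (\<integral>\<^sup>+x\<in>K'. ennreal (norm (G x) powr s) \<partial>lborel) (1 / s) *
         epowr (emeasure lborel K') (1 - 1 / r - 1 / s))"
        using r by (intro mult_left_mono nn_integral_mult_le_Lp) auto
      also have "\<dots> \<le> ennreal M * (epowr (X n) (1 / r) * 
         epowr (\<integral>\<^sup>+x\<in>K'. ennreal (norm (G x) powr s) \<partial>lborel) (1 / s) *
         epowr (emeasure lborel K') (1 - 1 / r - 1 / s))"
        unfolding X_def using r
        by (intro mult_left_mono mult_right_mono epowr_mono nn_integral_mono) (auto simp: indicator_def)
      finally show ?thesis
        by (simp add: C_def ac_simps)
    qed
    have lim: "(\<lambda>n. (ennreal M * C) * epowr (X n) (1 / r)) \<longlonglongrightarrow> (ennreal M * C) * 0"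
    proof (rule ennreal_tendsto_cmult)
      show "ennreal M * C < top"
        using C by (simp add: ennreal_mult_less_top)
      have "X \<longlonglongrightarrow> 0"
        unfolding X_def using r by (intro conv_moll_tendsto_Lp H Hr)
      then show "(\<lambda>n. epowr (X n) (1 / r)) \<longlonglongrightarrow> 0"
        using r by (intro epowr_tendsto_0) auto
    qed
    show "(\<lambda>n. \<integral>\<^sup>+x. ennreal (norm (\<phi> x *\<^sub>R (conv (moll n) H x * G x) - \<phi> x *\<^sub>R (H x * G x))) \<partial>lborel) \<longlonglongrightarrow> 0"
      by (rule tendsto_sandwich[OF _ _ tendsto_const lim[unfolded mult_zero_right]])
         (intro always_eventually allI le zero_le)+
  qed
qed

text \<open>Mollifying \<open>f\<close> suffices: \<open>\<phi>\<close> times a component of the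
  smooth \<open>F n\<close> is a test function, admissible in the definition of \<open>g'\<close>.
  The products \<open>f * g\<close>, \<open>f' * g\<close> and \<open>f * g'\<close> come with
  separate pairs of exponents because the integrability available in the application depends on the
  orders of the derivatives involved.\<close>

theorem weakd_mult:
  fixes f g f' g' :: "(real, 'n::{finite,linorder}) vec \<Rightarrow> 'b::{euclidean_space,real_normed_algebra}"
  assumes \<Omega>: "open \<Omega>"
    and f: "weakd \<Omega> ((\<lambda>_. 0)(i := Suc 0)) f f'" and g: "weakd \<Omega> ((\<lambda>_. 0)(i := Suc 0)) g g'"
    and Lp0: "loc_Lp \<Omega> r\<^sub>0 f" "loc_Lp \<Omega> s\<^sub>0 g" "1 \<le> r\<^sub>0" "1 \<le> s\<^sub>0" "1 / r\<^sub>0 + 1 / s\<^sub>0 \<le> 1"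
    and Lp1: "loc_Lp \<Omega> r\<^sub>1 f'" "loc_Lp \<Omega> s\<^sub>1 g" "1 \<le> r\<^sub>1" "1 \<le> s\<^sub>1" "1 / r\<^sub>1 + 1 / s\<^sub>1 \<le> 1"
    and Lp2: "loc_Lp \<Omega> r\<^sub>2 f" "loc_Lp \<Omega> s\<^sub>2 g'" "1 \<le> r\<^sub>2" "1 \<le> s\<^sub>2" "1 / r\<^sub>2 + 1 / s\<^sub>2 \<le> 1"
  shows "weakd \<Omega> ((\<lambda>_. 0)(i := Suc 0)) (\<lambda>x. f x * g x) (\<lambda>x. f' x * g x + f x * g' x)"
proof -
  have li: "loc_int \<Omega> f" "loc_int \<Omega> f'" "loc_int \<Omega> g" "loc_int \<Omega> g'"
    using f g by (auto simp: weakd_def)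
  note fg = loc_int_mult[OF li(1,3) Lp0] and f'g = loc_int_mult[OF li(2,3) Lp1] and fg' = loc_int_mult[OF li(1,4) Lp2]
  have ord: "mi_order ((\<lambda>_. 0)(i := Suc 0)) = 1"
    using mi_order_Suc[of "\<lambda>_. 0" i] by simp
  have "(LINT x|lborel. mi_deriv ((\<lambda>_. 0)(i := Suc 0)) \<phi> x *\<^sub>R (f x * g x))
      = (- 1) ^ 1 *\<^sub>R (LINT x|lborel. \<phi> x *\<^sub>R (f' x * g x + f x * g' x))"
    if \<phi>: "\<phi> \<in> test_functions \<Omega>" for \<phi>
  proof -
    obtain K where K: "smooth \<phi>" "compact K" "K \<subseteq> \<Omega>" "\<And>x. x \<notin> K \<Longrightarrow> \<phi> x = 0" "\<And>x i. x \<notin> K \<Longrightarrow> partial_deriv i \<phi> x = 0"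
      using test_functionE[OF \<phi>] by metis
    obtain K' \<epsilon> where K': "0 < \<epsilon>" "compact K'" "K' \<subseteq> \<Omega>" "K \<subseteq> K'" "\<forall>x\<in>K. cball x \<epsilon> \<subseteq> K'"
      using compact_neighbourhood[OF K(2) \<Omega> K(3)] .
    obtain N where N: "inverse (real (Suc N)) < \<epsilon>"
      using reals_Archimedean[OF K'(1)] by blast
    note d\<phi> = test_function_partial_deriv[OF \<phi>, of i]
    define F where "F n = conv (moll n) (\<lambda>y. indicator K' y *\<^sub>R f y)" for n
    define F' where "F' n = conv (moll n) (\<lambda>y. indicator K' y *\<^sub>R f' y)" for n
    have F: "smooth (F n)" "smooth (F' n)" for n
      unfolding F_def F'_def using li K' by (auto intro!: smooth_conv moll_test simp: loc_int_def)
    have id: "(LINT x|lborel. \<phi> x *\<^sub>R (F' n x * g x)) + (LINT x|lborel. partial_deriv i \<phi> x *\<^sub>R (F n x * g x))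
        = - (LINT x|lborel. \<phi> x *\<^sub>R (F n x * g' x))" if n: "N \<le> n" for n
    proof -
      have sub: "cball x (inverse (Suc n)) \<subseteq> K'" if "x \<in> K" for x
      proof -
        have "inverse (real (Suc n)) \<le> \<epsilon>"
          using n N le_imp_inverse_le[of "real (Suc N)" "real (Suc n)"] by linarith
        then show ?thesis
          using K'(5) that subset_cball[of _ \<epsilon> x] by (meson order_trans)
      qed
      \<comment> \<open>The identity for one real component of \<open>F n\<close>; multiplying by
        the basis vectors and summing recovers the product in the algebra.\<close>
      have *: "(LINT x|lborel. (\<phi> x * (F' n x \<bullet> b)) *\<^sub>R g x) + (LINT x|lborel. (partial_deriv i \<phi> x * (F n x \<bullet> b)) *\<^sub>R g x)
          = - (LINT x|lborel. (\<phi> x * (F n x \<bullet> b)) *\<^sub>R g' x)" for b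
      proof -
        have sm: "smooth (\<lambda>x. F n x \<bullet> b)" "smooth (\<lambda>x. F' n x \<bullet> b)"
          using smooth_linear[OF bounded_linear_inner_left F(1)] smooth_linear[OF bounded_linear_inner_left F(2)] by auto
        have \<chi>: "(\<lambda>x. \<phi> x * (F n x \<bullet> b)) \<in> test_functions \<Omega>"
          by (rule test_function_mult[OF \<phi> sm(1)])
        have "partial_deriv i (\<lambda>x. \<phi> x * (F n x \<bullet> b)) x = \<phi> x * (F' n x \<bullet> b) + partial_deriv i \<phi> x * (F n x \<bullet> b)" for x
        proof -
          have "partial_deriv i (\<lambda>x. \<phi> x * (F n x \<bullet> b)) x
              = \<phi> x * partial_deriv i (\<lambda>x. F n x \<bullet> b) x + partial_deriv i \<phi> x * (F n x \<bullet> b)"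
            by (intro partial_deriv_bilinear[OF bounded_bilinear_mult] smooth_differentiable K(1) sm)
          also have "partial_deriv i (\<lambda>x. F n x \<bullet> b) x = partial_deriv i (F n) x \<bullet> b"
            by (intro partial_deriv_linear[OF bounded_linear_inner_left] smooth_differentiable F)
          \<comment> \<open>The mollification commutes with the derivative only where the mollifying
            ball stays in \<open>K'\<close>, in particular on \<open>K\<close>; elsewhere
            \<open>\<phi>\<close> vanishes.\<close>
          also have "\<phi> x * (partial_deriv i (F n) x \<bullet> b) = \<phi> x * (F' n x \<bullet> b)"
          proof (cases "x \<in> K")
            case True
            then show ?thesis
              unfolding F_def F'_def by (simp add: partial_deriv_conv_moll[OF f K'(2,3) sub])
          qed (simp add: K(4))
          finally show ?thesis .
        qed
        then have "(LINT x|lborel. (\<phi> x * (F' n x \<bullet> b) + partial_deriv i \<phi> x * (F n x \<bullet> b)) *\<^sub>R g x)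
            = (LINT x|lborel. mi_deriv ((\<lambda>_. 0)(i := Suc 0)) (\<lambda>x. \<phi> x * (F n x \<bullet> b)) x *\<^sub>R g x)"
          using \<chi> by (subst mi_deriv_single) (auto elim: test_functionE)
        also have "\<dots> = - (LINT x|lborel. (\<phi> x * (F n x \<bullet> b)) *\<^sub>R g' x)"
          using g \<chi> by (simp add: weakd_def ord)
        also have "(LINT x|lborel. (\<phi> x * (F' n x \<bullet> b) + partial_deriv i \<phi> x * (F n x \<bullet> b)) *\<^sub>R g x)
            = (LINT x|lborel. (\<phi> x * (F' n x \<bullet> b)) *\<^sub>R g x) + (LINT x|lborel. (partial_deriv i \<phi> x * (F n x \<bullet> b)) *\<^sub>R g x)"
          unfolding scaleR_add_left
          by (intro Bochner_Integration.integral_add loc_int_test_integrable[OF li(3)] test_function_mult[OF \<phi>] test_function_mult[OF d\<phi>] sm)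
        finally show ?thesis .
      qed
      have "(LINT x|lborel. \<phi> x *\<^sub>R (F' n x * g x)) + (LINT x|lborel. partial_deriv i \<phi> x *\<^sub>R (F n x * g x))
        = (\<Sum>b\<in>Basis. b * ((LINT x|lborel. (\<phi> x * (F' n x \<bullet> b)) *\<^sub>R g x) + (LINT x|lborel. (partial_deriv i \<phi> x * (F n x \<bullet> b)) *\<^sub>R g x)))"
        by (simp add: smooth_mult_test_integrable(2)[OF \<phi> F(2) li(3)] smooth_mult_test_integrable(2)[OF d\<phi> F(1) li(3)]
            distrib_left sum.distrib)
      also have "\<dots> = - (LINT x|lborel. \<phi> x *\<^sub>R (F n x * g' x))"
        by (simp add: * smooth_mult_test_integrable(2)[OF \<phi> F(1) li(4)] sum_negf)
      finally show ?thesis .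
    qed
    have out: "\<phi> x = 0" "partial_deriv i \<phi> x = 0" if "x \<notin> K'" for x
      using that K'(4) K(4,5) by auto
    have lim1: "(\<lambda>n. (LINT x|lborel. \<phi> x *\<^sub>R (F' n x * g x)) + (LINT x|lborel. partial_deriv i \<phi> x *\<^sub>R (F n x * g x)))
       \<longlonglongrightarrow> (LINT x|lborel. \<phi> x *\<^sub>R (f' x * g x)) + (LINT x|lborel. partial_deriv i \<phi> x *\<^sub>R (f x * g x))"
      unfolding F_def F'_def
      by (intro tendsto_add conv_moll_mult_tendsto[OF \<phi> K'(2,3) out(1) li(2) Lp1(1) li(3) Lp1(2-5)]
          conv_moll_mult_tendsto[OF d\<phi> K'(2,3) out(2) li(1) Lp0(1) li(3) Lp0(2-5)])
    have lim2: "(\<lambda>n. - (LINT x|lborel. \<phi> x *\<^sub>R (F n x * g' x))) \<longlonglongrightarrow> - (LINT x|lborel. \<phi> x *\<^sub>R (f x * g' x))"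
      unfolding F_def by (intro tendsto_minus conv_moll_mult_tendsto[OF \<phi> K'(2,3) out(1) li(1) Lp2(1) li(4) Lp2(2-5)])
    have ev: "\<forall>\<^sub>F n in sequentially. - (LINT x|lborel. \<phi> x *\<^sub>R (F n x * g' x)) =
        (LINT x|lborel. \<phi> x *\<^sub>R (F' n x * g x)) + (LINT x|lborel. partial_deriv i \<phi> x *\<^sub>R (F n x * g x))"
      using id unfolding eventually_sequentially by (intro exI[of _ N]) simp
    have sum0: "(LINT x|lborel. \<phi> x *\<^sub>R (f' x * g x)) + (LINT x|lborel. partial_deriv i \<phi> x *\<^sub>R (f x * g x))
       = - (LINT x|lborel. \<phi> x *\<^sub>R (f x * g' x))"
      by (rule LIMSEQ_unique[OF lim1 Lim_transform_eventually[OF lim2 ev]])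
    have "(LINT x|lborel. partial_deriv i \<phi> x *\<^sub>R (f x * g x))
        = - (LINT x|lborel. \<phi> x *\<^sub>R (f' x * g x)) - (LINT x|lborel. \<phi> x *\<^sub>R (f x * g' x))"
    proof -
      have "b = - a - c" if "a + b = - c" for a b c :: 'b
      proof -
        have "b = (a + b) - a"
          by simp
        also have "\<dots> = - a - c"
          unfolding that by (simp add: algebra_simps)
        finally show ?thesis .
      qed
      from this[OF sum0] show ?thesis .
    qed
    then show ?thesis
      using loc_int_test_integrable[OF f'g \<phi>] loc_int_test_integrable[OF fg' \<phi>] K(1)
      by (simp add: mi_deriv_single scaleR_add_right)
  qed
  then show ?thesis
    using fg loc_int_add[OF f'g fg'] by (simp add: weakd_def ord)
qed

section \<open>A weighted Sobolev inequality\<close>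

lemma sum_powr_le:
  fixes a :: "'i \<Rightarrow> real"
  assumes "finite J" "0 < p" "\<And>j. j \<in> J \<Longrightarrow> 0 \<le> a j"
  shows "(\<Sum>j\<in>J. a j) powr p \<le> real (card J) powr p * (\<Sum>j\<in>J. a j powr p)"
proof (cases "J = {}")
  case False
  define m where "m = Max (a ` J)"
  have m: "a j \<le> m" if "j \<in> J" for j
    using that assms(1) by (auto simp: m_def)
  obtain k where k: "k \<in> J" "m = a k"
  proof -
    have "m \<in> a ` J"
      unfolding m_def using False assms(1) by (intro Max_in) auto
    then show ?thesis
      using that by blast
  qed
  have "(\<Sum>j\<in>J. a j) \<le> real (card J) * m"
    using sum_bounded_above[of J a m] m by simp
  then have "(\<Sum>j\<in>J. a j) powr p \<le> (real (card J) * m) powr p"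
    using assms by (intro powr_mono2 sum_nonneg) auto
  also have "\<dots> = real (card J) powr p * a k powr p"
    using k assms(3)[of k] by (simp add: powr_mult)
  also have "\<dots> \<le> real (card J) powr p * (\<Sum>j\<in>J. a j powr p)"
    using k assms(1) by (intro mult_left_mono member_le_sum) auto
  finally show ?thesis .
qed (use assms in auto)

lemma epowr_add_le:
  assumes "0 \<le> a"
  shows "epowr (x + y) a \<le> epowr 2 a * (epowr x a + epowr y a)"
proof -
  have "x + y \<le> max x y + max x y"
    by (intro add_mono) auto
  then have "epowr (x + y) a \<le> epowr (2 * max x y) a"
    using assms by (intro epowr_mono) (simp_all add: mult_2)
  also have "\<dots> = epowr 2 a * epowr (max x y) a"
    using assms by (rule epowr_mult)
  also have "epowr (max x y) a \<le> epowr x a + epowr y a"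
    by (cases "x \<le> y") (simp_all add: max_def)
  finally show ?thesis
    by (simp add: mult_left_mono)
qed

lemma powr_add_le:
  fixes x y :: real
  assumes "0 < p" "0 \<le> x" "0 \<le> y"
  shows "(x + y) powr p \<le> 2 powr p * (x powr p + y powr p)"
  using sum_powr_le[of "UNIV :: bool set" p "\<lambda>b. if b then x else y"] assms by (simp add: UNIV_bool add_ac)

text \<open>The inequality \<open>Sobolev_C1\<close> is applied to \<open>\<kappa>\<close> times a
  mollification of \<open>f\<close>, a continuously differentiable function of compact support. Its
  gradient converges in L^p to that of the product, which \<open>S\<close> dominates, and Fatou's
  lemma along an a.e. convergent subsequence yields the bound for \<open>f\<close>. The powers of 2
  are the price for separating \<open>S\<close> from the mollification error.\<close>

lemma Sobolev_cutoff:
  fixes f :: "(real, 'n::{finite,linorder}) vec \<Rightarrow> 'b::euclidean_space" and p q :: real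
    and \<kappa> :: "(real, 'n) vec \<Rightarrow> real"
  assumes p: "1 < p" "p < CARD('n)" and q: "1 / q = 1 / p - 1 / CARD('n)"
    and \<Omega>: "open \<Omega>" and D: "\<And>i. weakd \<Omega> ((\<lambda>_. 0)(i := Suc 0)) f (D i)"
    and Lp: "loc_Lp \<Omega> p f" "\<And>i. loc_Lp \<Omega> p (D i)"
    and \<kappa>: "\<And>x. \<kappa> differentiable at x" "\<And>i. continuous_on UNIV (partial_deriv i \<kappa>)"
    and K: "compact K" "K \<subseteq> \<Omega>" "\<And>x. x \<notin> K \<Longrightarrow> \<kappa> x = 0"
  defines "S \<equiv> \<lambda>x. \<Sum>i\<in>UNIV. \<bar>\<kappa> x\<bar> * norm (D i x) + \<bar>partial_deriv i \<kappa> x\<bar> * norm (f x)"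
  shows "(\<integral>\<^sup>+x. ennreal (norm (\<kappa> x *\<^sub>R f x) powr q) \<partial>lborel)
    \<le> ennreal ((q * (1 - 1 / CARD('n))) powr q) * (epowr 2 (q / p) * epowr (ennreal (2 powr p) * (\<integral>\<^sup>+x. ennreal (S x powr p) \<partial>lborel)) (q / p))"
proof -
  have "1 / q > 0"
    using p q by (simp add: frac_less2)
  then have q0: "0 < q"
    by simp
  define Cq where "Cq = ennreal ((q * (1 - 1 / CARD('n))) powr q)"
  have li: "loc_int \<Omega> f" "loc_int \<Omega> (D i)" for i
    using D[of i] by (auto simp: weakd_def)
  then have [measurable]: "f \<in> borel_measurable borel" "D i \<in> borel_measurable borel" for i
    by (auto simp: loc_int_def)
  have \<kappa>_cont: "continuous_on UNIV \<kappa>"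
    using \<kappa>(1) by (simp add: continuous_at_imp_continuous_on differentiable_imp_continuous_within)
  have [measurable]: "\<kappa> \<in> borel_measurable borel" "partial_deriv i \<kappa> \<in> borel_measurable borel" for i
    using \<kappa>_cont \<kappa>(2) by (auto intro: borel_measurable_continuous_onI)
  have d\<kappa>0: "partial_deriv i \<kappa> x = 0" if "x \<notin> K" for i x
    using partial_deriv_eq_0_outside[OF compact_imp_closed[OF K(1)]] K(3) that by blast
  obtain K' \<epsilon> where K': "0 < \<epsilon>" "compact K'" "K' \<subseteq> \<Omega>" "K \<subseteq> K'" "\<forall>x\<in>K. cball x \<epsilon> \<subseteq> K'"
    using compact_neighbourhood[OF K(1) \<Omega> K(2)] .
  have [measurable]: "K' \<in> sets borel" "K \<in> sets borel"
    using K'(2) K(1) by (auto intro: borel_compact)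
  obtain N where N: "inverse (real (Suc N)) < \<epsilon>"
    using reals_Archimedean[OF K'(1)] by blast
  \<comment> \<open>Cutting off to \<open>K'\<close> makes the convolutions globally defined; for
    \<open>n\<close> at least \<open>N\<close> their values and derivatives on \<open>K\<close> do
    not notice it.\<close>
  define H where "H y = indicator K' y *\<^sub>R f y" for y
  define E where "E i y = indicator K' y *\<^sub>R D i y" for i y
  have int: "integrable lborel H" "integrable lborel (E i)" for i
    using li K'(2,3) by (auto simp: H_def[abs_def] E_def[abs_def] loc_int_def)
  have pH: "ennreal (norm (H x) powr p) = ennreal (norm (f x) powr p) * indicator K' x"
    and pE: "ennreal (norm (E i x) powr p) = ennreal (norm (D i x) powr p) * indicator K' x" for i x
    using p by (auto simp: H_def E_def split: split_indicator)
  have fin: "(\<integral>\<^sup>+x. ennreal (norm (H x) powr p) \<partial>lborel) < top" "(\<integral>\<^sup>+x. ennreal (norm (E i x) powr p) \<partial>lborel) < top" for i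
    using Lp K'(2,3) by (auto simp: pH pE loc_Lp_def)
  define hn where "hn n = conv (moll n) H" for n
  define en where "en n i = conv (moll n) (E i)" for n i
  have sm: "smooth (hn n)" "smooth (en n i)" for n i
    unfolding hn_def en_def by (intro smooth_conv moll_test int)+
  have [measurable]: "H \<in> borel_measurable borel" "E i \<in> borel_measurable borel"
     "hn n \<in> borel_measurable borel" "en n i \<in> borel_measurable borel" for n i
    using int by (auto dest: borel_measurable_integrable intro: borel_measurable_continuous_onI smooth_continuous_on sm)
  have S0: "0 \<le> S x" for x
    unfolding S_def by (intro sum_nonneg) auto
  have [measurable]: "S \<in> borel_measurable borel"
    unfolding S_def by measurable
  define X where "X n = (\<integral>\<^sup>+x. ennreal (norm (hn n x - H x) powr p) \<partial>lborel)
      + (\<Sum>i\<in>UNIV. \<integral>\<^sup>+x. ennreal (norm (en n i x - E i x) powr p) \<partial>lborel)" for n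
  have X: "X \<longlonglongrightarrow> 0"
  proof -
    have "X \<longlonglongrightarrow> 0 + (\<Sum>i\<in>(UNIV::'n set). 0)"
      unfolding X_def hn_def en_def using p by (intro tendsto_add tendsto_sum conv_moll_tendsto_Lp int fin) auto
    then show ?thesis by simp
  qed
  obtain M where M: "0 \<le> M" "\<And>x. \<bar>\<kappa> x\<bar> \<le> M" "\<And>x i. \<bar>partial_deriv i \<kappa> x\<bar> \<le> M"
  proof -
    define T where "T x = \<bar>\<kappa> x\<bar> + (\<Sum>i\<in>UNIV. \<bar>partial_deriv i \<kappa> x\<bar>)" for x
    have "continuous_on K T"
      unfolding T_def using \<kappa>_cont \<kappa>(2) by (intro continuous_intros) (auto intro: continuous_on_subset)
    then have "bounded (T ` K)"
      using K(1) by (intro compact_imp_bounded compact_continuous_image)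
    then obtain B where B: "\<forall>x\<in>K. \<bar>T x\<bar> \<le> B"
      by (auto simp: bounded_iff)
    have T: "\<bar>\<kappa> x\<bar> \<le> T x" "\<bar>partial_deriv i \<kappa> x\<bar> \<le> T x" for x i
      unfolding T_def using member_le_sum[of i UNIV "\<lambda>i. \<bar>partial_deriv i \<kappa> x\<bar>"]
      by (auto intro: sum_nonneg add_increasing)
    show ?thesis
    proof (rule that[of "max B 0"])
      fix x i
      show "\<bar>\<kappa> x\<bar> \<le> max B 0" 
        using B T(1)[of x] K(3)[of x] by (cases "x \<in> K") fastforce+
      show "\<bar>partial_deriv i \<kappa> x\<bar> \<le> max B 0" 
        using B T(2)[of i x] d\<kappa>0[of x i] by (cases "x \<in> K") fastforce+
    qed simp
  qed
  \<comment> \<open>The bound for the gradient integral: the wanted term plus a fixed multiple of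
    the total mollification error \<open>X n\<close>. One factor \<open>real CARD('n) + 1\<close>
    comes from summing the pointwise errors over the directions, the other from the power of a sum
    of d + 1 terms.\<close>
  define Y where "Y n = ennreal (2 powr p) * (\<integral>\<^sup>+x. ennreal (S x powr p) \<partial>lborel) + ennreal (2 powr p * (M * (real CARD('n) + 1)) powr p * (real CARD('n) + 1) powr p) * X n" for n
  have bound: "(\<integral>\<^sup>+x. ennreal (norm (\<kappa> x *\<^sub>R hn n x) powr q) \<partial>lborel) \<le> Cq * epowr (Y n) (q / p)"
    if n: "N \<le> n" for n
  proof -
    define g where "g x = \<kappa> x *\<^sub>R hn n x" for x
    have sub: "cball x (inverse (Suc n)) \<subseteq> K'" if "x \<in> K" for x
    proof -
      have "inverse (real (Suc n)) \<le> \<epsilon>"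
        using n N le_imp_inverse_le[of "real (Suc N)" "real (Suc n)"] by linarith
      then show ?thesis
        using K'(5) that subset_cball[of _ \<epsilon> x] by (meson order_trans)
    qed
    have dg: "partial_deriv i g x = \<kappa> x *\<^sub>R partial_deriv i (hn n) x + partial_deriv i \<kappa> x *\<^sub>R hn n x" for i x
      unfolding g_def by (intro partial_deriv_bilinear[OF bounded_bilinear_scaleR] \<kappa> smooth_differentiable sm)
    obtain R where R: "\<forall>x\<in>K. norm x \<le> R"
      using compact_imp_bounded[OF K(1)] by (auto simp: bounded_iff)
    have le1: "(\<integral>\<^sup>+x. ennreal (norm (g x) powr q) \<partial>lborel)
      \<le> Cq * epowr (\<integral>\<^sup>+x. ennreal ((\<Sum>i\<in>UNIV. norm (partial_deriv i g x)) powr p) \<partial>lborel) (q / p)"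
      unfolding Cq_def
    proof (rule Sobolev_C1[OF p q])
      show "g differentiable at x" for x
        unfolding g_def by (intro differentiable_bilinear[OF bounded_bilinear_scaleR] \<kappa> smooth_differentiable sm)
      have "partial_deriv i g = (\<lambda>x. \<kappa> x *\<^sub>R partial_deriv i (hn n) x + partial_deriv i \<kappa> x *\<^sub>R hn n x)" for i
        by (rule ext) (rule dg)
      then show "continuous_on UNIV (partial_deriv i g)" for i
        using \<kappa>_cont \<kappa>(2) smooth_continuous_on[OF smooth_partial_deriv[OF sm(1)]] smooth_continuous_on[OF sm(1)]
        by (auto intro!: continuous_intros)
      show "g x = 0" if "R < norm x" for x
        using that R K(3)[of x] by (force simp: g_def)
    qed
    have le2: "(\<integral>\<^sup>+x. ennreal ((\<Sum>i\<in>UNIV. norm (partial_deriv i g x)) powr p) \<partial>lborel) \<le> Y n"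
    proof -
      define R where "R x = norm (hn n x - H x) powr p + (\<Sum>i\<in>UNIV. norm (en n i x - E i x) powr p)" for x
      have "(\<Sum>i\<in>UNIV. norm (partial_deriv i g x)) powr p \<le> 2 powr p * S x powr p
          + (2 powr p * (M * (real CARD('n) + 1)) powr p * (real CARD('n) + 1) powr p) * R x" for x
      proof (cases "x \<in> K")
        case False
        then have "(\<Sum>i\<in>UNIV. norm (partial_deriv i g x)) = 0"
          by (simp add: dg K(3) d\<kappa>0)
        moreover have "0 \<le> R x"
          unfolding R_def by (intro add_nonneg_nonneg sum_nonneg) auto
        ultimately show ?thesis
          using p by simp
      next
        case True
        then have xK': "x \<in> K'"
          using K'(4) by auto
        define G where "G = norm (hn n x - H x) + (\<Sum>i\<in>UNIV. norm (en n i x - E i x))"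
        have G0: "0 \<le> G"
          unfolding G_def by (intro add_nonneg_nonneg sum_nonneg) auto
        have "norm (partial_deriv i g x) \<le> (\<bar>\<kappa> x\<bar> * norm (D i x) + \<bar>partial_deriv i \<kappa> x\<bar> * norm (f x)) + M * (norm (en n i x - E i x) + norm (hn n x - H x))" for i
        proof -
          have eni: "partial_deriv i (hn n) x = en n i x"
            unfolding hn_def en_def H_def[abs_def] E_def[abs_def] by (rule partial_deriv_conv_moll[OF D K'(2,3) sub[OF True]])
          have "norm (partial_deriv i g x) \<le> \<bar>\<kappa> x\<bar> * norm (en n i x) + \<bar>partial_deriv i \<kappa> x\<bar> * norm (hn n x)"
            unfolding dg eni by (rule norm_triangle_le) simp
          also have "\<dots> \<le> \<bar>\<kappa> x\<bar> * (norm (D i x) + norm (en n i x - E i x)) + \<bar>partial_deriv i \<kappa> x\<bar> * (norm (f x) + norm (hn n x - H x))"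
            using xK' norm_triangle_sub[of "en n i x" "D i x"] norm_triangle_sub[of "hn n x" "f x"]
            by (intro add_mono mult_left_mono) (auto simp: E_def H_def)
          also have "\<dots> \<le> (\<bar>\<kappa> x\<bar> * norm (D i x) + \<bar>partial_deriv i \<kappa> x\<bar> * norm (f x)) + (M * norm (en n i x - E i x) + M * norm (hn n x - H x))"
            using mult_right_mono[OF M(2), of "norm (en n i x - E i x)" x] mult_right_mono[OF M(3), of "norm (hn n x - H x)" i x]
            by (simp add: distrib_left)
          finally show ?thesis
            by (simp add: distrib_left)
        qed
        then have "(\<Sum>i\<in>UNIV. norm (partial_deriv i g x)) \<le> S x + (\<Sum>i\<in>(UNIV::'n set). M * (norm (en n i x - E i x) + norm (hn n x - H x)))"
          unfolding S_def sum.distrib[symmetric] by (rule sum_mono)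
        also have "(\<Sum>i\<in>(UNIV::'n set). M * (norm (en n i x - E i x) + norm (hn n x - H x)))
            = M * ((\<Sum>i\<in>UNIV. norm (en n i x - E i x)) + real CARD('n) * norm (hn n x - H x))"
          by (simp add: sum_distrib_left[symmetric] sum.distrib)
        also have "\<dots> \<le> M * ((real CARD('n) + 1) * G)"
        proof (intro mult_left_mono M(1))
          have "0 \<le> real CARD('n) * (\<Sum>i\<in>UNIV. norm (en n i x - E i x))"
            by (intro mult_nonneg_nonneg sum_nonneg) auto
          then show "(\<Sum>i\<in>UNIV. norm (en n i x - E i x)) + real CARD('n) * norm (hn n x - H x) \<le> (real CARD('n) + 1) * G"
            unfolding G_def by (simp add: algebra_simps)
        qed
        finally have "(\<Sum>i\<in>UNIV. norm (partial_deriv i g x)) \<le> S x + M * (real CARD('n) + 1) * G"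
          by (simp add: mult.assoc)
        then have "(\<Sum>i\<in>UNIV. norm (partial_deriv i g x)) powr p \<le> (S x + M * (real CARD('n) + 1) * G) powr p"
          using p by (intro powr_mono2 sum_nonneg) auto
        also have "\<dots> \<le> 2 powr p * (S x powr p + (M * (real CARD('n) + 1) * G) powr p)"
          using p M G0 S0 by (intro powr_add_le) auto
        also have "(M * (real CARD('n) + 1) * G) powr p = (M * (real CARD('n) + 1)) powr p * G powr p"
          using M G0 by (simp add: powr_mult)
        also have "G powr p \<le> (real CARD('n) + 1) powr p * R x"
        proof -
          \<comment> \<open>The d + 1 error terms indexed by one finite type: \<open>None\<close>
            for the function, \<open>Some i\<close> for its derivatives.\<close>
          define a where "a j = (case j of None \<Rightarrow> norm (hn n x - H x) | Some i \<Rightarrow> norm (en n i x - E i x))" for j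
          have sumopt: "(\<Sum>j\<in>UNIV. b j) = b None + (\<Sum>i\<in>UNIV. b (Some i))" for b :: "'n option \<Rightarrow> real"
            unfolding UNIV_option_conv by (subst sum.insert) (auto simp: sum.reindex)
          have "(\<Sum>j\<in>UNIV. a j) powr p \<le> real (card (UNIV :: 'n option set)) powr p * (\<Sum>j\<in>UNIV. a j powr p)"
            using p by (intro sum_powr_le) (auto simp: a_def split: option.split)
          then show ?thesis
            by (simp add: sumopt a_def G_def R_def card_UNIV_option add.commute)
        qed
        finally show ?thesis
          by (simp add: distrib_left mult_left_mono mult.assoc)
      qed
      then have "(\<integral>\<^sup>+x. ennreal ((\<Sum>i\<in>UNIV. norm (partial_deriv i g x)) powr p) \<partial>lborel)
         \<le> (\<integral>\<^sup>+x. ennreal (2 powr p * S x powr p + (2 powr p * (M * (real CARD('n) + 1)) powr p * (real CARD('n) + 1) powr p) * R x) \<partial>lborel)"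
        by (intro nn_integral_mono ennreal_leI) auto
      also have "\<dots> = (\<integral>\<^sup>+x. ennreal (2 powr p) * ennreal (S x powr p) + ennreal (2 powr p * (M * (real CARD('n) + 1)) powr p * (real CARD('n) + 1) powr p) * 
          (ennreal (norm (hn n x - H x) powr p) + (\<Sum>i\<in>UNIV. ennreal (norm (en n i x - E i x) powr p))) \<partial>lborel)"
      proof (rule nn_integral_cong)
        fix x
        have "ennreal (R x) = ennreal (norm (hn n x - H x) powr p) + (\<Sum>i\<in>UNIV. ennreal (norm (en n i x - E i x) powr p))"
          unfolding R_def by (simp add: sum_nonneg)
        moreover have "0 \<le> R x"
          unfolding R_def by (intro add_nonneg_nonneg sum_nonneg) auto
        ultimately show "ennreal (2 powr p * S x powr p + (2 powr p * (M * (real CARD('n) + 1)) powr p * (real CARD('n) + 1) powr p) * R x)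
          = ennreal (2 powr p) * ennreal (S x powr p) + ennreal (2 powr p * (M * (real CARD('n) + 1)) powr p * (real CARD('n) + 1) powr p) * 
          (ennreal (norm (hn n x - H x) powr p) + (\<Sum>i\<in>UNIV. ennreal (norm (en n i x - E i x) powr p)))"
          by (metis (no_types, lifting) ennreal_mult ennreal_plus mult_nonneg_nonneg powr_ge_zero)
      qed
      also have "\<dots> = Y n"
        unfolding Y_def X_def by (simp add: nn_integral_add nn_integral_cmult nn_integral_sum del: sum_ennreal)
      finally show ?thesis .
    qed
    have "(\<integral>\<^sup>+x. ennreal (norm (g x) powr q) \<partial>lborel) \<le> Cq * epowr (Y n) (q / p)"
      using q0 p by (intro order_trans[OF le1] mult_left_mono epowr_mono le2) auto
    then show ?thesis
      by (simp only: g_def)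
  qed
  \<comment> \<open>On the compact \<open>K\<close> the smooth \<open>hn n\<close> is integrable,
    and L^1 convergence gives a subsequence converging a.e.; off \<open>K\<close> the factor
    \<open>\<kappa>\<close> vanishes anyway.\<close>
  define u where "u n x = indicator K x *\<^sub>R (hn n x - H x)" for n x
  have u_int: "integrable lborel (u n)" for n
  proof -
    have "integrable lborel (\<lambda>x. indicator K x *\<^sub>R hn n x - indicator K x *\<^sub>R H x)"
      using int(1) by (intro Bochner_Integration.integrable_diff borel_integrable_compact[OF K(1)]
          smooth_continuous_on sm integrable_mult_indicator) auto
    then show ?thesis
      by (simp only: u_def[abs_def] scaleR_diff_right)
  qed
  have "(\<lambda>n. LINT x|lborel. norm (u n x)) \<longlonglongrightarrow> 0"
  proof -
    have L1: "(\<lambda>n. \<integral>\<^sup>+x. ennreal (norm (hn n x - H x) powr 1) \<partial>lborel) \<longlonglongrightarrow> 0"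
      unfolding hn_def using int(1) by (intro conv_moll_tendsto_Lp) (auto simp: integrable_iff_bounded)
    have le: "ennreal (LINT x|lborel. norm (u n x)) \<le> (\<integral>\<^sup>+x. ennreal (norm (hn n x - H x) powr 1) \<partial>lborel)" for n
    proof -
      have "ennreal (LINT x|lborel. norm (u n x)) = (\<integral>\<^sup>+x. ennreal (norm (u n x)) \<partial>lborel)"
        using u_int by (intro nn_integral_eq_integral[symmetric]) auto
      also have "\<dots> \<le> (\<integral>\<^sup>+x. ennreal (norm (hn n x - H x) powr 1) \<partial>lborel)"
        by (intro nn_integral_mono ennreal_leI) (auto simp: u_def split: split_indicator)
      finally show ?thesis .
    qed
    have "(\<lambda>n. ennreal (LINT x|lborel. norm (u n x))) \<longlonglongrightarrow> 0"
      by (rule tendsto_sandwich[OF _ _ tendsto_const L1]) (intro always_eventually allI le zero_le)+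
    then have "(\<lambda>n. ennreal (LINT x|lborel. norm (u n x))) \<longlonglongrightarrow> ennreal 0"
      by simp
    then show ?thesis
      by (rule tendsto_ennrealD) auto
  qed
  from tendsto_L1_AE_subseq[OF u_int this]
  obtain r where r: "strict_mono r" "AE x in lborel. (\<lambda>n. u (r n) x) \<longlonglongrightarrow> 0"
    by blast
  have ae: "AE x in lborel. ennreal (norm (\<kappa> x *\<^sub>R f x) powr q) = liminf (\<lambda>n. ennreal (norm (\<kappa> x *\<^sub>R hn (r n) x) powr q))"
    using r(2)
  proof eventually_elim
    case (elim x)
    have "(\<lambda>n. \<kappa> x *\<^sub>R hn (r n) x) \<longlonglongrightarrow> \<kappa> x *\<^sub>R f x"
    proof (cases "x \<in> K")
      case True
      then have "(\<lambda>n. hn (r n) x - f x) \<longlonglongrightarrow> 0"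
        using elim K'(4) by (auto simp: u_def H_def)
      then show ?thesis
        by (intro tendsto_intros) (simp add: LIM_zero_iff)
    next
      case False
      then show ?thesis
        by (simp add: K(3))
    qed
    then have "(\<lambda>n. ennreal (norm (\<kappa> x *\<^sub>R hn (r n) x) powr q)) \<longlonglongrightarrow> ennreal (norm (\<kappa> x *\<^sub>R f x) powr q)"
      using q0 by (intro tendsto_ennrealI tendsto_powr2 tendsto_norm tendsto_const) auto
    then show ?case
      by (intro lim_imp_Liminf[symmetric]) auto
  qed
  define B where "B = ennreal (2 powr p) * (\<integral>\<^sup>+x. ennreal (S x powr p) \<partial>lborel)"
  define c where "c = ennreal (2 powr p * (M * (real CARD('n) + 1)) powr p * (real CARD('n) + 1) powr p)"
  have Y: "Y n = B + c * X n" for n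
    by (simp add: Y_def B_def c_def)
  have "(\<integral>\<^sup>+x. ennreal (norm (\<kappa> x *\<^sub>R f x) powr q) \<partial>lborel)
      = (\<integral>\<^sup>+x. liminf (\<lambda>n. ennreal (norm (\<kappa> x *\<^sub>R hn (r n) x) powr q)) \<partial>lborel)"
    using ae by (rule nn_integral_cong_AE)
  also have "\<dots> \<le> liminf (\<lambda>n. \<integral>\<^sup>+x. ennreal (norm (\<kappa> x *\<^sub>R hn (r n) x) powr q) \<partial>lborel)"
    by (rule nn_integral_liminf) measurable
  \<comment> \<open>Splitting the power of \<open>B + c * X (r n)\<close> before taking the limit
    means that \<open>epowr\<close> has to be continuous only at 0, also if \<open>B\<close> is
    \<open>top\<close>.\<close>
  also have "\<dots> \<le> liminf (\<lambda>n. (Cq * epowr 2 (q / p)) * (epowr B (q / p) + epowr (c * X (r n)) (q / p)))"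
  proof (rule Liminf_mono)
    have "(\<integral>\<^sup>+x. ennreal (norm (\<kappa> x *\<^sub>R hn (r n) x) powr q) \<partial>lborel)
        \<le> (Cq * epowr 2 (q / p)) * (epowr B (q / p) + epowr (c * X (r n)) (q / p))" if "N \<le> n" for n
    proof -
      have "N \<le> r n"
        using that seq_suble[OF r(1), of n] by linarith
      then have "(\<integral>\<^sup>+x. ennreal (norm (\<kappa> x *\<^sub>R hn (r n) x) powr q) \<partial>lborel) \<le> Cq * epowr (B + c * X (r n)) (q / p)"
        using bound[of "r n"] by (simp only: Y)
      also have "\<dots> \<le> Cq * (epowr 2 (q / p) * (epowr B (q / p) + epowr (c * X (r n)) (q / p)))"
        using q0 p by (intro mult_left_mono epowr_add_le) auto
      finally show ?thesis
        by (simp only: mult.assoc)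
    qed
    then show "\<forall>\<^sub>F n in sequentially. (\<integral>\<^sup>+x. ennreal (norm (\<kappa> x *\<^sub>R hn (r n) x) powr q) \<partial>lborel)
        \<le> (Cq * epowr 2 (q / p)) * (epowr B (q / p) + epowr (c * X (r n)) (q / p))"
      unfolding eventually_sequentially by blast
  qed
  also have "\<dots> = (Cq * epowr 2 (q / p)) * (epowr B (q / p) + 0)"
  proof (rule lim_imp_Liminf)
    have "Cq * epowr 2 (q / p) < top"
      unfolding ennreal_mult_less_top Cq_def by (auto simp: less_top[symmetric] epowr_eq_top_iff)
    moreover have "(\<lambda>n. c * X (r n)) \<longlonglongrightarrow> c * 0"
      using LIMSEQ_subseq_LIMSEQ[OF X r(1)] by (intro ennreal_tendsto_cmult) (auto simp: c_def o_def)
    then have "(\<lambda>n. epowr (c * X (r n)) (q / p)) \<longlonglongrightarrow> 0"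
      using q0 p by (intro epowr_tendsto_0) auto
    ultimately show "(\<lambda>n. (Cq * epowr 2 (q / p)) * (epowr B (q / p) + epowr (c * X (r n)) (q / p)))
        \<longlonglongrightarrow> (Cq * epowr 2 (q / p)) * (epowr B (q / p) + 0)"
      by (intro ennreal_tendsto_cmult tendsto_add tendsto_const)
  qed simp
  finally show ?thesis
    by (simp add: Cq_def B_def mult.assoc)
qed

section \<open>The regularised distance to the singular set and its cutoffs\<close>

text \<open>The squared distance to the singular set: unlike \<open>rho\<close> it is smooth
  everywhere.\<close>

definition sig :: "nat \<Rightarrow> (real, 'n::{finite,linorder}) vec \<Rightarrow> real"
  where "sig l x = (\<Sum>i | coord_number i \<le> CARD('n) - l. (x $ i)\<^sup>2)"

lemma sig_nonneg: "0 \<le> sig l x"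
  by (simp add: sig_def sum_nonneg)

lemma rho_eq_sig: "rho l x = min 1 (sqrt (sig l x))"
  by (simp add: rho_def sig_def)

lemma not_singular_iff: "x \<in> - singular_set l \<longleftrightarrow> 0 < sig l x"
proof -
  have "sig l x = 0 \<longleftrightarrow> x \<in> singular_set l"
    by (simp add: sig_def singular_set_def sum_nonneg_eq_0_iff)
  then show ?thesis
    using sig_nonneg[of l x] by auto
qed

lemma rho_pos: "x \<in> - singular_set l \<Longrightarrow> 0 < rho l x"
  unfolding not_singular_iff by (simp add: rho_eq_sig)

lemma rho_le_1: "rho l x \<le> 1"
  by (simp add: rho_eq_sig)

lemma continuous_on_sig: "continuous_on S (sig l)"
  unfolding sig_def[abs_def] by (intro continuous_intros)

lemma continuous_on_rho: "continuous_on S (rho l)"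
  unfolding rho_eq_sig[abs_def] by (intro continuous_intros continuous_on_sig)

lemma open_regular: "open (- singular_set l :: (real, 'n::{finite,linorder}) vec set)"
proof -
  have "- singular_set l = {x :: (real, 'n) vec. 0 < sig l x}"
    using not_singular_iff by blast
  also have "open \<dots>"
    by (rule open_Collect_less[OF continuous_on_const continuous_on_sig])
  finally show ?thesis .
qed

lemma borel_measurable_rho [measurable]: "rho l \<in> borel_measurable borel"
  by (rule borel_measurable_continuous_onI) (rule continuous_on_rho)

lemma regular_in_borel [measurable]: "- singular_set l \<in> sets borel"
  by (rule borel_open[OF open_regular])

lemma sig_has_derivative:
  "(sig l has_derivative (\<lambda>h. \<Sum>i | coord_number i \<le> CARD('n) - l. 2 * x $ i * h $ i)) (at (x :: (real, 'n::{finite,linorder}) vec))"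
  unfolding sig_def[abs_def]
  by (auto intro!: derivative_eq_intros bounded_linear.has_derivative[OF bounded_linear_vec_nth] simp: mult_ac)

lemma sig_differentiable: "sig l differentiable at x"
  using sig_has_derivative by (auto simp: differentiable_def)

lemma partial_deriv_sig:
  "partial_deriv i (sig l) (x :: (real, 'n::{finite,linorder}) vec) = (if coord_number i \<le> CARD('n) - l then 2 * x $ i else 0)"
  by (simp add: has_derivative_imp_partial_deriv[OF sig_has_derivative] axis_def if_distrib[of "\<lambda>c. _ * c"] cong: if_cong)

lemma abs_partial_deriv_sig_le: "\<bar>partial_deriv i (sig l) x\<bar> \<le> 2 * sqrt (sig l x)"
proof -
  have "(x $ i)\<^sup>2 \<le> sig l x" if "coord_number i \<le> CARD('a) - l"
    unfolding sig_def using that by (intro member_le_sum) auto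
  then have "\<bar>x $ i\<bar> \<le> sqrt (sig l x)" if "coord_number i \<le> CARD('a) - l"
    using that real_le_rsqrt[of "\<bar>x $ i\<bar>"] by simp
  then show ?thesis
    using sig_nonneg[of l x] by (simp add: partial_deriv_sig abs_mult)
qed

lemma min_sqrt_powr: "0 < t \<Longrightarrow> (min 1 (sqrt t)) powr (2 * c) = (min 1 t) powr c"
proof (cases "t \<le> 1")
  assume t: "0 < t"
  case True
  then have eqs: "min 1 (sqrt t) = t powr (1 / 2)" "min 1 t = t"
    using t by (simp_all add: powr_half_sqrt)
  show ?thesis
    unfolding eqs powr_powr by simp
qed simp

text \<open>\<open>t / (1 + t)\<close> lies between one half of \<open>min 1 t\<close> and
  \<open>min 1 t\<close>, so powers with exponent \<open>c\<close> differ by at most the factor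
  \<open>2 powr \<bar>c\<bar>\<close>; for negative \<open>c\<close> the two bounds exchange their
  roles.\<close>

lemma frac_powr_bounds:
  fixes t c :: real
  assumes t: "0 < t"
  shows "(t / (1 + t)) powr c \<le> 2 powr \<bar>c\<bar> * (min 1 (sqrt t)) powr (2 * c)"
    and "(min 1 (sqrt t)) powr (2 * c) \<le> 2 powr \<bar>c\<bar> * (t / (1 + t)) powr c"
proof -
  define s m where "s = t / (1 + t)" and "m = min 1 t"
  have sm: "0 < s" "0 < m" "s \<le> m" "m \<le> 2 * s"
    using t by (auto simp: s_def m_def min_def field_simps)
  have "s powr c \<le> 2 powr \<bar>c\<bar> * m powr c \<and> m powr c \<le> 2 powr \<bar>c\<bar> * s powr c"
  proof (cases "0 \<le> c")
    case True
    then have "s powr c \<le> m powr c" "m powr c \<le> (2 * s) powr c" "1 \<le> 2 powr c"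
      using sm by (auto intro!: powr_mono2 ge_one_powr_ge_zero)
    have "1 * m powr c \<le> 2 powr c * m powr c"
      using \<open>1 \<le> 2 powr c\<close> by (intro mult_right_mono) auto
    then have "s powr c \<le> 2 powr c * m powr c"
      using \<open>s powr c \<le> m powr c\<close> by linarith
    then show ?thesis
      using True sm \<open>m powr c \<le> (2 * s) powr c\<close> by (simp add: powr_mult)
  next
    case False
    then have "m powr c \<le> s powr c" "(2 * s) powr c \<le> m powr c" "1 \<le> 2 powr (- c)"
      using sm by (auto intro!: powr_mono2' ge_one_powr_ge_zero)
    moreover have "s powr c = 2 powr (- c) * (2 * s) powr c"
      using sm by (simp add: powr_mult powr_minus field_simps)
    moreover have "2 powr (- c) * (2 * s) powr c \<le> 2 powr (- c) * m powr c"
      using \<open>(2 * s) powr c \<le> m powr c\<close> by (intro mult_left_mono) auto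
    ultimately have 1: "s powr c \<le> 2 powr (- c) * m powr c"
      by linarith
    have "1 * s powr c \<le> 2 powr (- c) * s powr c"
      using \<open>1 \<le> 2 powr (- c)\<close> by (intro mult_right_mono) auto
    then have "m powr c \<le> 2 powr (- c) * s powr c"
      using \<open>m powr c \<le> s powr c\<close> by linarith
    with 1 show ?thesis
      using False by simp
  qed
  then show "(t / (1 + t)) powr c \<le> 2 powr \<bar>c\<bar> * (min 1 (sqrt t)) powr (2 * c)"
    "(min 1 (sqrt t)) powr (2 * c) \<le> 2 powr \<bar>c\<bar> * (t / (1 + t)) powr c"
    by (auto simp: min_sqrt_powr[OF t] s_def m_def)
qed

lemma partial_deriv_cong_open:
  assumes "open U" "x \<in> U" "\<And>y. y \<in> U \<Longrightarrow> g y = f y" "g differentiable at x"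
  shows "f differentiable at x" "partial_deriv i f x = partial_deriv i g x"
proof -
  from assms(4) obtain D where D: "(g has_derivative D) (at x)"
    by (auto simp: differentiable_def)
  from has_derivative_transform_within_open[OF D assms(1-3)]
  have D': "(f has_derivative D) (at x)" by blast
  then show "f differentiable at x"
    by (auto simp: differentiable_def)
  show "partial_deriv i f x = partial_deriv i g x"
    by (simp add: has_derivative_imp_partial_deriv[OF D] has_derivative_imp_partial_deriv[OF D'])
qed

lemma max_0_square_has_derivative: "((\<lambda>t. (max 0 t)\<^sup>2) has_real_derivative 2 * max 0 t) (at (t::real))"
proof -
  consider "t < 0" | "t > 0" | "t = 0" by linarith
  then show ?thesis
  proof cases
    case 1
    have "((\<lambda>t. 0) has_real_derivative 0) (at t)"
      by simp
    then have "((\<lambda>t. (max 0 t)\<^sup>2) has_real_derivative 0) (at t)"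
      by (rule has_field_derivative_transform_within_open[where S="{..<0}"]) (use 1 in auto)
    then show ?thesis
      using 1 by simp
  next
    case 2
    have "((\<lambda>t. t\<^sup>2) has_real_derivative 2 * t) (at t)"
      by (auto intro!: derivative_eq_intros)
    then have "((\<lambda>t. (max 0 t)\<^sup>2) has_real_derivative 2 * t) (at t)"
      by (rule has_field_derivative_transform_within_open[where S="{0<..}"]) (use 2 in auto)
    then show ?thesis
      using 2 by simp
  next
    case 3
    have "((\<lambda>h. ((max 0 (0 + h))\<^sup>2 - (max 0 0)\<^sup>2) / h) \<longlongrightarrow> 0) (at (0::real))"
    proof (rule Lim_null_comparison)
      show "\<forall>\<^sub>F h in at 0. norm (((max 0 (0 + h))\<^sup>2 - (max 0 0)\<^sup>2) / h) \<le> \<bar>h\<bar>"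
        by (rule always_eventually) (auto simp: max_def power2_eq_square)
      show "((\<lambda>h. \<bar>h\<bar>) \<longlongrightarrow> 0) (at (0::real))"
        using tendsto_rabs[OF tendsto_ident_at, of 0 UNIV] by simp
    qed
    then show ?thesis
      by (simp add: 3 DERIV_def)
  qed
qed

text \<open>\<open>sig l x / (1 + sig l x)\<close> is a smooth substitute for \<open>(rho l x)\<^sup>2\<close> off the singular set.\<close>

definition wgt :: "real \<Rightarrow> real \<Rightarrow> real"
  where "wgt b t = (t / (1 + t)) powr (b / 2)"

text \<open>The smooth version of \<open>rho\<close> to the power \<open>b\<close>, multiplied by a
  function of \<open>1 / sig l x + x \<bullet> x\<close>. This quantity is large both near the
  singular set and far out, so one factor produces a compact support off the singular set, and the
  factor tends to 1 as \<open>n\<close> grows. The square of the positive part is continuously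
  differentiable.\<close>

definition cutoff :: "nat \<Rightarrow> real \<Rightarrow> nat \<Rightarrow> (real, 'n::{finite,linorder}) vec \<Rightarrow> real"
  where "cutoff l b n x = (if sig l x = 0 then 0
    else wgt b (sig l x) * (max 0 (1 - (1 / sig l x + x \<bullet> x) / real n))\<^sup>2)"

lemma wgt_has_derivative:
  assumes "0 < t"
  shows "(wgt b has_real_derivative (b / 2) * (t / (1 + t)) powr (b / 2 - 1) * (1 / (1 + t)\<^sup>2)) (at t)"
proof -
  have "((\<lambda>t. t / (1 + t)) has_real_derivative 1 / (1 + t)\<^sup>2) (at t)"
    using assms by (auto intro!: derivative_eq_intros simp: power2_eq_square)
  moreover have "((\<lambda>z. z powr (b / 2)) has_real_derivative (b / 2) * (t / (1 + t)) powr (b / 2 - 1)) (at (t / (1 + t)))"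
    using assms by (intro has_real_derivative_powr) auto
  ultimately show ?thesis
    unfolding wgt_def[abs_def] by (rule DERIV_chain2[rotated])
qed

definition cutoff_deriv :: "nat \<Rightarrow> real \<Rightarrow> nat \<Rightarrow> 'n \<Rightarrow> (real, 'n::{finite,linorder}) vec \<Rightarrow> real"
  where "cutoff_deriv l b n i x =
    wgt b (sig l x) * (2 * max 0 (1 - (1 / sig l x + x \<bullet> x) / real n) * (- 1 / real n) *
       (- 1 / (sig l x)\<^sup>2 * partial_deriv i (sig l) x + 2 * x $ i))
    + (b / 2) * (sig l x / (1 + sig l x)) powr (b / 2 - 1) * (1 / (1 + sig l x)\<^sup>2) * partial_deriv i (sig l) x *
       (max 0 (1 - (1 / sig l x + x \<bullet> x) / real n))\<^sup>2"

lemma cutoff_differentiable_regular: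
  fixes x :: "(real, 'n::{finite,linorder}) vec"
  assumes x: "x \<in> - singular_set l" and n: "0 < n"
  shows "cutoff l b n differentiable at x" "partial_deriv i (cutoff l b n) x = cutoff_deriv l b n i x"
proof -
  have s: "0 < sig l x"
    using x by (simp only: not_singular_iff)
  note W = partial_deriv_compose_real[OF sig_differentiable wgt_has_derivative[OF s]]
  have "((\<lambda>t. 1 / t) has_real_derivative - 1 / (sig l x)\<^sup>2) (at (sig l x))"
    using s by (auto intro!: derivative_eq_intros simp: power2_eq_square)
  note I = partial_deriv_compose_real[OF sig_differentiable this]
  have "((\<lambda>x. x \<bullet> x) has_derivative (\<lambda>h. 2 * (x \<bullet> h))) (at x)"
    by (auto intro!: derivative_eq_intros simp: inner_commute)
  then have N: "(\<lambda>x. x \<bullet> x) differentiable at x" "partial_deriv i (\<lambda>x. x \<bullet> x) x = 2 * x $ i"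
    by (auto simp: differentiable_def has_derivative_imp_partial_deriv inner_axis)
  define r where "r x = 1 / sig l x + x \<bullet> x" for x :: "(real, 'n) vec"
  have r: "r differentiable at x" "partial_deriv i r x = - 1 / (sig l x)\<^sup>2 * partial_deriv i (sig l) x + 2 * x $ i"
    unfolding r_def using I N by (auto intro!: differentiable_add simp: partial_deriv_add)
  have "((\<lambda>t. 1 - t / real n) has_real_derivative - 1 / real n) (at (r x))"
    using n by (auto intro!: derivative_eq_intros)
  from DERIV_chain2[OF max_0_square_has_derivative this]
  have "((\<lambda>t. (max 0 (1 - t / real n))\<^sup>2) has_real_derivative 2 * max 0 (1 - r x / real n) * (- 1 / real n)) (at (r x))" .
  note P = partial_deriv_compose_real[OF r(1) this]
  define g where "g x = wgt b (sig l x) * (max 0 (1 - r x / real n))\<^sup>2" for x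
  have g1: "g differentiable at x"
    unfolding g_def by (rule differentiable_bilinear[OF bounded_bilinear_mult W(1) P(1)])
  have "partial_deriv i g x = wgt b (sig l x) * partial_deriv i (\<lambda>x. (max 0 (1 - r x / real n))\<^sup>2) x
      + partial_deriv i (\<lambda>x. wgt b (sig l x)) x * (max 0 (1 - r x / real n))\<^sup>2"
    unfolding g_def by (rule partial_deriv_bilinear[OF bounded_bilinear_mult W(1) P(1)])
  also have "\<dots> = cutoff_deriv l b n i x"
    unfolding W(2) P(2) r(2) cutoff_deriv_def by (simp only: r_def)
  finally have g2: "partial_deriv i g x = cutoff_deriv l b n i x" .
  have eq: "g y = cutoff l b n y" if "y \<in> - singular_set l" for y
    using that unfolding not_singular_iff by (simp add: g_def cutoff_def r_def)
  show "cutoff l b n differentiable at x" "partial_deriv i (cutoff l b n) x = cutoff_deriv l b n i x"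
    using partial_deriv_cong_open[OF open_regular x eq g1] g2 by auto
qed

lemma cutoff_eq_0:
  assumes n: "0 < n" and "sig l x < 1 / real n \<or> real n < x \<bullet> x"
  shows "cutoff l b n x = 0"
proof (cases "sig l x = 0")
  case False
  then have s: "0 < sig l x"
    using sig_nonneg[of l x] by linarith
  have "real n \<le> 1 / sig l x + x \<bullet> x"
    using assms(2)
  proof
    assume "sig l x < 1 / real n"
    then have "real n < 1 / sig l x"
      using s n by (simp add: field_simps)
    then show ?thesis
      by (simp add: add_increasing2 less_imp_le)
  next
    assume "real n < x \<bullet> x"
    moreover have "0 < 1 / sig l x"
      using s by simp
    ultimately show ?thesis
      by linarith
  qed
  then have "1 - (1 / sig l x + x \<bullet> x) / real n \<le> 0"
    using n by simp
  then show ?thesis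
    by (simp add: cutoff_def)
qed (simp add: cutoff_def)

text \<open>The formula for the derivative is available only off the singular set, but
  \<open>cutoff\<close> vanishes identically on the open neighbourhood \<open>V\<close> of that set.
  The two open sets cover the space.\<close>

lemma cutoff_C1:
  fixes l :: nat
  assumes n: "0 < n"
  shows "cutoff l b n differentiable at (x :: (real, 'n::{finite,linorder}) vec)"
    and "continuous_on UNIV (partial_deriv i (cutoff l b n :: (real, 'n) vec \<Rightarrow> real))"
proof -
  define V where "V = {x :: (real, 'n) vec. sig l x < 1 / real n}"
  have V: "open V"
    unfolding V_def by (rule open_Collect_less[OF continuous_on_sig continuous_on_const])
  have cover: "x \<in> V \<or> x \<in> - singular_set l" for x
    using n unfolding not_singular_iff V_def by (cases "0 < sig l x") (auto intro: le_less_trans simp: not_less)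
  have zero: "0 = cutoff l b n x" if "x \<in> V" for x
    using that cutoff_eq_0[OF n, of l x b] by (simp add: V_def)
  have const: "(\<lambda>_. 0 :: real) differentiable at x" for x :: "(real, 'n) vec"
    by simp
  show "cutoff l b n differentiable at x"
  proof (cases "x \<in> V")
    case True
    show ?thesis
      by (rule partial_deriv_cong_open(1)[where g="\<lambda>_. 0", OF V True zero const])
  next
    case False
    with cover[of x] have "x \<in> - singular_set l"
      by blast
    then show ?thesis
      by (rule cutoff_differentiable_regular(1)[OF _ n])
  qed
  have "continuous_on V (partial_deriv i (cutoff l b n))"
  proof (rule continuous_on_eq)
    show "continuous_on V (\<lambda>x. 0 :: real)" by simp
    show "0 = partial_deriv i (cutoff l b n) x" if "x \<in> V" for x
      using partial_deriv_cong_open(2)[where g="\<lambda>_. 0" and i=i, OF V that zero const] by simp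
  qed
  moreover have "continuous_on (- singular_set l) (partial_deriv i (cutoff l b n :: (real, 'n) vec \<Rightarrow> real))"
  proof (rule continuous_on_eq)
    have s: "\<forall>x\<in>- singular_set l. 0 < sig l (x :: (real, 'n) vec)"
      using not_singular_iff by blast
    have s1: "\<forall>x\<in>- singular_set l. 1 + sig l (x :: (real, 'n) vec) \<noteq> 0" "\<forall>x\<in>- singular_set l. sig l (x :: (real, 'n) vec) \<noteq> 0"
    proof -
      show "\<forall>x\<in>- singular_set l. sig l (x :: (real, 'n) vec) \<noteq> 0"
        using s by (metis less_irrefl)
      show "\<forall>x\<in>- singular_set l. 1 + sig l (x :: (real, 'n) vec) \<noteq> 0"
        using sig_nonneg by (metis add_pos_nonneg less_irrefl zero_less_one)
    qed
    have d: "continuous_on (- singular_set l) (partial_deriv i (sig l :: (real, 'n) vec \<Rightarrow> real))"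
      by (cases "coord_number i \<le> CARD('n) - l") (auto simp: partial_deriv_sig[abs_def] intro!: continuous_intros)
    show "continuous_on (- singular_set l) (cutoff_deriv l b n i :: (real, 'n) vec \<Rightarrow> real)"
      unfolding cutoff_deriv_def[abs_def] wgt_def
      by (intro continuous_intros continuous_on_sig d) (use s s1 n in auto)
    show "cutoff_deriv l b n i x = partial_deriv i (cutoff l b n) x" if "x \<in> - singular_set l" for x
      using cutoff_differentiable_regular(2)[OF that n] by simp
  qed
  ultimately have "continuous_on (V \<union> - singular_set l) (partial_deriv i (cutoff l b n))"
    using V open_regular by (intro continuous_on_open_Un)
  moreover have "V \<union> - singular_set l = UNIV"
    using cover by blast
  ultimately show "continuous_on UNIV (partial_deriv i (cutoff l b n :: (real, 'n) vec \<Rightarrow> real))"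
    by simp
qed

lemma wgt_le_rho:
  assumes "x \<in> - singular_set l"
  shows "wgt b (sig l x) \<le> 2 powr (\<bar>b\<bar> / 2) * rho l x powr b"
    and "rho l x powr b \<le> 2 powr (\<bar>b\<bar> / 2) * wgt b (sig l x)"
  using frac_powr_bounds[of "sig l x" "b / 2"] assms unfolding not_singular_iff by (auto simp: wgt_def rho_eq_sig)

lemma wgt_nonneg: "0 \<le> wgt b t"
  by (simp add: wgt_def)

text \<open>Neither bound depends on \<open>n\<close>. Where the truncating factor is positive,
  \<open>1 / sig l x\<close> and \<open>x \<bullet> x\<close> are below \<open>n\<close>; this
  compensates the factor \<open>1 / real n\<close> in its derivative and leaves only a multiple of
  \<open>1 / rho l x\<close>. The derivative of the weight itself is of the order
  \<open>b - 1\<close> by the chain rule.\<close>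

lemma cutoff_bounds:
  fixes x :: "(real, 'n::{finite,linorder}) vec"
  assumes x: "x \<in> - singular_set l" and n: "0 < n"
  shows "\<bar>cutoff l b n x\<bar> \<le> 2 powr (\<bar>b\<bar> / 2) * rho l x powr b"
    and "\<bar>partial_deriv i (cutoff l b n) x\<bar> \<le> (8 * 2 powr (\<bar>b\<bar> / 2) + \<bar>b\<bar> * 2 powr (\<bar>b - 1\<bar> / 2)) * rho l x powr (b - 1)"
proof -
  define s where "s = sig l x"
  have s: "0 < s"
    using x by (simp add: s_def not_singular_iff[symmetric])
  define m where "m = max 0 (1 - (1 / s + x \<bullet> x) / real n)"
  have m: "0 \<le> m" "m \<le> 1"
    using s by (auto simp: m_def)
  then have m2: "m\<^sup>2 \<le> 1"
    by (simp add: power_le_one)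
  have rho: "0 < rho l x" "rho l x \<le> 1" "rho l x \<le> sqrt s"
    using rho_pos[OF x] by (auto simp: rho_eq_sig s_def)
  have "\<bar>cutoff l b n x\<bar> = wgt b s * m\<^sup>2"
    using s by (simp add: cutoff_def s_def[symmetric] m_def[symmetric] abs_mult wgt_nonneg)
  also have "\<dots> \<le> wgt b s * 1"
    using m2 by (intro mult_left_mono wgt_nonneg)
  also have "\<dots> \<le> 2 powr (\<bar>b\<bar> / 2) * rho l x powr b"
    using wgt_le_rho(1)[OF x] by (simp add: s_def)
  finally show "\<bar>cutoff l b n x\<bar> \<le> 2 powr (\<bar>b\<bar> / 2) * rho l x powr b" .
  define d where "d = partial_deriv i (sig l) x"
  have d: "\<bar>d\<bar> \<le> 2 * sqrt s"
    unfolding d_def s_def by (rule abs_partial_deriv_sig_le)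
  \<comment> \<open>The sum \<open>2 / sqrt s + 2\<close> is at most \<open>4 / rho l x\<close>, one
    half from the distance term and one half from \<open>x \<bullet> x\<close>; the square of the
    positive part contributes another 2, in total 8.\<close>
  have t1: "2 * m * (1 / real n) * \<bar>- 1 / s\<^sup>2 * d + 2 * x $ i\<bar> \<le> 8 * (1 / rho l x)"
  proof (cases "m = 0")
    case False
    with m have "0 < m"
      by simp
    then have "0 < 1 - (1 / s + x \<bullet> x) / real n"
      unfolding m_def less_max_iff_disj by (simp only: less_irrefl simp_thms)
    then have "(1 / s + x \<bullet> x) / real n < 1"
      by linarith
    then have lt: "1 / s + x \<bullet> x < real n"
      using n by simp
    moreover have "0 < 1 / s"
      using s by simp
    ultimately have "1 / s \<le> real n" "x \<bullet> x \<le> real n"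
      using inner_ge_zero[of x] by linarith+
    have "real n \<le> (real n)\<^sup>2"
      using n self_le_power[of "real n" 2] by simp
    then have "(norm x)\<^sup>2 \<le> (real n)\<^sup>2"
      using \<open>x \<bullet> x \<le> real n\<close> unfolding power2_norm_eq_inner by linarith
    then have "norm x \<le> real n"
      by (rule power2_le_imp_le) simp
    then have xi: "\<bar>x $ i\<bar> \<le> real n"
      using component_le_norm_cart[of x i] by linarith
    have "\<bar>- 1 / s\<^sup>2 * d + 2 * x $ i\<bar> \<le> \<bar>d\<bar> / s\<^sup>2 + 2 * \<bar>x $ i\<bar>"
      using abs_triangle_ineq[of "- 1 / s\<^sup>2 * d" "2 * x $ i"] by (simp add: abs_mult)
    also have "\<bar>d\<bar> / s\<^sup>2 \<le> (2 * sqrt s) / s\<^sup>2"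
      using d by (intro divide_right_mono) auto
    also have "(2 * sqrt s) / s\<^sup>2 = (2 / sqrt s) * (1 / s)"
      using s by (simp add: field_simps power2_eq_square)
    also have "\<dots> \<le> (2 / sqrt s) * real n"
      using \<open>1 / s \<le> real n\<close> s by (intro mult_left_mono) auto
    finally have "\<bar>- 1 / s\<^sup>2 * d + 2 * x $ i\<bar> \<le> (2 / sqrt s + 2) * real n"
      using xi by (simp add: distrib_right)
    moreover have "2 / sqrt s \<le> 2 / rho l x"
      using rho s by (intro divide_left_mono) auto
    moreover have "2 \<le> 2 / rho l x"
      using rho by (simp add: field_simps)
    ultimately have "\<bar>- 1 / s\<^sup>2 * d + 2 * x $ i\<bar> \<le> (2 / sqrt s + 2) * real n" "2 / sqrt s + 2 \<le> 4 / rho l x"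
      by linarith+
    then have "\<bar>- 1 / s\<^sup>2 * d + 2 * x $ i\<bar> \<le> (4 / rho l x) * real n"
      using mult_right_mono[of "2 / sqrt s + 2" "4 / rho l x" "real n"] by linarith
    then have "(2 * m * (1 / real n)) * \<bar>- 1 / s\<^sup>2 * d + 2 * x $ i\<bar> \<le> (2 * 1 * (1 / real n)) * ((4 / rho l x) * real n)"
      using m n rho by (intro mult_mono) auto
    then show ?thesis
      using n by simp
  qed (use rho in simp)
  \<comment> \<open>The partial derivative of \<open>sig\<close> is at most
    \<open>2 * sqrt s\<close>. Together with a factor \<open>1 / sqrt (1 + s)\<close> this gives
    back half a power of \<open>s / (1 + s)\<close>, which raises the exponent
    \<open>b / 2 - 1\<close> to \<open>(b - 1) / 2\<close>.\<close>
  have t2: "\<bar>(b / 2) * (s / (1 + s)) powr (b / 2 - 1) * (1 / (1 + s)\<^sup>2) * d\<bar> \<le> \<bar>b\<bar> * (2 powr (\<bar>b - 1\<bar> / 2) * rho l x powr (b - 1))"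
  proof -
    define k where "k = s / (1 + s)"
    have k: "0 < k"
      using s by (simp add: k_def)
    have "(1 / (1 + s)\<^sup>2) * \<bar>d\<bar> \<le> (1 / (1 + s)\<^sup>2) * (2 * sqrt s)"
      using d by (intro mult_left_mono) auto
    also have "\<dots> \<le> (1 / sqrt (1 + s)) * (2 * sqrt s)"
    proof (intro mult_right_mono divide_left_mono)
      have "sqrt (1 + s) \<le> 1 + s"
        using s by (intro real_le_lsqrt) (auto simp: power2_eq_square algebra_simps)
      also have "\<dots> \<le> (1 + s)\<^sup>2"
        using s self_le_power[of "1 + s" 2] by simp
      finally show "sqrt (1 + s) \<le> (1 + s)\<^sup>2" .
    qed (use s in auto)
    also have "\<dots> = 2 * k powr (1 / 2)"
      using s k by (simp add: k_def powr_half_sqrt real_sqrt_divide)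
    finally have "(\<bar>b\<bar> / 2 * k powr (b / 2 - 1)) * ((1 / (1 + s)\<^sup>2) * \<bar>d\<bar>) \<le> (\<bar>b\<bar> / 2 * k powr (b / 2 - 1)) * (2 * k powr (1 / 2))"
      by (intro mult_left_mono) auto
    also have "\<dots> = \<bar>b\<bar> * k powr ((b - 1) / 2)"
      by (simp add: powr_add[symmetric] diff_divide_distrib)
    also have "\<dots> \<le> \<bar>b\<bar> * (2 powr (\<bar>b - 1\<bar> / 2) * rho l x powr (b - 1))"
    proof (intro mult_left_mono)
      have e: "2 * ((b - 1) / 2) = b - 1" "\<bar>(b - 1) / 2\<bar> = \<bar>b - 1\<bar> / 2"
        by simp_all
      show "k powr ((b - 1) / 2) \<le> 2 powr (\<bar>b - 1\<bar> / 2) * rho l x powr (b - 1)"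
        using frac_powr_bounds(1)[OF s, of "(b - 1) / 2", unfolded e] by (simp only: k_def rho_eq_sig s_def)
    qed simp
    finally show ?thesis
      by (simp add: k_def abs_mult mult.assoc)
  qed
  have "\<bar>partial_deriv i (cutoff l b n) x\<bar> \<le> wgt b s * (2 * m * (1 / real n) * \<bar>- 1 / s\<^sup>2 * d + 2 * x $ i\<bar>)
      + \<bar>(b / 2) * (s / (1 + s)) powr (b / 2 - 1) * (1 / (1 + s)\<^sup>2) * d\<bar> * m\<^sup>2"
    unfolding cutoff_differentiable_regular(2)[OF x n] cutoff_deriv_def s_def[symmetric] m_def[symmetric] d_def[symmetric]
    by (rule order_trans[OF abs_triangle_ineq]) (use m in \<open>simp add: abs_mult wgt_nonneg\<close>)
  also have "\<dots> \<le> (2 powr (\<bar>b\<bar> / 2) * rho l x powr b) * (8 * (1 / rho l x))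
      + (\<bar>b\<bar> * (2 powr (\<bar>b - 1\<bar> / 2) * rho l x powr (b - 1))) * 1"
  proof (rule add_mono)
    show "wgt b s * (2 * m * (1 / real n) * \<bar>- 1 / s\<^sup>2 * d + 2 * x $ i\<bar>)
        \<le> (2 powr (\<bar>b\<bar> / 2) * rho l x powr b) * (8 * (1 / rho l x))"
      using wgt_le_rho(1)[OF x, of b] m by (intro mult_mono t1) (auto simp: s_def)
    show "\<bar>(b / 2) * (s / (1 + s)) powr (b / 2 - 1) * (1 / (1 + s)\<^sup>2) * d\<bar> * m\<^sup>2
        \<le> (\<bar>b\<bar> * (2 powr (\<bar>b - 1\<bar> / 2) * rho l x powr (b - 1))) * 1"
      by (rule mult_mono[OF t2 m2]) auto
  qed
  also have "\<dots> = (8 * 2 powr (\<bar>b\<bar> / 2) + \<bar>b\<bar> * 2 powr (\<bar>b - 1\<bar> / 2)) * rho l x powr (b - 1)"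
    using rho by (simp add: powr_diff algebra_simps)
  finally show "\<bar>partial_deriv i (cutoff l b n) x\<bar> \<le> (8 * 2 powr (\<bar>b\<bar> / 2) + \<bar>b\<bar> * 2 powr (\<bar>b - 1\<bar> / 2)) * rho l x powr (b - 1)" .
qed

lemma cutoff_tendsto:
  assumes "x \<in> - singular_set l"
  shows "(\<lambda>n. cutoff l b (Suc n) x) \<longlonglongrightarrow> wgt b (sig l x)"
proof -
  have s: "sig l x \<noteq> 0"
    using assms unfolding not_singular_iff by simp
  have "(\<lambda>n. (1 / sig l x + x \<bullet> x) / real (Suc n)) \<longlonglongrightarrow> 0"
    using tendsto_mult[OF tendsto_const LIMSEQ_inverse_real_of_nat, of "1 / sig l x + x \<bullet> x"]
    by (simp add: divide_inverse)
  then have "(\<lambda>n. wgt b (sig l x) * (max 0 (1 - (1 / sig l x + x \<bullet> x) / real (Suc n)))\<^sup>2)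
      \<longlonglongrightarrow> wgt b (sig l x) * (max 0 (1 - 0))\<^sup>2"
    by (intro tendsto_intros)
  then show ?thesis
    using s by (simp add: cutoff_def)
qed

text \<open>A power of \<open>rho\<close> is continuous and positive off the singular set, hence
  bounded below by a positive number on each compact subset.\<close>

lemma loc_Lp_weighted:
  fixes f :: "(real, 'n::{finite,linorder}) vec \<Rightarrow> 'b::real_normed_vector"
  assumes [measurable]: "f \<in> borel_measurable borel" and p: "0 < p"
    and fin: "(\<integral>\<^sup>+x. ennreal ((rho l x powr c * norm (f x)) powr p) \<partial>lborel) < top"
  shows "loc_Lp (- singular_set l) p f"
  unfolding loc_Lp_def
proof (intro allI impI)
  fix K :: "(real, 'n) vec set" assume K: "compact K \<and> K \<subseteq> - singular_set l"
  then have [measurable]: "K \<in> sets borel"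
    by (auto intro: borel_compact)
  show "(\<integral>\<^sup>+x\<in>K. ennreal (norm (f x) powr p) \<partial>lborel) < top"
  proof (cases "K = {}")
    case False
    have "continuous_on K (\<lambda>x. rho l x powr c)"
      using K rho_pos[of _ l] by (intro continuous_intros continuous_on_rho) force
    then obtain y where y: "y \<in> K" "\<forall>x\<in>K. rho l y powr c \<le> rho l x powr c"
      using continuous_attains_inf[of K "\<lambda>x. rho l x powr c"] K False by blast
    define m where "m = rho l y powr c"
    have m: "0 < m"
      using rho_pos[of y l] y K by (auto simp: m_def)
    have "(\<integral>\<^sup>+x\<in>K. ennreal (norm (f x) powr p) \<partial>lborel)
        \<le> (\<integral>\<^sup>+x. ennreal (m powr - p) * ennreal ((rho l x powr c * norm (f x)) powr p) \<partial>lborel)"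
    proof (rule nn_integral_mono)
      fix x
      show "ennreal (norm (f x) powr p) * indicator K x \<le> ennreal (m powr - p) * ennreal ((rho l x powr c * norm (f x)) powr p)"
      proof (cases "x \<in> K")
        case True
        have "norm (f x) powr p = m powr - p * (m * norm (f x)) powr p"
          using m by (simp add: powr_mult powr_minus field_simps)
        also have "\<dots> \<le> m powr - p * (rho l x powr c * norm (f x)) powr p"
          using y(2) True m p by (intro mult_left_mono powr_mono2 mult_right_mono) (auto simp: m_def)
        finally show ?thesis
          using True by (simp add: ennreal_leI flip: ennreal_mult)
      qed simp
    qed
    also have "\<dots> = ennreal (m powr - p) * (\<integral>\<^sup>+x. ennreal ((rho l x powr c * norm (f x)) powr p) \<partial>lborel)"
      by (rule nn_integral_cmult) measurable
    also have "\<dots> < top"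
      using fin by (simp add: ennreal_mult_less_top)
    finally show ?thesis .
  qed simp
qed

text \<open>\<open>Sobolev_cutoff\<close> with the cutoff of exponent \<open>b\<close>: its values
  are paired with the derivatives of \<open>f\<close>, and its gradient, of order
  \<open>b - 1\<close>, with \<open>f\<close>. Both bounds are uniform in \<open>n\<close>, and
  Fatou's lemma recovers the full weight in the limit. A common bound \<open>A\<close> for all the
  integrals keeps the constant independent of \<open>f\<close>.\<close>

theorem weighted_Sobolev:
  fixes p q b :: real and l :: nat
  assumes p: "1 < p" "p < CARD('n::{finite,linorder})" and q: "1 / q = 1 / p - 1 / CARD('n)"
  obtains C :: ennreal where "C < top"
    "\<And>(f :: (real, 'n) vec \<Rightarrow> 'b::euclidean_space) D A.
       (\<And>i. weakd (- singular_set l) ((\<lambda>_. 0)(i := Suc 0)) f (D i)) \<Longrightarrow>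
       (\<integral>\<^sup>+x. ennreal ((rho l x powr (b - 1) * norm (f x)) powr p) \<partial>lborel) \<le> A \<Longrightarrow>
       (\<And>i. (\<integral>\<^sup>+x. ennreal ((rho l x powr b * norm (D i x)) powr p) \<partial>lborel) \<le> A) \<Longrightarrow>
       (\<integral>\<^sup>+x. ennreal ((rho l x powr b * norm (f x)) powr q) \<partial>lborel) \<le> C * epowr A (q / p)"
proof -
  have "1 / q > 0"
    using p q by (simp add: frac_less2)
  then have q0: "0 < q"
    by simp
  define d where "d = real CARD('n)"
  \<comment> \<open>\<open>w\<close> and \<open>M\<close> are the constants in
    \<open>cutoff_bounds\<close>; \<open>w\<close> also compares \<open>rho\<close> with its smooth
    substitute in the other direction.\<close>
  define M where "M = 8 * 2 powr (\<bar>b\<bar> / 2) + \<bar>b\<bar> * 2 powr (\<bar>b - 1\<bar> / 2)"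
  define w where "w = (2::real) powr (\<bar>b\<bar> / 2)"
  have M: "0 \<le> M" "w \<le> M" "0 < w"
    by (auto simp: M_def w_def intro!: add_nonneg_nonneg add_increasing2)
  \<comment> \<open>Here \<open>2 powr p\<close> comes from \<open>Sobolev_cutoff\<close>,
    \<open>d powr p\<close> from the power of a sum over d directions,
    \<open>M powr p * 2 powr p\<close> from the two terms in each direction, and
    \<open>2 * d\<close> counts the integrals bounded by \<open>A\<close>.\<close>
  define c where "c = ennreal (2 powr p) * (ennreal (d powr p * M powr p * 2 powr p) * ennreal (2 * d))"
  define Cq where "Cq = ennreal ((q * (1 - 1 / CARD('n))) powr q) * epowr 2 (q / p) * epowr c (q / p)"
  have c: "c < top"
    by (simp add: c_def ennreal_mult_less_top)
  have "epowr 2 (q / p) < top" "epowr c (q / p) < top"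
    using c by (auto simp: less_top[symmetric] epowr_eq_top_iff)
  then have Cq: "Cq < top"
    unfolding Cq_def by (auto simp: ennreal_mult_less_top)
  have "(\<integral>\<^sup>+x. ennreal ((rho l x powr b * norm (f x)) powr q) \<partial>lborel) \<le> ennreal (w powr q) * Cq * epowr A (q / p)"
    if D: "\<And>i. weakd (- singular_set l) ((\<lambda>_. 0)(i := Suc 0)) f (D i)"
      and A: "(\<integral>\<^sup>+x. ennreal ((rho l x powr (b - 1) * norm (f x)) powr p) \<partial>lborel) \<le> A"
        "\<And>i. (\<integral>\<^sup>+x. ennreal ((rho l x powr b * norm (D i x)) powr p) \<partial>lborel) \<le> A"
    for f :: "(real, 'n) vec \<Rightarrow> 'b" and D A
  proof (cases "A = top")
    case True
    \<comment> \<open>For infinite \<open>A\<close> the bound is trivial only with a nonzero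
      constant, since 0 times \<open>top\<close> is 0.\<close>
    have "ennreal (w powr q) * Cq \<noteq> 0"
    proof -
      have "0 < M"
        using M by linarith
      moreover have "0 < q * (1 - 1 / real CARD('n))"
        using p q0 by simp
      ultimately show ?thesis
        using M(3) p q0 by (auto simp: Cq_def c_def epowr_eq_0_iff d_def)
    qed
    then show ?thesis
      using True q0 p by (simp add: ennreal_mult_top)
  next
    case False
    have li: "loc_int (- singular_set l) f" "loc_int (- singular_set l) (D i)" for i
      using D[of i] by (auto simp: weakd_def)
    then have [measurable]: "f \<in> borel_measurable borel" "D i \<in> borel_measurable borel" for i
      by (auto simp: loc_int_def)
    have out: "f x = 0" "D i x = 0" if "x \<in> singular_set l" for x i
      using li that by (auto simp: loc_int_def)
    have Lp: "loc_Lp (- singular_set l) p f" "loc_Lp (- singular_set l) p (D i)" for i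
      using p False le_less_trans[OF A(1)] le_less_trans[OF A(2)[of i]]
      by (auto intro!: loc_Lp_weighted simp: less_top)
    have bound: "(\<integral>\<^sup>+x. ennreal (norm (cutoff l b (Suc n) x *\<^sub>R f x) powr q) \<partial>lborel) \<le> Cq * epowr A (q / p)" for n
    proof -
      let ?\<kappa> = "cutoff l b (Suc n) :: (real, 'n) vec \<Rightarrow> real"
      define S where "S x = (\<Sum>i\<in>UNIV. \<bar>?\<kappa> x\<bar> * norm (D i x) + \<bar>partial_deriv i ?\<kappa> x\<bar> * norm (f x))" for x
      \<comment> \<open>By \<open>cutoff_eq_0\<close> the cutoff vanishes off this set, which is
        bounded and stays away from the singular set.\<close>
      define K where "K = {x :: (real, 'n) vec. 1 / real (Suc n) \<le> sig l x} \<inter> {x. x \<bullet> x \<le> real (Suc n)}"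
      have K: "compact K" "K \<subseteq> - singular_set l"
      proof -
        have "closed K"
          unfolding K_def by (intro closed_Int closed_Collect_le continuous_on_sig continuous_intros)
        moreover have "bounded K"
          unfolding bounded_iff
        proof (intro exI ballI)
          fix x assume "x \<in> K"
          then show "norm x \<le> sqrt (Suc n)"
            by (simp add: K_def norm_eq_sqrt_inner)
        qed
        ultimately show "compact K"
          by (simp add: compact_eq_bounded_closed)
        show "K \<subseteq> - singular_set l"
        proof
          fix x assume "x \<in> K"
          then have "1 / real (Suc n) \<le> sig l x"
            by (simp add: K_def)
          then have "0 < sig l x"
            by (rule less_le_trans[rotated]) simp
          then show "x \<in> - singular_set l"
            by (simp only: not_singular_iff)
        qed
      qed
      have le1: "(\<integral>\<^sup>+x. ennreal (norm (?\<kappa> x *\<^sub>R f x) powr q) \<partial>lborel)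
         \<le> ennreal ((q * (1 - 1 / CARD('n))) powr q) * (epowr 2 (q / p) *
            epowr (ennreal (2 powr p) * (\<integral>\<^sup>+x. ennreal (S x powr p) \<partial>lborel)) (q / p))"
        unfolding S_def
      proof (rule Sobolev_cutoff[OF p q open_regular D Lp])
        show "?\<kappa> differentiable at x" "continuous_on UNIV (partial_deriv i ?\<kappa>)" for x i
          by (auto intro: cutoff_C1)
        show "?\<kappa> x = 0" if "x \<notin> K" for x
          using that by (intro cutoff_eq_0) (auto simp: K_def)
      qed (use K in auto)
      have le2: "(\<integral>\<^sup>+x. ennreal (S x powr p) \<partial>lborel) \<le> ennreal (d powr p * M powr p * 2 powr p) * (ennreal (2 * d) * A)"
      proof -
        have "(\<integral>\<^sup>+x. ennreal (S x powr p) \<partial>lborel) \<le> (\<integral>\<^sup>+x. ennreal (d powr p * M powr p * 2 powr p) *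
            (\<Sum>i\<in>UNIV. ennreal ((rho l x powr b * norm (D i x)) powr p) + ennreal ((rho l x powr (b - 1) * norm (f x)) powr p)) \<partial>lborel)"
        proof (rule nn_integral_mono)
          fix x :: "(real, 'n) vec"
          define a where "a i = rho l x powr b * norm (D i x) + rho l x powr (b - 1) * norm (f x)" for i
          have a0: "0 \<le> a i" for i
            by (simp add: a_def)
          have "\<bar>?\<kappa> x\<bar> * norm (D i x) + \<bar>partial_deriv i ?\<kappa> x\<bar> * norm (f x) \<le> M * a i" for i
          proof (cases "x \<in> singular_set l")
            case False
            then have x: "x \<in> - singular_set l"
              by simp
            have "\<bar>?\<kappa> x\<bar> \<le> w * rho l x powr b"
              unfolding w_def by (rule cutoff_bounds(1)[OF x]) simp
            also have "\<dots> \<le> M * rho l x powr b"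
              using M by (intro mult_right_mono) auto
            finally have "\<bar>?\<kappa> x\<bar> \<le> M * rho l x powr b" .
            moreover have "\<bar>partial_deriv i ?\<kappa> x\<bar> \<le> M * rho l x powr (b - 1)"
              unfolding M_def by (rule cutoff_bounds(2)[OF x]) simp
            ultimately have "\<bar>?\<kappa> x\<bar> * norm (D i x) + \<bar>partial_deriv i ?\<kappa> x\<bar> * norm (f x)
                \<le> M * rho l x powr b * norm (D i x) + M * rho l x powr (b - 1) * norm (f x)"
              by (intro add_mono mult_right_mono) auto
            then show ?thesis
              by (simp add: a_def distrib_left mult.assoc)
          qed (use out a_def in simp)
          then have "S x \<le> (\<Sum>i\<in>UNIV. M * a i)"
            unfolding S_def by (rule sum_mono)
          also have "\<dots> = M * (\<Sum>i\<in>UNIV. a i)"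
            by (simp add: sum_distrib_left)
          finally have "S x powr p \<le> (M * (\<Sum>i\<in>UNIV. a i)) powr p"
            using p by (intro powr_mono2) (auto simp: S_def intro!: sum_nonneg)
          also have "\<dots> = M powr p * (\<Sum>i\<in>UNIV. a i) powr p"
            using M by (simp add: powr_mult sum_nonneg a0)
          also have "\<dots> \<le> M powr p * (d powr p * (\<Sum>i\<in>UNIV. a i powr p))"
            unfolding d_def using p a0 by (intro mult_left_mono sum_powr_le) auto
          also have "\<dots> \<le> M powr p * (d powr p * (\<Sum>i\<in>UNIV. 2 powr p *
              ((rho l x powr b * norm (D i x)) powr p + (rho l x powr (b - 1) * norm (f x)) powr p)))"
            unfolding a_def using p by (intro mult_left_mono sum_mono powr_add_le) auto
          also have "\<dots> = (d powr p * M powr p * 2 powr p) * (\<Sum>i\<in>UNIV.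
              ((rho l x powr b * norm (D i x)) powr p + (rho l x powr (b - 1) * norm (f x)) powr p))"
            by (simp only: sum_distrib_left[symmetric] ac_simps)
          finally have "ennreal (S x powr p) \<le> ennreal ((d powr p * M powr p * 2 powr p) * (\<Sum>i\<in>UNIV.
              ((rho l x powr b * norm (D i x)) powr p + (rho l x powr (b - 1) * norm (f x)) powr p)))"
            by (rule ennreal_leI)
          also have "\<dots> = ennreal (d powr p * M powr p * 2 powr p) * ennreal (\<Sum>i\<in>UNIV.
              ((rho l x powr b * norm (D i x)) powr p + (rho l x powr (b - 1) * norm (f x)) powr p))"
            by (intro ennreal_mult sum_nonneg) auto
          also have "ennreal (\<Sum>i\<in>UNIV. ((rho l x powr b * norm (D i x)) powr p + (rho l x powr (b - 1) * norm (f x)) powr p))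
             = (\<Sum>i\<in>UNIV. ennreal ((rho l x powr b * norm (D i x)) powr p) + ennreal ((rho l x powr (b - 1) * norm (f x)) powr p))"
            by (subst sum_ennreal[symmetric]) auto
          finally show "ennreal (S x powr p) \<le> ennreal (d powr p * M powr p * 2 powr p) *
            (\<Sum>i\<in>UNIV. ennreal ((rho l x powr b * norm (D i x)) powr p) + ennreal ((rho l x powr (b - 1) * norm (f x)) powr p))" .
        qed
        also have "\<dots> = ennreal (d powr p * M powr p * 2 powr p) *
            (\<Sum>i\<in>UNIV. (\<integral>\<^sup>+x. ennreal ((rho l x powr b * norm (D i x)) powr p) \<partial>lborel)
               + (\<integral>\<^sup>+x. ennreal ((rho l x powr (b - 1) * norm (f x)) powr p) \<partial>lborel))"
          by (simp add: nn_integral_cmult nn_integral_sum nn_integral_add del: sum_ennreal)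
        also have "\<dots> \<le> ennreal (d powr p * M powr p * 2 powr p) * (\<Sum>i\<in>(UNIV::'n set). A + A)"
          using A by (intro mult_left_mono sum_mono add_mono) auto
        also have "(\<Sum>i\<in>(UNIV::'n set). A + A) = ennreal (2 * d) * A"
        proof -
          have "ennreal (2 * d) = of_nat CARD('n) * 2"
            unfolding d_def ennreal_of_nat_eq_real_of_nat by (subst mult.commute) (simp add: ennreal_mult)
          then show ?thesis
            by (simp only: sum_constant mult_2[symmetric] mult.assoc)
        qed
        finally show ?thesis .
      qed
      have "(\<integral>\<^sup>+x. ennreal (norm (?\<kappa> x *\<^sub>R f x) powr q) \<partial>lborel)
         \<le> ennreal ((q * (1 - 1 / CARD('n))) powr q) * (epowr 2 (q / p) *
            epowr (ennreal (2 powr p) * (ennreal (d powr p * M powr p * 2 powr p) * (ennreal (2 * d) * A))) (q / p))"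
        using q0 p by (intro order_trans[OF le1] mult_left_mono epowr_mono le2) auto
      also have "ennreal (2 powr p) * (ennreal (d powr p * M powr p * 2 powr p) * (ennreal (2 * d) * A)) = c * A"
        by (simp only: c_def mult.assoc)
      finally show ?thesis
        using q0 p by (simp add: Cq_def epowr_mult mult.assoc)
    qed
    have lim: "ennreal ((wgt b (sig l x) * norm (f x)) powr q) = liminf (\<lambda>n. ennreal (norm (cutoff l b (Suc n) x *\<^sub>R f x) powr q))" for x
    proof -
      have "(\<lambda>n. \<bar>cutoff l b (Suc n) x\<bar> * norm (f x)) \<longlonglongrightarrow> \<bar>wgt b (sig l x)\<bar> * norm (f x)"
      proof (cases "x \<in> singular_set l")
        case False
        then have "(\<lambda>n. cutoff l b (Suc n) x) \<longlonglongrightarrow> wgt b (sig l x)"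
          by (intro cutoff_tendsto) simp
        then show ?thesis
          by (intro tendsto_intros)
      qed (simp add: out)
      then have "(\<lambda>n. ennreal ((\<bar>cutoff l b (Suc n) x\<bar> * norm (f x)) powr q)) \<longlonglongrightarrow> ennreal ((\<bar>wgt b (sig l x)\<bar> * norm (f x)) powr q)"
        using q0 by (intro tendsto_ennrealI tendsto_powr2 tendsto_const) auto
      from lim_imp_Liminf[OF sequentially_bot this] show ?thesis
        by (simp add: wgt_nonneg)
    qed
    have [measurable]: "cutoff l b (Suc n) \<in> borel_measurable (borel :: (real, 'n) vec measure)" for n
      by (intro borel_measurable_continuous_onI continuous_at_imp_continuous_on ballI differentiable_imp_continuous_within cutoff_C1(1)) simp
    have "(\<integral>\<^sup>+x. ennreal ((rho l x powr b * norm (f x)) powr q) \<partial>lborel)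
        \<le> (\<integral>\<^sup>+x. ennreal (w powr q) * liminf (\<lambda>n. ennreal (norm (cutoff l b (Suc n) x *\<^sub>R f x) powr q)) \<partial>lborel)"
    proof (rule nn_integral_mono)
      fix x
      have "rho l x powr b * norm (f x) \<le> w * (wgt b (sig l x) * norm (f x))"
      proof (cases "x \<in> singular_set l")
        case False
        then have "rho l x powr b \<le> w * wgt b (sig l x)"
          unfolding w_def by (intro wgt_le_rho) simp
        then have "rho l x powr b * norm (f x) \<le> (w * wgt b (sig l x)) * norm (f x)"
          by (rule mult_right_mono) simp
        then show ?thesis
          by (simp only: mult.assoc)
      qed (simp add: out)
      then have "(rho l x powr b * norm (f x)) powr q \<le> (w * (wgt b (sig l x) * norm (f x))) powr q"
        using q0 by (intro powr_mono2) auto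
      also have "\<dots> = w powr q * (wgt b (sig l x) * norm (f x)) powr q"
        using M(3) by (simp add: powr_mult wgt_nonneg)
      finally have "ennreal ((rho l x powr b * norm (f x)) powr q) \<le> ennreal (w powr q) * ennreal ((wgt b (sig l x) * norm (f x)) powr q)"
        by (simp add: ennreal_leI flip: ennreal_mult)
      then show "ennreal ((rho l x powr b * norm (f x)) powr q)
          \<le> ennreal (w powr q) * liminf (\<lambda>n. ennreal (norm (cutoff l b (Suc n) x *\<^sub>R f x) powr q))"
        by (simp only: lim)
    qed
    also have "\<dots> = ennreal (w powr q) * (\<integral>\<^sup>+x. liminf (\<lambda>n. ennreal (norm (cutoff l b (Suc n) x *\<^sub>R f x) powr q)) \<partial>lborel)"
      by (rule nn_integral_cmult) measurable
    also have "\<dots> \<le> ennreal (w powr q) * liminf (\<lambda>n. \<integral>\<^sup>+x. ennreal (norm (cutoff l b (Suc n) x *\<^sub>R f x) powr q) \<partial>lborel)"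
      by (intro mult_left_mono nn_integral_liminf) auto
    also have "\<dots> \<le> ennreal (w powr q) * liminf (\<lambda>n. Cq * epowr A (q / p))"
      by (intro mult_left_mono Liminf_mono always_eventually allI bound) auto
    also have "\<dots> = ennreal (w powr q) * Cq * epowr A (q / p)"
      by (simp add: Liminf_const mult.assoc)
    finally show ?thesis .
  qed
  moreover have "ennreal (w powr q) * Cq < top"
    using Cq by (simp add: ennreal_mult_less_top)
  ultimately show ?thesis
    using that by blast
qed

section \<open>Products in Kondratiev spaces\<close>

text \<open>A simultaneous choice of Borel representatives of all weak derivatives of
  \<open>W (\<lambda>_. 0)\<close> up to order \<open>m\<close>. The single number \<open>A\<close>
  bounds each weighted integral, so that constants can be quantified before
  \<open>W\<close>.\<close>

definition kdata ::
  "nat \<Rightarrow> nat \<Rightarrow> real \<Rightarrow> real \<Rightarrow> (('n \<Rightarrow> nat) \<Rightarrow> (real, 'n::{finite,linorder}) vec \<Rightarrow> complex) \<Rightarrow> ennreal \<Rightarrow> bool"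
  where "kdata l m a p W A \<longleftrightarrow> (\<forall>\<alpha>. mi_order \<alpha> \<le> m \<longrightarrow>
     weakd (- singular_set l) \<alpha> (W (\<lambda>_. 0)) (W \<alpha>) \<and>
     (\<integral>\<^sup>+x. ennreal ((rho l x powr (real (mi_order \<alpha>) - a) * norm (W \<alpha> x)) powr p) \<partial>lborel) \<le> A)"

lemma kdata_loc_int: "kdata l m a p W A \<Longrightarrow> mi_order \<alpha> \<le> m \<Longrightarrow> loc_int (- singular_set l) (W \<alpha>)"
  by (auto simp: kdata_def weakd_def)

lemma kdata_measurable: "kdata l m a p W A \<Longrightarrow> mi_order \<alpha> \<le> m \<Longrightarrow> W \<alpha> \<in> borel_measurable borel"
  using kdata_loc_int unfolding loc_int_def by blast

lemma kdata_Suc: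
  assumes "kdata l m a p W A" "mi_order \<alpha> < m"
  shows "weakd (- singular_set l) ((\<lambda>_. 0)(i := Suc 0)) (W \<alpha>) (W (\<alpha>(i := Suc (\<alpha> i))))"
proof -
  have "mi_order (\<alpha>(i := Suc (\<alpha> i))) \<le> m"
    using assms(2) by (simp only: mi_order_Suc)
  then have "weakd (- singular_set l) \<alpha> (W (\<lambda>_. 0)) (W \<alpha>)"
    "weakd (- singular_set l) (\<alpha>(i := Suc (\<alpha> i))) (W (\<lambda>_. 0)) (W (\<alpha>(i := Suc (\<alpha> i))))"
    using assms by (auto simp: kdata_def)
  then show ?thesis
    using weakd_Suc_iff by blast
qed

section \<open>Iterated Sobolev embedding for the derivatives\<close>

definition sob_exp :: "nat \<Rightarrow> real \<Rightarrow> nat \<Rightarrow> real"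
  where "sob_exp d p j = 1 / (1 / p - real j / real d)"

lemma sob_exp:
  assumes p: "1 < p" and m: "real m < real d / p" and j: "j \<le> m"
  shows "1 / sob_exp d p j = 1 / p - real j / real d" "p \<le> sob_exp d p j" "1 < sob_exp d p j"
proof -
  have d: "0 < real d"
    using p m by (cases "d = 0") auto
  have "real j / real d \<le> real m / real d"
    using j d by (intro divide_right_mono) auto
  also have "\<dots> < 1 / p"
    using m p d by (simp add: field_simps)
  finally have pos: "0 < 1 / p - real j / real d"
    by simp
  show "1 / sob_exp d p j = 1 / p - real j / real d"
    by (simp add: sob_exp_def)
  have "1 / (1 / p) \<le> 1 / (1 / p - real j / real d)"
    using pos d p by (intro divide_left_mono mult_pos_pos) auto
  then show "p \<le> sob_exp d p j"
    by (simp add: sob_exp_def)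
  then show "1 < sob_exp d p j"
    using p by simp
qed

text \<open>Induction on \<open>j\<close> for all orders \<open>k\<close> at once: level
  \<open>Suc j\<close> at order \<open>k\<close> uses level \<open>j\<close> at the orders
  \<open>k\<close> and \<open>Suc k\<close>. The weights match, because \<open>k + j - a\<close> is
  one less than \<open>Suc k + j - a\<close>, exactly the pair \<open>b - 1\<close>,
  \<open>b\<close> of \<open>weighted_Sobolev\<close>. The exponents of \<open>A\<close> compose as
  \<open>(r / p) * (q / r) = q / p\<close>.\<close>

lemma kdata_Sobolev:
  fixes p a :: real and l m :: nat
  assumes p: "1 < p" and m: "real m < real CARD('n::{finite,linorder}) / p"
  shows "\<exists>C<top. \<forall>(W :: ('n \<Rightarrow> nat) \<Rightarrow> (real, 'n) vec \<Rightarrow> complex) A \<beta>. kdata l m a p W A \<longrightarrow> mi_order \<beta> = k \<longrightarrow> k + j \<le> m \<longrightarrow>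
    (\<integral>\<^sup>+x. ennreal ((rho l x powr (real k + real j - a) * norm (W \<beta> x)) powr sob_exp CARD('n) p j) \<partial>lborel)
      \<le> C * epowr A (sob_exp CARD('n) p j / p)"
proof (induction j arbitrary: k)
  case 0
  have "sob_exp CARD('n) p 0 = p"
    by (simp add: sob_exp_def)
  then show ?case
    using p by (intro exI[of _ 1]) (auto simp: kdata_def)
next
  case (Suc j)
  show ?case
  proof (cases "k + Suc j \<le> m")
    case True
    define r where "r = sob_exp CARD('n) p j"
    define q where "q = sob_exp CARD('n) p (Suc j)"
    define b where "b = real k + real (Suc j) - a"
    have r: "1 / r = 1 / p - real j / CARD('n)" "1 < r" "p \<le> r"
      and q: "1 / q = 1 / p - real (Suc j) / CARD('n)" "1 < q"
      using sob_exp[OF p m, of j] sob_exp[OF p m, of "Suc j"] True by (auto simp: r_def q_def)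
    have d: "0 < real CARD('n)"
      by simp
    have qr: "1 / q = 1 / r - 1 / CARD('n)"
      by (simp add: r q add_divide_distrib)
    \<comment> \<open>Positivity of the reciprocal of the next exponent \<open>q\<close> says that
      the current exponent \<open>r\<close> is still below the dimension.\<close>
    have "1 / CARD('n) < 1 / r"
      using qr q(2) by (smt (verit) zero_less_divide_1_iff)
    then have "r < CARD('n)"
      using r(2) d by (simp add: field_simps)
    obtain C where C: "C < top"
      "\<And>(f :: (real, 'n) vec \<Rightarrow> complex) D A.
       (\<And>i. weakd (- singular_set l) ((\<lambda>_. 0)(i := Suc 0)) f (D i)) \<Longrightarrow>
       (\<integral>\<^sup>+x. ennreal ((rho l x powr (b - 1) * norm (f x)) powr r) \<partial>lborel) \<le> A \<Longrightarrow>
       (\<And>i. (\<integral>\<^sup>+x. ennreal ((rho l x powr b * norm (D i x)) powr r) \<partial>lborel) \<le> A) \<Longrightarrow>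
       (\<integral>\<^sup>+x. ennreal ((rho l x powr b * norm (f x)) powr q) \<partial>lborel) \<le> C * epowr A (q / r)"
      by (rule weighted_Sobolev[OF r(2) \<open>r < CARD('n)\<close> qr, of l b]) blast
    obtain C0 where C0: "C0 < top"
      "\<And>(W :: ('n \<Rightarrow> nat) \<Rightarrow> (real, 'n) vec \<Rightarrow> complex) A \<beta>. kdata l m a p W A \<Longrightarrow> mi_order \<beta> = k \<Longrightarrow> k + j \<le> m \<Longrightarrow>
        (\<integral>\<^sup>+x. ennreal ((rho l x powr (real k + real j - a) * norm (W \<beta> x)) powr r) \<partial>lborel) \<le> C0 * epowr A (r / p)"
      using Suc.IH[of k] unfolding r_def by blast
    obtain C1 where C1: "C1 < top"
      "\<And>(W :: ('n \<Rightarrow> nat) \<Rightarrow> (real, 'n) vec \<Rightarrow> complex) A \<beta>. kdata l m a p W A \<Longrightarrow> mi_order \<beta> = Suc k \<Longrightarrow> Suc k + j \<le> m \<Longrightarrow>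
        (\<integral>\<^sup>+x. ennreal ((rho l x powr (real (Suc k) + real j - a) * norm (W \<beta> x)) powr r) \<partial>lborel) \<le> C1 * epowr A (r / p)"
      using Suc.IH[of "Suc k"] unfolding r_def by blast
    define E where "E = C0 + C1"
    have "(\<integral>\<^sup>+x. ennreal ((rho l x powr b * norm (W \<beta> x)) powr q) \<partial>lborel) \<le> (C * epowr E (q / r)) * epowr A (q / p)"
      if W: "kdata l m a p W A" and \<beta>: "mi_order \<beta> = k" for W :: "('n \<Rightarrow> nat) \<Rightarrow> (real, 'n) vec \<Rightarrow> complex" and A \<beta>
    proof -
      have "(\<integral>\<^sup>+x. ennreal ((rho l x powr b * norm (W \<beta> x)) powr q) \<partial>lborel) \<le> C * epowr (E * epowr A (r / p)) (q / r)"
      proof (rule C(2))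
        show "weakd (- singular_set l) ((\<lambda>_. 0)(i := Suc 0)) (W \<beta>) (W (\<beta>(i := Suc (\<beta> i))))" for i
          using \<beta> True by (intro kdata_Suc[OF W]) simp
        have "b - 1 = real k + real j - a"
          by (simp add: b_def)
        then have "(\<integral>\<^sup>+x. ennreal ((rho l x powr (b - 1) * norm (W \<beta> x)) powr r) \<partial>lborel) \<le> C0 * epowr A (r / p)"
          using C0(2)[OF W \<beta>] True by simp
        also have "\<dots> \<le> E * epowr A (r / p)"
          by (intro mult_right_mono) (auto simp: E_def)
        finally show "(\<integral>\<^sup>+x. ennreal ((rho l x powr (b - 1) * norm (W \<beta> x)) powr r) \<partial>lborel) \<le> E * epowr A (r / p)" .
        fix i
        have "b = real (Suc k) + real j - a"
          by (simp add: b_def)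
        moreover have "mi_order (\<beta>(i := Suc (\<beta> i))) = Suc k"
          using \<beta> by (simp only: mi_order_Suc)
        ultimately have "(\<integral>\<^sup>+x. ennreal ((rho l x powr b * norm (W (\<beta>(i := Suc (\<beta> i))) x)) powr r) \<partial>lborel) \<le> C1 * epowr A (r / p)"
          using C1(2)[OF W] True by simp
        also have "\<dots> \<le> E * epowr A (r / p)"
          by (intro mult_right_mono) (auto simp: E_def)
        finally show "(\<integral>\<^sup>+x. ennreal ((rho l x powr b * norm (W (\<beta>(i := Suc (\<beta> i))) x)) powr r) \<partial>lborel) \<le> E * epowr A (r / p)" .
      qed
      also have "\<dots> = (C * epowr E (q / r)) * epowr A (q / p)"
        using r q p by (simp add: epowr_mult epowr_epowr mult.assoc)
      finally show ?thesis .
    qed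
    moreover have "epowr E (q / r) < top"
      using C0(1) C1(1) by (auto simp: less_top[symmetric] epowr_eq_top_iff E_def)
    then have "C * epowr E (q / r) < top"
      using C(1) by (simp add: ennreal_mult_less_top)
    ultimately show ?thesis
      unfolding b_def q_def by blast
  qed (auto intro: exI[of _ 0])
qed

lemma loc_Lp_kdata:
  fixes W :: "('n::{finite,linorder} \<Rightarrow> nat) \<Rightarrow> (real, 'n) vec \<Rightarrow> complex"
  assumes p: "1 < p" and m: "real m < real CARD('n) / p"
    and W: "kdata l m a p W A" "A < top" and j: "mi_order \<beta> + j \<le> m"
  shows "loc_Lp (- singular_set l) (sob_exp CARD('n) p j) (W \<beta>)"
proof -
  have q: "1 < sob_exp CARD('n) p j"
    using sob_exp[OF p m, of j] j by simp
  obtain C where C: "C < top" "(\<integral>\<^sup>+x. ennreal ((rho l x powr (real (mi_order \<beta>) + real j - a) * norm (W \<beta> x)) powr sob_exp CARD('n) p j) \<partial>lborel)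
      \<le> C * epowr A (sob_exp CARD('n) p j / p)"
    using kdata_Sobolev[OF p m, of l a "mi_order \<beta>" j] W(1) j by blast
  have "epowr A (sob_exp CARD('n) p j / p) < top"
    using W(2) by (auto simp: less_top[symmetric] epowr_eq_top_iff)
  with C have "(\<integral>\<^sup>+x. ennreal ((rho l x powr (real (mi_order \<beta>) + real j - a) * norm (W \<beta> x)) powr sob_exp CARD('n) p j) \<partial>lborel) < top"
    by (auto intro: le_less_trans simp: ennreal_mult_less_top)
  then show ?thesis
    using q j by (intro loc_Lp_weighted kdata_measurable[OF W(1)]) auto
qed

section \<open>The Leibniz formula and the estimate of its terms\<close>

lemma weakd_add:
  assumes "weakd \<Omega> \<alpha> f g" "weakd \<Omega> \<alpha> f' g'"
  shows "weakd \<Omega> \<alpha> (\<lambda>x. f x + f' x) (\<lambda>x. g x + g' x)"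
proof -
  have li: "loc_int \<Omega> f" "loc_int \<Omega> g" "loc_int \<Omega> f'" "loc_int \<Omega> g'"
    using assms by (auto simp: weakd_def)
  show ?thesis
    using assms loc_int_test_integrable[OF li(1) test_function_mi_deriv] loc_int_test_integrable[OF li(3) test_function_mi_deriv]
      loc_int_test_integrable[OF li(2)] loc_int_test_integrable[OF li(4)]
    by (simp add: weakd_def loc_int_add scaleR_add_right)
qed

lemma weakd_sum_list:
  "(\<And>z. z \<in> set L \<Longrightarrow> weakd \<Omega> \<alpha> (f z) (g z)) \<Longrightarrow> weakd \<Omega> \<alpha> (\<lambda>x. \<Sum>z\<leftarrow>L. f z x) (\<lambda>x. \<Sum>z\<leftarrow>L. g z x)"
proof (induction L)
  case Nil
  have "loc_int \<Omega> (\<lambda>x. 0)"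
    by (simp add: loc_int_def)
  then show ?case
    by (simp add: weakd_def)
qed (auto intro: weakd_add)

text \<open>The reciprocals add up to \<open>2 / p - m / d\<close> since \<open>m - k\<close> and
  \<open>k\<close> together lose \<open>m\<close> derivatives. The lower bound on \<open>m\<close>
  means that the denominator \<open>2 * (d / p) - m\<close> of \<open>t\<close> is less than
  \<open>d\<close>.\<close>

lemma exponent_pair:
  assumes p: "1 < p" and m: "real m < real d / p" and k: "k \<le> m"
    and t: "t = real d / (2 * (real d / p) - real m)" "2 * real d * (1 / p - 1 / 2) < real m"
  shows "1 / sob_exp d p (m - k) + 1 / sob_exp d p k = 1 / t" "1 < t"
proof -
  have d: "0 < real d"
    using p m by (cases "d = 0") auto
  have pos: "0 < 2 * (real d / p) - real m"
    using m p by (smt (verit) of_nat_0_le_iff)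
  have t': "1 / t = 2 / p - real m / real d"
    using d pos by (simp add: t field_simps)
  have "1 / sob_exp d p (m - k) + 1 / sob_exp d p k = 2 / p - (real (m - k) + real k) / real d"
  proof -
    have "m - k \<le> m"
      by simp
    then show ?thesis
      unfolding sob_exp(1)[OF p m \<open>m - k \<le> m\<close>] sob_exp(1)[OF p m k] by (simp add: add_divide_distrib del: of_nat_diff)
  qed
  then show "1 / sob_exp d p (m - k) + 1 / sob_exp d p k = 1 / t"
    using k t' by simp
  have "2 * (real d / p) - real m < real d"
    using t(2) by (simp add: algebra_simps)
  then show "1 < t"
    using pos by (simp add: t)
qed

text \<open>Spend all \<open>m - mi_order \<beta>\<close> remaining orders on \<open>U\<close> and
  \<open>mi_order \<beta>\<close> orders on \<open>V\<close>; the latter is permitted because the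
  two orders together do not exceed \<open>m\<close>. That the reciprocals sum to at most 1 is the
  inequality \<open>1 < t\<close>.\<close>

lemma loc_Lp_pair:
  fixes U V :: "('n::{finite,linorder} \<Rightarrow> nat) \<Rightarrow> (real, 'n) vec \<Rightarrow> complex"
  assumes p: "1 < p" and m: "real m < real CARD('n) / p"
    and t: "t = real CARD('n) / (2 * (real CARD('n) / p) - real m)" "2 * real CARD('n) * (1 / p - 1 / 2) < real m"
    and U: "kdata l m a p U A" "A < top" and V: "kdata l m a p V B" "B < top"
    and \<beta>\<gamma>: "mi_order \<beta> + mi_order \<gamma> \<le> m"
  obtains r s where "loc_Lp (- singular_set l) r (U \<beta>)" "loc_Lp (- singular_set l) s (V \<gamma>)" "1 \<le> r" "1 \<le> s" "1 / r + 1 / s \<le> 1"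
proof
  let ?k = "mi_order \<beta>"
  have k: "?k \<le> m"
    using \<beta>\<gamma> by simp
  show "loc_Lp (- singular_set l) (sob_exp CARD('n) p (m - ?k)) (U \<beta>)"
    using \<beta>\<gamma> by (intro loc_Lp_kdata[OF p m U]) simp
  show "loc_Lp (- singular_set l) (sob_exp CARD('n) p ?k) (V \<gamma>)"
    using \<beta>\<gamma> by (intro loc_Lp_kdata[OF p m V]) simp
  show "1 \<le> sob_exp CARD('n) p (m - ?k)" "1 \<le> sob_exp CARD('n) p ?k"
    using sob_exp(3)[OF p m, of "m - ?k"] sob_exp(3)[OF p m k] by auto
  have "1 < t"
    by (rule exponent_pair(2)[OF p m k t])
  then show "1 / sob_exp CARD('n) p (m - ?k) + 1 / sob_exp CARD('n) p ?k \<le> 1"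
    by (simp add: exponent_pair(1)[OF p m k t])
qed

text \<open>The binomial coefficients are encoded by repetitions in the list, which spares their
  recursion. The list precedes \<open>U\<close> and \<open>V\<close> in the quantifiers, as the
  uniform constants require.\<close>

lemma Leibniz:
  fixes \<alpha> :: "'n::{finite,linorder} \<Rightarrow> nat"
  assumes p: "1 < p" and m: "real m < real CARD('n) / p"
    and t: "t = real CARD('n) / (2 * (real CARD('n) / p) - real m)" "2 * real CARD('n) * (1 / p - 1 / 2) < real m"
    and \<alpha>: "mi_order \<alpha> = k" "k \<le> m"
  shows "\<exists>L :: (('n \<Rightarrow> nat) \<times> ('n \<Rightarrow> nat)) list. (\<forall>(\<beta>, \<gamma>)\<in>set L. mi_order \<beta> + mi_order \<gamma> = k) \<and>
    (\<forall>(U :: ('n \<Rightarrow> nat) \<Rightarrow> (real, 'n) vec \<Rightarrow> complex) V A B. kdata l m a p U A \<and> A < top \<and> kdata l m a p V B \<and> B < top \<longrightarrow>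
      weakd (- singular_set l) \<alpha> (\<lambda>x. U (\<lambda>_. 0) x * V (\<lambda>_. 0) x) (\<lambda>x. \<Sum>(\<beta>, \<gamma>)\<leftarrow>L. U \<beta> x * V \<gamma> x))"
  using \<alpha>
proof (induction k arbitrary: \<alpha>)
  case 0
  then have \<alpha>0: "\<alpha> = (\<lambda>_. 0)"
    by (simp add: mi_order_eq_0)
  have "loc_int (- singular_set l) (\<lambda>x. U (\<lambda>_. 0) x * V (\<lambda>_. 0) x)"
    if UV: "kdata l m a p U A" "A < top" "kdata l m a p V B" "B < top"
    for U V :: "('n \<Rightarrow> nat) \<Rightarrow> (real, 'n) vec \<Rightarrow> complex" and A B
  proof -
    obtain r s where rs: "loc_Lp (- singular_set l) r (U (\<lambda>_. 0))" "loc_Lp (- singular_set l) s (V (\<lambda>_. 0))" "1 \<le> r" "1 \<le> s" "1 / r + 1 / s \<le> 1"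
      by (rule loc_Lp_pair[OF p m t UV, of "\<lambda>_. 0" "\<lambda>_. 0"]) auto
    show ?thesis
      by (rule loc_int_mult[OF kdata_loc_int[OF UV(1)] kdata_loc_int[OF UV(3)] rs]) auto
  qed
  then show ?case
    unfolding \<alpha>0 by (intro exI[of _ "[(\<lambda>_. 0, \<lambda>_. 0)]"]) (auto intro: weakd_zero)
next
  case (Suc k)
  obtain \<alpha>' i where \<alpha>': "\<alpha> = \<alpha>'(i := Suc (\<alpha>' i))" "mi_order \<alpha>' = k"
    using mi_order_SucE[OF Suc.prems(1)] .
  obtain L :: "(('n \<Rightarrow> nat) \<times> ('n \<Rightarrow> nat)) list" where L: "\<forall>(\<beta>, \<gamma>)\<in>set L. mi_order \<beta> + mi_order \<gamma> = k"
    "\<And>(U :: ('n \<Rightarrow> nat) \<Rightarrow> (real, 'n) vec \<Rightarrow> complex) V A B. kdata l m a p U A \<Longrightarrow> A < top \<Longrightarrow> kdata l m a p V B \<Longrightarrow> B < top \<Longrightarrow>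
      weakd (- singular_set l) \<alpha>' (\<lambda>x. U (\<lambda>_. 0) x * V (\<lambda>_. 0) x) (\<lambda>x. \<Sum>(\<beta>, \<gamma>)\<leftarrow>L. U \<beta> x * V \<gamma> x)"
    using Suc.IH[OF \<alpha>'(2) Suc_leD[OF Suc.prems(2)]] by blast
  \<comment> \<open>Differentiating once more replaces each pair by two, with the new derivative on
    either factor.\<close>
  define L' where "L' = concat (map (\<lambda>(\<beta>, \<gamma>). [(\<beta>(i := Suc (\<beta> i)), \<gamma>), (\<beta>, \<gamma>(i := Suc (\<gamma> i)))]) L)"
  have "\<forall>(\<beta>, \<gamma>)\<in>set L'. mi_order \<beta> + mi_order \<gamma> = Suc k"
    using L(1) by (auto simp: L'_def mi_order_Suc simp del: fun_upd_apply)
  moreover have "weakd (- singular_set l) \<alpha> (\<lambda>x. U (\<lambda>_. 0) x * V (\<lambda>_. 0) x) (\<lambda>x. \<Sum>(\<beta>, \<gamma>)\<leftarrow>L'. U \<beta> x * V \<gamma> x)"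
    if UV: "kdata l m a p U A" "A < top" "kdata l m a p V B" "B < top"
    for U V :: "('n \<Rightarrow> nat) \<Rightarrow> (real, 'n) vec \<Rightarrow> complex" and A B
  proof -
    have "weakd (- singular_set l) ((\<lambda>_. 0)(i := Suc 0)) (\<lambda>x. \<Sum>z\<leftarrow>L. U (fst z) x * V (snd z) x)
      (\<lambda>x. \<Sum>z\<leftarrow>L. U ((fst z)(i := Suc (fst z i))) x * V (snd z) x + U (fst z) x * V ((snd z)(i := Suc (snd z i))) x)"
    proof (rule weakd_sum_list)
      fix z assume z: "z \<in> set L"
      define \<beta> \<gamma> where "\<beta> = fst z" and "\<gamma> = snd z"
      have ord: "mi_order \<beta> + mi_order \<gamma> = k"
        using L(1) z by (auto simp: \<beta>_def \<gamma>_def)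
      have ord': "mi_order (\<beta>(i := Suc (\<beta> i))) + mi_order \<gamma> \<le> m" "mi_order \<beta> + mi_order (\<gamma>(i := Suc (\<gamma> i))) \<le> m"
        "mi_order \<beta> + mi_order \<gamma> \<le> m" "mi_order \<beta> < m" "mi_order \<gamma> < m"
        using ord Suc.prems(2) unfolding mi_order_Suc by auto
      obtain r0 s0 where 0: "loc_Lp (- singular_set l) r0 (U \<beta>)" "loc_Lp (- singular_set l) s0 (V \<gamma>)" "1 \<le> r0" "1 \<le> s0" "1 / r0 + 1 / s0 \<le> 1"
        by (rule loc_Lp_pair[OF p m t UV ord'(3)])
      obtain r1 s1 where 1: "loc_Lp (- singular_set l) r1 (U (\<beta>(i := Suc (\<beta> i))))" "loc_Lp (- singular_set l) s1 (V \<gamma>)" "1 \<le> r1" "1 \<le> s1" "1 / r1 + 1 / s1 \<le> 1"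
        by (rule loc_Lp_pair[OF p m t UV ord'(1)])
      obtain r2 s2 where 2: "loc_Lp (- singular_set l) r2 (U \<beta>)" "loc_Lp (- singular_set l) s2 (V (\<gamma>(i := Suc (\<gamma> i))))" "1 \<le> r2" "1 \<le> s2" "1 / r2 + 1 / s2 \<le> 1"
        by (rule loc_Lp_pair[OF p m t UV ord'(2)])
      show "weakd (- singular_set l) ((\<lambda>_. 0)(i := Suc 0)) (\<lambda>x. U (fst z) x * V (snd z) x)
         (\<lambda>x. U ((fst z)(i := Suc (fst z i))) x * V (snd z) x + U (fst z) x * V ((snd z)(i := Suc (snd z i))) x)"
        unfolding \<beta>_def[symmetric] \<gamma>_def[symmetric]
        by (rule weakd_mult[OF open_regular kdata_Suc[OF UV(1) ord'(4)] kdata_Suc[OF UV(3) ord'(5)] 0 1 2])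
    qed
    moreover have "(\<Sum>z\<leftarrow>L. U ((fst z)(i := Suc (fst z i))) x * V (snd z) x + U (fst z) x * V ((snd z)(i := Suc (snd z i))) x)
        = (\<Sum>(\<beta>, \<gamma>)\<leftarrow>L'. U \<beta> x * V \<gamma> x)" for x
      unfolding L'_def by (induction L) (auto simp: split_beta add.assoc)
    moreover have "(\<Sum>z\<leftarrow>L. U (fst z) x * V (snd z) x) = (\<Sum>(\<beta>, \<gamma>)\<leftarrow>L. U \<beta> x * V \<gamma> x)" for x
      by (simp add: case_prod_beta')
    ultimately show ?thesis
      using weakd_Suc_iff[OF L(2)[OF UV], of i] unfolding \<alpha>'(1) by simp
  qed
  ultimately show ?case
    by (intro exI[of _ L']) blast
qed

text \<open>Hoelder with the weights \<open>t / r\<close> and \<open>t / s\<close>. The two powers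
  of \<open>rho\<close> supplied by \<open>kdata_Sobolev\<close> have exponents summing to
  \<open>k\<^sub>1 + k\<^sub>2 - (2 * a\<^sub>0 - m)\<close>, which is at most the exponent
  wanted.\<close>

lemma pair_estimate:
  fixes p a\<^sub>0 a\<^sub>1 t :: real and l m :: nat
  assumes p: "1 < p" and m: "real m < real CARD('n::{finite,linorder}) / p"
    and t: "t = real CARD('n) / (2 * (real CARD('n) / p) - real m)" "2 * real CARD('n) * (1 / p - 1 / 2) < real m"
    and a: "a\<^sub>1 \<le> 2 * a\<^sub>0 - real m" and k: "k\<^sub>1 + k\<^sub>2 \<le> m"
  shows "\<exists>C<top. \<forall>(U :: ('n \<Rightarrow> nat) \<Rightarrow> (real, 'n) vec \<Rightarrow> complex) V A B \<beta> \<gamma>.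
    kdata l m a\<^sub>0 p U A \<longrightarrow> kdata l m a\<^sub>0 p V B \<longrightarrow> mi_order \<beta> = k\<^sub>1 \<longrightarrow> mi_order \<gamma> = k\<^sub>2 \<longrightarrow>
    (\<integral>\<^sup>+x. ennreal ((rho l x powr (real (k\<^sub>1 + k\<^sub>2) - a\<^sub>1) * norm (U \<beta> x * V \<gamma> x)) powr t) \<partial>lborel)
      \<le> C * (epowr A (t / p) * epowr B (t / p))"
proof -
  have k1: "k\<^sub>1 \<le> m"
    using k by simp
  define r where "r = sob_exp CARD('n) p (m - k\<^sub>1)"
  define s where "s = sob_exp CARD('n) p k\<^sub>1"
  have rs: "1 < r" "1 < s"
    using sob_exp(3)[OF p m] k1 by (auto simp: r_def s_def)
  have t1: "1 < t" "1 / r + 1 / s = 1 / t"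
    using exponent_pair[OF p m k1 t] by (auto simp: r_def s_def)
  have tw: "t / r + t / s = 1"
    using t1 by (metis distrib_left divide_self_if not_one_less_zero times_divide_eq_right mult.right_neutral)
  obtain C1 where C1: "C1 < top"
    "\<And>(W :: ('n \<Rightarrow> nat) \<Rightarrow> (real, 'n) vec \<Rightarrow> complex) A \<beta>. kdata l m a\<^sub>0 p W A \<Longrightarrow> mi_order \<beta> = k\<^sub>1 \<Longrightarrow>
        (\<integral>\<^sup>+x. ennreal ((rho l x powr (real k\<^sub>1 + real (m - k\<^sub>1) - a\<^sub>0) * norm (W \<beta> x)) powr r) \<partial>lborel) \<le> C1 * epowr A (r / p)"
    using kdata_Sobolev[OF p m, of l a\<^sub>0 k\<^sub>1 "m - k\<^sub>1"] k1 unfolding r_def by auto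
  obtain C2 where C2: "C2 < top"
    "\<And>(W :: ('n \<Rightarrow> nat) \<Rightarrow> (real, 'n) vec \<Rightarrow> complex) A \<beta>. kdata l m a\<^sub>0 p W A \<Longrightarrow> mi_order \<beta> = k\<^sub>2 \<Longrightarrow>
        (\<integral>\<^sup>+x. ennreal ((rho l x powr (real k\<^sub>2 + real k\<^sub>1 - a\<^sub>0) * norm (W \<beta> x)) powr s) \<partial>lborel) \<le> C2 * epowr A (s / p)"
    using kdata_Sobolev[OF p m, of l a\<^sub>0 k\<^sub>2 k\<^sub>1] k unfolding s_def by auto
  define C where "C = epowr C1 (t / r) * epowr C2 (t / s)"
  have "epowr C1 (t / r) < top" "epowr C2 (t / s) < top"
    using C1(1) C2(1) by (auto simp: less_top[symmetric] epowr_eq_top_iff)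
  then have C: "C < top"
    by (simp add: C_def ennreal_mult_less_top)
  have "(\<integral>\<^sup>+x. ennreal ((rho l x powr (real (k\<^sub>1 + k\<^sub>2) - a\<^sub>1) * norm (U \<beta> x * V \<gamma> x)) powr t) \<partial>lborel)
      \<le> C * (epowr A (t / p) * epowr B (t / p))"
    if U: "kdata l m a\<^sub>0 p U A" and V: "kdata l m a\<^sub>0 p V B" and \<beta>: "mi_order \<beta> = k\<^sub>1" and \<gamma>: "mi_order \<gamma> = k\<^sub>2"
    for U V :: "('n \<Rightarrow> nat) \<Rightarrow> (real, 'n) vec \<Rightarrow> complex" and A B \<beta> \<gamma>
  proof -
    define F where "F x = ennreal ((rho l x powr (real k\<^sub>1 + real (m - k\<^sub>1) - a\<^sub>0) * norm (U \<beta> x)) powr r)" for x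
    define G where "G x = ennreal ((rho l x powr (real k\<^sub>2 + real k\<^sub>1 - a\<^sub>0) * norm (V \<gamma> x)) powr s)" for x
    have [measurable]: "U \<beta> \<in> borel_measurable borel" "V \<gamma> \<in> borel_measurable borel"
      using kdata_measurable[OF U, of \<beta>] kdata_measurable[OF V, of \<gamma>] k \<beta> \<gamma> by auto
    have out: "U \<beta> x = 0" if "x \<in> singular_set l" for x
      using kdata_loc_int[OF U, of \<beta>] k \<beta> that by (auto simp: loc_int_def)
    have "(\<integral>\<^sup>+x. ennreal ((rho l x powr (real (k\<^sub>1 + k\<^sub>2) - a\<^sub>1) * norm (U \<beta> x * V \<gamma> x)) powr t) \<partial>lborel)
        \<le> (\<integral>\<^sup>+x. epowr (F x) (t / r) * epowr (G x) (t / s) \<partial>lborel)"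
    proof (rule nn_integral_mono)
      fix x
      have "rho l x powr (real (k\<^sub>1 + k\<^sub>2) - a\<^sub>1) * norm (U \<beta> x * V \<gamma> x)
         \<le> (rho l x powr (real k\<^sub>1 + real (m - k\<^sub>1) - a\<^sub>0) * norm (U \<beta> x)) * (rho l x powr (real k\<^sub>2 + real k\<^sub>1 - a\<^sub>0) * norm (V \<gamma> x))"
      proof (cases "x \<in> singular_set l")
        case False
        then have rho: "0 < rho l x" "rho l x \<le> 1"
          using rho_pos[of x l] by (auto simp: rho_le_1)
        \<comment> \<open>The larger exponent gives the smaller power, as \<open>rho\<close> does
          not exceed 1.\<close>
        have "rho l x powr (real (k\<^sub>1 + k\<^sub>2) - a\<^sub>1) \<le> rho l x powr ((real k\<^sub>1 + real (m - k\<^sub>1) - a\<^sub>0) + (real k\<^sub>2 + real k\<^sub>1 - a\<^sub>0))"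
          using rho a k1 by (intro powr_mono') auto
        also have "\<dots> = rho l x powr (real k\<^sub>1 + real (m - k\<^sub>1) - a\<^sub>0) * rho l x powr (real k\<^sub>2 + real k\<^sub>1 - a\<^sub>0)"
          by (rule powr_add)
        finally have "rho l x powr (real (k\<^sub>1 + k\<^sub>2) - a\<^sub>1) * (norm (U \<beta> x) * norm (V \<gamma> x))
          \<le> (rho l x powr (real k\<^sub>1 + real (m - k\<^sub>1) - a\<^sub>0) * rho l x powr (real k\<^sub>2 + real k\<^sub>1 - a\<^sub>0)) * (norm (U \<beta> x) * norm (V \<gamma> x))"
          by (intro mult_right_mono) auto
        then show ?thesis
          by (simp only: norm_mult ac_simps)
      qed (simp add: out)
      then have "(rho l x powr (real (k\<^sub>1 + k\<^sub>2) - a\<^sub>1) * norm (U \<beta> x * V \<gamma> x)) powr t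
         \<le> ((rho l x powr (real k\<^sub>1 + real (m - k\<^sub>1) - a\<^sub>0) * norm (U \<beta> x)) * (rho l x powr (real k\<^sub>2 + real k\<^sub>1 - a\<^sub>0) * norm (V \<gamma> x))) powr t"
        using t1(1) by (intro powr_mono2) auto
      also have "\<dots> = (rho l x powr (real k\<^sub>1 + real (m - k\<^sub>1) - a\<^sub>0) * norm (U \<beta> x)) powr t * (rho l x powr (real k\<^sub>2 + real k\<^sub>1 - a\<^sub>0) * norm (V \<gamma> x)) powr t"
        by (rule powr_mult) 
      finally have "ennreal ((rho l x powr (real (k\<^sub>1 + k\<^sub>2) - a\<^sub>1) * norm (U \<beta> x * V \<gamma> x)) powr t)
        \<le> ennreal ((rho l x powr (real k\<^sub>1 + real (m - k\<^sub>1) - a\<^sub>0) * norm (U \<beta> x)) powr t) * ennreal ((rho l x powr (real k\<^sub>2 + real k\<^sub>1 - a\<^sub>0) * norm (V \<gamma> x)) powr t)"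
        by (subst ennreal_mult[symmetric]) (auto intro: ennreal_leI)
      also have "\<dots> = epowr (F x) (t / r) * epowr (G x) (t / s)"
        unfolding F_def G_def using rs t1(1)
        by (subst (1 2) epowr_ennreal) (auto simp only: powr_powr powr_ge_zero, auto)
      finally show "ennreal ((rho l x powr (real (k\<^sub>1 + k\<^sub>2) - a\<^sub>1) * norm (U \<beta> x * V \<gamma> x)) powr t) \<le> epowr (F x) (t / r) * epowr (G x) (t / s)" .
    qed
    also have "\<dots> \<le> epowr (\<integral>\<^sup>+x. F x \<partial>lborel) (t / r) * epowr (\<integral>\<^sup>+x. G x \<partial>lborel) (t / s)"
      using rs t1(1) tw unfolding F_def G_def by (intro nn_integral_Hoelder2) auto
    also have "\<dots> \<le> epowr (C1 * epowr A (r / p)) (t / r) * epowr (C2 * epowr B (s / p)) (t / s)"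
      using C1(2)[OF U \<beta>] C2(2)[OF V \<gamma>] rs t1(1) unfolding F_def G_def by (intro mult_mono epowr_mono) auto
    also have "\<dots> = C * (epowr A (t / p) * epowr B (t / p))"
      using rs t1(1) p by (simp add: C_def epowr_mult epowr_epowr ac_simps)
    finally show ?thesis .
  qed
  with C show ?thesis
    by blast
qed

lemma Leibniz_estimate:
  fixes p a\<^sub>0 a\<^sub>1 t :: real and l m :: nat and L :: "(('n::{finite,linorder} \<Rightarrow> nat) \<times> ('n \<Rightarrow> nat)) list"
  assumes p: "1 < p" and m: "real m < real CARD('n) / p"
    and t: "t = real CARD('n) / (2 * (real CARD('n) / p) - real m)" "2 * real CARD('n) * (1 / p - 1 / 2) < real m"
    and a: "a\<^sub>1 \<le> 2 * a\<^sub>0 - real m" and k: "k \<le> m"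
    and L: "\<forall>(\<beta>, \<gamma>)\<in>set L. mi_order \<beta> + mi_order \<gamma> = k"
  shows "\<exists>C<top. \<forall>(U :: ('n \<Rightarrow> nat) \<Rightarrow> (real, 'n) vec \<Rightarrow> complex) V A B.
    kdata l m a\<^sub>0 p U A \<longrightarrow> kdata l m a\<^sub>0 p V B \<longrightarrow>
    (\<integral>\<^sup>+x. ennreal ((rho l x powr (real k - a\<^sub>1) * norm (\<Sum>(\<beta>, \<gamma>)\<leftarrow>L. U \<beta> x * V \<gamma> x)) powr t) \<partial>lborel)
      \<le> C * (epowr A (t / p) * epowr B (t / p))"
  using L
proof (induction L)
  case Nil
  show ?case
    by (intro exI[of _ 0]) simp
next
  case (Cons z L)
  obtain \<beta>\<^sub>0 \<gamma>\<^sub>0 where z: "z = (\<beta>\<^sub>0, \<gamma>\<^sub>0)"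
    by (cases z)
  have ord: "mi_order \<beta>\<^sub>0 + mi_order \<gamma>\<^sub>0 = k" and L: "\<forall>(\<beta>, \<gamma>)\<in>set L. mi_order \<beta> + mi_order \<gamma> = k"
    using Cons.prems z by auto
  have t1: "1 < t"
    using exponent_pair(2)[OF p m _ t, of 0] by simp
  obtain C1 where C1: "C1 < top" "\<And>(U :: ('n \<Rightarrow> nat) \<Rightarrow> (real, 'n) vec \<Rightarrow> complex) V A B.
    kdata l m a\<^sub>0 p U A \<Longrightarrow> kdata l m a\<^sub>0 p V B \<Longrightarrow>
    (\<integral>\<^sup>+x. ennreal ((rho l x powr (real k - a\<^sub>1) * norm (\<Sum>(\<beta>, \<gamma>)\<leftarrow>L. U \<beta> x * V \<gamma> x)) powr t) \<partial>lborel)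
      \<le> C1 * (epowr A (t / p) * epowr B (t / p))"
    using Cons.IH[OF L] by blast
  have "mi_order \<beta>\<^sub>0 + mi_order \<gamma>\<^sub>0 \<le> m"
    using ord k by simp
  from pair_estimate[OF p m t a this, of l]
  obtain C2 where C2: "C2 < top" "\<And>(U :: ('n \<Rightarrow> nat) \<Rightarrow> (real, 'n) vec \<Rightarrow> complex) V A B.
    kdata l m a\<^sub>0 p U A \<Longrightarrow> kdata l m a\<^sub>0 p V B \<Longrightarrow>
    (\<integral>\<^sup>+x. ennreal ((rho l x powr (real k - a\<^sub>1) * norm (U \<beta>\<^sub>0 x * V \<gamma>\<^sub>0 x)) powr t) \<partial>lborel)
      \<le> C2 * (epowr A (t / p) * epowr B (t / p))"
    unfolding ord by blast
  have "(\<integral>\<^sup>+x. ennreal ((rho l x powr (real k - a\<^sub>1) * norm (\<Sum>(\<beta>, \<gamma>)\<leftarrow>z # L. U \<beta> x * V \<gamma> x)) powr t) \<partial>lborel)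
      \<le> (ennreal (2 powr t) * (C2 + C1)) * (epowr A (t / p) * epowr B (t / p))"
    if U: "kdata l m a\<^sub>0 p U A" and V: "kdata l m a\<^sub>0 p V B"
    for U V :: "('n \<Rightarrow> nat) \<Rightarrow> (real, 'n) vec \<Rightarrow> complex" and A B
  proof -
    have meas: "(\<lambda>x. U \<beta> x * V \<gamma> x) \<in> borel_measurable borel" if "(\<beta>, \<gamma>) \<in> set (z # L)" for \<beta> \<gamma>
    proof -
      have "mi_order \<beta> + mi_order \<gamma> = k"
        using Cons.prems that by blast
      then show ?thesis
        using k kdata_measurable[OF U, of \<beta>] kdata_measurable[OF V, of \<gamma>] by simp
    qed
    define g where "g x = (\<Sum>(\<beta>, \<gamma>)\<leftarrow>L. U \<beta> x * V \<gamma> x)" for x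
    have "(\<lambda>x. \<Sum>(\<beta>, \<gamma>)\<leftarrow>L'. U \<beta> x * V \<gamma> x) \<in> borel_measurable borel" if "set L' \<subseteq> set (z # L)" for L'
      using that by (induction L') (auto intro!: borel_measurable_add meas)
    then have [measurable]: "g \<in> borel_measurable borel"
      unfolding g_def by (meson set_subset_Cons)
    have [measurable]: "(\<lambda>x. U \<beta>\<^sub>0 x * V \<gamma>\<^sub>0 x) \<in> borel_measurable borel"
      by (rule meas) (simp add: z)
    have "(\<integral>\<^sup>+x. ennreal ((rho l x powr (real k - a\<^sub>1) * norm (\<Sum>(\<beta>, \<gamma>)\<leftarrow>z # L. U \<beta> x * V \<gamma> x)) powr t) \<partial>lborel)
        \<le> (\<integral>\<^sup>+x. ennreal (2 powr t) * (ennreal ((rho l x powr (real k - a\<^sub>1) * norm (U \<beta>\<^sub>0 x * V \<gamma>\<^sub>0 x)) powr t)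
             + ennreal ((rho l x powr (real k - a\<^sub>1) * norm (g x)) powr t)) \<partial>lborel)"
    proof (rule nn_integral_mono)
      fix x
      have "rho l x powr (real k - a\<^sub>1) * norm (\<Sum>(\<beta>, \<gamma>)\<leftarrow>z # L. U \<beta> x * V \<gamma> x)
          \<le> rho l x powr (real k - a\<^sub>1) * (norm (U \<beta>\<^sub>0 x * V \<gamma>\<^sub>0 x) + norm (g x))"
        by (intro mult_left_mono) (auto simp: z g_def norm_triangle_ineq)
      then have "(rho l x powr (real k - a\<^sub>1) * norm (\<Sum>(\<beta>, \<gamma>)\<leftarrow>z # L. U \<beta> x * V \<gamma> x)) powr t
          \<le> (rho l x powr (real k - a\<^sub>1) * norm (U \<beta>\<^sub>0 x * V \<gamma>\<^sub>0 x) + rho l x powr (real k - a\<^sub>1) * norm (g x)) powr t"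
        using t1 by (intro powr_mono2) (auto simp: distrib_left)
      also have "\<dots> \<le> 2 powr t * ((rho l x powr (real k - a\<^sub>1) * norm (U \<beta>\<^sub>0 x * V \<gamma>\<^sub>0 x)) powr t + (rho l x powr (real k - a\<^sub>1) * norm (g x)) powr t)"
        using t1 by (intro powr_add_le) auto
      finally have "ennreal ((rho l x powr (real k - a\<^sub>1) * norm (\<Sum>(\<beta>, \<gamma>)\<leftarrow>z # L. U \<beta> x * V \<gamma> x)) powr t)
          \<le> ennreal (2 powr t * ((rho l x powr (real k - a\<^sub>1) * norm (U \<beta>\<^sub>0 x * V \<gamma>\<^sub>0 x)) powr t + (rho l x powr (real k - a\<^sub>1) * norm (g x)) powr t))"
        by (rule ennreal_leI)
      also have "\<dots> = ennreal (2 powr t) * (ennreal ((rho l x powr (real k - a\<^sub>1) * norm (U \<beta>\<^sub>0 x * V \<gamma>\<^sub>0 x)) powr t)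
             + ennreal ((rho l x powr (real k - a\<^sub>1) * norm (g x)) powr t))"
        by (simp only: ennreal_mult ennreal_plus powr_ge_zero add_nonneg_nonneg)
      finally show "ennreal ((rho l x powr (real k - a\<^sub>1) * norm (\<Sum>(\<beta>, \<gamma>)\<leftarrow>z # L. U \<beta> x * V \<gamma> x)) powr t)
          \<le> ennreal (2 powr t) * (ennreal ((rho l x powr (real k - a\<^sub>1) * norm (U \<beta>\<^sub>0 x * V \<gamma>\<^sub>0 x)) powr t)
             + ennreal ((rho l x powr (real k - a\<^sub>1) * norm (g x)) powr t))" .
    qed
    also have "\<dots> = ennreal (2 powr t) * ((\<integral>\<^sup>+x. ennreal ((rho l x powr (real k - a\<^sub>1) * norm (U \<beta>\<^sub>0 x * V \<gamma>\<^sub>0 x)) powr t) \<partial>lborel)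
             + (\<integral>\<^sup>+x. ennreal ((rho l x powr (real k - a\<^sub>1) * norm (g x)) powr t) \<partial>lborel))"
      by (subst nn_integral_cmult, measurable, subst nn_integral_add, measurable)
    also have "\<dots> \<le> ennreal (2 powr t) * (C2 * (epowr A (t / p) * epowr B (t / p)) + C1 * (epowr A (t / p) * epowr B (t / p)))"
      using C1(2)[OF U V] C2(2)[OF U V] unfolding g_def by (intro mult_left_mono add_mono) auto
    also have "\<dots> = (ennreal (2 powr t) * (C2 + C1)) * (epowr A (t / p) * epowr B (t / p))"
      by (simp only: distrib_right mult.assoc)
    finally show ?thesis .
  qed
  moreover have "ennreal (2 powr t) * (C2 + C1) < top"
    using C1(1) C2(1) by (simp add: ennreal_mult_less_top)
  ultimately show ?case
    by blast
qed

section \<open>Return to the Kondratiev norms\<close>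

lemma repr_mult:
  fixes u v f g :: "'a::euclidean_space \<Rightarrow> 'b::{real_normed_algebra,banach,second_countable_topology}"
  assumes u: "repr \<Omega> u f" and v: "repr \<Omega> v g" and fg: "loc_int \<Omega> (\<lambda>x. f x * g x)"
  shows "repr \<Omega> (\<lambda>x. u x * v x) (\<lambda>x. f x * g x)"
  unfolding repr_def
proof (intro conjI fg)
  have eq: "indicator \<Omega> x *\<^sub>R (u x * v x) = (indicator \<Omega> x *\<^sub>R u x) * (indicator \<Omega> x *\<^sub>R v x)" for x
    by (simp split: split_indicator)
  show "(\<lambda>x. indicator \<Omega> x *\<^sub>R (u x * v x)) \<in> borel_measurable lebesgue"
    unfolding eq using u v unfolding repr_def by (intro borel_measurable_times) blast+
  have "AE x in lborel. x \<in> \<Omega> \<longrightarrow> u x = f x" "AE x in lborel. x \<in> \<Omega> \<longrightarrow> v x = g x"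
    using u v by (auto simp: repr_def)
  then show "AE x in lborel. x \<in> \<Omega> \<longrightarrow> u x * v x = f x * g x"
    by eventually_elim simp
qed

lemma repr_cong:
  assumes "repr \<Omega> w g" "loc_int \<Omega> h" "AE x in lborel. g x = h x"
  shows "repr \<Omega> w h"
proof -
  have "AE x in lborel. x \<in> \<Omega> \<longrightarrow> w x = g x"
    using assms(1) by (simp add: repr_def)
  then have "AE x in lborel. x \<in> \<Omega> \<longrightarrow> w x = h x"
    using assms(3) by eventually_elim simp
  then show ?thesis
    using assms(1,2) by (simp add: repr_def)
qed

text \<open>The integral of a nonnegative function is the same for a measure and its completion, and
  \<open>W \<alpha>\<close> vanishes on the singular set, so both the completion and the restriction
  of the domain disappear.\<close>

lemma kondratiev_integral_repr:
  fixes u :: "(real, 'n::{finite,linorder}) vec \<Rightarrow> 'b::{banach,second_countable_topology}"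
  assumes W: "\<And>\<alpha>. mi_order \<alpha> \<le> m \<Longrightarrow> repr (- singular_set l) (weak_deriv (- singular_set l) \<alpha> u) (W \<alpha>)"
  shows "kondratiev_integral l m a p u = (\<Sum>\<alpha> | mi_order \<alpha> \<le> m.
    \<integral>\<^sup>+x. ennreal ((rho l x powr (real (mi_order \<alpha>) - a) * norm (W \<alpha> x)) powr p) \<partial>lborel)"
  unfolding kondratiev_integral_def
proof (rule sum.cong[OF refl])
  fix \<alpha> :: "'n \<Rightarrow> nat" assume "\<alpha> \<in> {\<alpha>. mi_order \<alpha> \<le> m}"
  then have r: "repr (- singular_set l) (weak_deriv (- singular_set l) \<alpha> u) (W \<alpha>)"
    using W by simp
  have "AE x in lborel. ennreal (norm (rho l x powr (real (mi_order \<alpha>) - a) *\<^sub>R weak_deriv (- singular_set l) \<alpha> u x) powr p) * indicator (- singular_set l) x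
      = ennreal ((rho l x powr (real (mi_order \<alpha>) - a) * norm (W \<alpha> x)) powr p)"
  proof -
    have "AE x in lborel. x \<in> - singular_set l \<longrightarrow> weak_deriv (- singular_set l) \<alpha> u x = W \<alpha> x"
      using r by (simp add: repr_def)
    then show ?thesis
    proof eventually_elim
      case (elim x)
      then show ?case
        using r by (cases "x \<in> singular_set l") (auto simp: repr_def loc_int_def)
    qed
  qed
  then show "(\<integral>\<^sup>+x\<in>- singular_set l. ennreal (norm (rho l x powr (real (mi_order \<alpha>) - a) *\<^sub>R weak_deriv (- singular_set l) \<alpha> u x) powr p) \<partial>lebesgue)
      = (\<integral>\<^sup>+x. ennreal ((rho l x powr (real (mi_order \<alpha>) - a) * norm (W \<alpha> x)) powr p) \<partial>lborel)"
    unfolding nn_integral_completion by (rule nn_integral_cong_AE)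
qed

lemma weak_deriv_works: "has_weak_deriv \<Omega> \<alpha> u w \<Longrightarrow> has_weak_deriv \<Omega> \<alpha> u (weak_deriv \<Omega> \<alpha> u)"
  unfolding weak_deriv_def by (rule someI[of "has_weak_deriv \<Omega> \<alpha> u" w])

lemma kondratiev_space_kdata:
  fixes u :: "(real, 'n::{finite,linorder}) vec \<Rightarrow> complex"
  assumes u: "u \<in> kondratiev_space l m a p"
  obtains W where "repr (- singular_set l) u (W (\<lambda>_. 0))" "kdata l m a p W (kondratiev_integral l m a p u)"
proof -
  let ?\<Omega> = "- singular_set l :: (real, 'n) vec set"
  have has: "has_weak_deriv ?\<Omega> \<alpha> u (weak_deriv ?\<Omega> \<alpha> u)" if "mi_order \<alpha> \<le> m" for \<alpha>
    using u that weak_deriv_works unfolding kondratiev_space_def by blast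
  then have "locally_integrable ?\<Omega> u"
    using has[of "\<lambda>_. 0"] by (simp add: has_weak_deriv_def)
  then obtain F where F: "repr ?\<Omega> u F"
    using repr_exists[OF open_regular] by blast
  have "\<exists>W. mi_order \<alpha> \<le> m \<longrightarrow> repr ?\<Omega> (weak_deriv ?\<Omega> \<alpha> u) W" for \<alpha>
  proof (cases "mi_order \<alpha> \<le> m")
    case True
    then have "locally_integrable ?\<Omega> (weak_deriv ?\<Omega> \<alpha> u)"
      using has[of \<alpha>] by (simp add: has_weak_deriv_def)
    then show ?thesis
      using repr_exists[OF open_regular] by blast
  qed simp
  then obtain W where W: "\<And>\<alpha>. mi_order \<alpha> \<le> m \<Longrightarrow> repr ?\<Omega> (weak_deriv ?\<Omega> \<alpha> u) (W \<alpha>)"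
    by metis
  have wd: "weakd ?\<Omega> \<alpha> F (W \<alpha>)" if "mi_order \<alpha> \<le> m" for \<alpha>
    using has_weak_deriv_iff_weakd[OF F W[OF that]] has[OF that] by blast
  have F0: "weakd ?\<Omega> (\<lambda>_. 0) F F"
    using F by (intro weakd_zero) (simp add: repr_def)
  have "AE x in lborel. W (\<lambda>_. 0) x = F x"
    by (rule weakd_unique[OF open_regular wd F0]) simp
  then have "repr ?\<Omega> (weak_deriv ?\<Omega> (\<lambda>_. 0) u) F"
    using F by (intro repr_cong[OF W]) (auto simp: repr_def)
  \<comment> \<open>The chosen weak derivative of order 0 agrees with \<open>u\<close> only a.e.
    Overwriting its representative by \<open>F\<close> makes the base function of the family
    literally the one whose weak derivatives are known.\<close>
  define V where "V = W((\<lambda>_. 0) := F)"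
  have V: "repr ?\<Omega> (weak_deriv ?\<Omega> \<alpha> u) (V \<alpha>)" if "mi_order \<alpha> \<le> m" for \<alpha>
    using W[OF that] \<open>repr ?\<Omega> (weak_deriv ?\<Omega> (\<lambda>_. 0) u) F\<close> by (simp add: V_def)
  show ?thesis
  proof
    show "repr ?\<Omega> u (V (\<lambda>_. 0))"
      using F by (simp add: V_def)
    have eq: "kondratiev_integral l m a p u = (\<Sum>\<alpha> | mi_order \<alpha> \<le> m.
        \<integral>\<^sup>+x. ennreal ((rho l x powr (real (mi_order \<alpha>) - a) * norm (V \<alpha> x)) powr p) \<partial>lborel)"
      by (rule kondratiev_integral_repr[OF V])
    show "kdata l m a p V (kondratiev_integral l m a p u)"
      unfolding kdata_def
    proof (intro allI impI conjI)
      fix \<alpha> :: "'n \<Rightarrow> nat" assume \<alpha>: "mi_order \<alpha> \<le> m"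
      show "weakd ?\<Omega> \<alpha> (V (\<lambda>_. 0)) (V \<alpha>)"
        using wd[OF \<alpha>] F0 by (auto simp: V_def)
      show "(\<integral>\<^sup>+x. ennreal ((rho l x powr (real (mi_order \<alpha>) - a) * norm (V \<alpha> x)) powr p) \<partial>lborel) \<le> kondratiev_integral l m a p u"
        unfolding eq using \<alpha> finite_mi_order_le
        by (intro member_le_sum[where f="\<lambda>\<alpha>. \<integral>\<^sup>+x. ennreal ((rho l x powr (real (mi_order \<alpha>) - a) * norm (V \<alpha> x)) powr p) \<partial>lborel"]) auto
    qed
  qed
qed

theorem theorem37:
  fixes p a\<^sub>0 a\<^sub>1 t a1_tilde :: real and m l :: nat
  assumes "1 < p" and "1 \<le> m" and "l < CARD('n::{finite,linorder})"
    and "t = real CARD('n) / (2 * (real CARD('n) / p) - real m)"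
    and "a1_tilde = 2 * a\<^sub>0 - real m"
    and "2 * real CARD('n) * (1 / p - 1 / 2) < real m"
    and "real m < real CARD('n) / p"
    and "a\<^sub>1 < a1_tilde"
  shows "\<exists>c :: real.
    \<forall>u \<in> (kondratiev_space l m a\<^sub>0 p :: ((real, 'n) vec \<Rightarrow> complex) set).
    \<forall>v \<in> (kondratiev_space l m a\<^sub>0 p :: ((real, 'n) vec \<Rightarrow> complex) set).
      (\<lambda>x. u x * v x) \<in> kondratiev_space l m a\<^sub>1 t \<and>
      kondratiev_norm l m a\<^sub>1 t (\<lambda>x. u x * v x)
        \<le> c * kondratiev_norm l m a\<^sub>0 p u * kondratiev_norm l m a\<^sub>0 p v"
proof -
  let ?\<Omega> = "- singular_set l :: (real, 'n) vec set"
  note p = assms(1) and m = assms(7) and t = assms(4) assms(6)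
  have a: "a\<^sub>1 \<le> 2 * a\<^sub>0 - real m"
    using assms(5,8) by simp
  have t1: "1 < t"
    using exponent_pair(2)[OF p m _ t, of 0] by simp
  \<comment> \<open>Lists and constants are selected for every multi-index here, before
    \<open>u\<close> and \<open>v\<close> appear.\<close>
  define P where "P \<alpha> L \<longleftrightarrow> (\<forall>(\<beta>, \<gamma>)\<in>set L. mi_order \<beta> + mi_order \<gamma> = mi_order \<alpha>) \<and>
    (\<forall>(U :: ('n \<Rightarrow> nat) \<Rightarrow> (real, 'n) vec \<Rightarrow> complex) V A B. kdata l m a\<^sub>0 p U A \<and> A < top \<and> kdata l m a\<^sub>0 p V B \<and> B < top \<longrightarrow>
      weakd ?\<Omega> \<alpha> (\<lambda>x. U (\<lambda>_. 0) x * V (\<lambda>_. 0) x) (\<lambda>x. \<Sum>(\<beta>, \<gamma>)\<leftarrow>L. U \<beta> x * V \<gamma> x))"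
    for \<alpha> :: "'n \<Rightarrow> nat" and L
  have "\<exists>L. P \<alpha> L" if "mi_order \<alpha> \<le> m" for \<alpha>
    unfolding P_def by (rule Leibniz[OF p m t refl that])
  then obtain L where L: "\<And>\<alpha>. mi_order \<alpha> \<le> m \<Longrightarrow> P \<alpha> (L \<alpha>)"
    by metis
  define Q where "Q \<alpha> C \<longleftrightarrow> C < top \<and> (\<forall>(U :: ('n \<Rightarrow> nat) \<Rightarrow> (real, 'n) vec \<Rightarrow> complex) V A B.
    kdata l m a\<^sub>0 p U A \<longrightarrow> kdata l m a\<^sub>0 p V B \<longrightarrow>
    (\<integral>\<^sup>+x. ennreal ((rho l x powr (real (mi_order \<alpha>) - a\<^sub>1) * norm (\<Sum>(\<beta>, \<gamma>)\<leftarrow>L \<alpha>. U \<beta> x * V \<gamma> x)) powr t) \<partial>lborel)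
      \<le> C * (epowr A (t / p) * epowr B (t / p)))" for \<alpha> :: "'n \<Rightarrow> nat" and C
  have "\<exists>C. Q \<alpha> C" if \<alpha>: "mi_order \<alpha> \<le> m" for \<alpha>
    unfolding Q_def using L[OF \<alpha>] unfolding P_def by (intro Leibniz_estimate[OF p m t a \<alpha>]) blast
  then obtain C where C: "\<And>\<alpha>. mi_order \<alpha> \<le> m \<Longrightarrow> Q \<alpha> (C \<alpha>)"
    by metis
  \<comment> \<open>One constant for the whole sum over the multi-indices; its power
    \<open>1 / t\<close> becomes the constant of the norm inequality.\<close>
  define E where "E = (\<Sum>\<alpha> | mi_order \<alpha> \<le> m. C \<alpha>)"
  have "E < top"
  proof -
    have "C \<alpha> \<noteq> top" if "mi_order \<alpha> \<le> m" for \<alpha>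
      using C[OF that] by (auto simp: Q_def)
    then show ?thesis
      unfolding E_def less_top[symmetric] using finite_mi_order_le by (subst ennreal_sum_eq_top) auto
  qed
  then obtain e where e: "E = ennreal e" "0 \<le> e"
    by (cases E) auto
  have "(\<lambda>x. u x * v x) \<in> kondratiev_space l m a\<^sub>1 t \<and>
      kondratiev_norm l m a\<^sub>1 t (\<lambda>x. u x * v x)
        \<le> e powr (1 / t) * kondratiev_norm l m a\<^sub>0 p u * kondratiev_norm l m a\<^sub>0 p v"
    if u: "u \<in> kondratiev_space l m a\<^sub>0 p" and v: "v \<in> kondratiev_space l m a\<^sub>0 p"
    for u v :: "(real, 'n) vec \<Rightarrow> complex"
  proof -
    define A where "A = kondratiev_integral l m a\<^sub>0 p u"
    define B where "B = kondratiev_integral l m a\<^sub>0 p v"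
    have fin: "A < top" "B < top"
      using u v by (auto simp: A_def B_def kondratiev_space_def)
    obtain U where U: "repr ?\<Omega> u (U (\<lambda>_. 0))" "kdata l m a\<^sub>0 p U A"
      using kondratiev_space_kdata[OF u] unfolding A_def by blast
    obtain V where V: "repr ?\<Omega> v (V (\<lambda>_. 0))" "kdata l m a\<^sub>0 p V B"
      using kondratiev_space_kdata[OF v] unfolding B_def by blast
    define W where "W \<alpha> x = (\<Sum>(\<beta>, \<gamma>)\<leftarrow>L \<alpha>. U \<beta> x * V \<gamma> x)" for \<alpha> x
    have W: "weakd ?\<Omega> \<alpha> (\<lambda>x. U (\<lambda>_. 0) x * V (\<lambda>_. 0) x) (W \<alpha>)" if "mi_order \<alpha> \<le> m" for \<alpha>
      unfolding W_def[abs_def] using L[OF that] U(2) fin(1) V(2) fin(2) unfolding P_def by blast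
    \<comment> \<open>The case of order 0 of the Leibniz formula already contains the local
      integrability of the product.\<close>
    have uv: "repr ?\<Omega> (\<lambda>x. u x * v x) (\<lambda>x. U (\<lambda>_. 0) x * V (\<lambda>_. 0) x)"
      using W[of "\<lambda>_. 0"] by (intro repr_mult U V) (simp add: weakd_def)
    have has: "has_weak_deriv ?\<Omega> \<alpha> (\<lambda>x. u x * v x) (W \<alpha>)" if "mi_order \<alpha> \<le> m" for \<alpha>
    proof -
      have "repr ?\<Omega> (W \<alpha>) (W \<alpha>)"
        using W[OF that] by (intro repr_self open_regular) (simp add: weakd_def)
      then show ?thesis
        using has_weak_deriv_iff_weakd[OF uv] W[OF that] by blast
    qed
    \<comment> \<open>The norm refers to an arbitrarily chosen weak derivative of the product;
      uniqueness up to null sets identifies it with the Leibniz sum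
      \<open>W \<alpha>\<close>.\<close>
    have repr_W: "repr ?\<Omega> (weak_deriv ?\<Omega> \<alpha> (\<lambda>x. u x * v x)) (W \<alpha>)" if \<alpha>: "mi_order \<alpha> \<le> m" for \<alpha>
    proof -
      note hw = weak_deriv_works[OF has[OF \<alpha>]]
      then obtain G where G: "repr ?\<Omega> (weak_deriv ?\<Omega> \<alpha> (\<lambda>x. u x * v x)) G"
        using repr_exists[OF open_regular] unfolding has_weak_deriv_def by blast
      then have "weakd ?\<Omega> \<alpha> (\<lambda>x. U (\<lambda>_. 0) x * V (\<lambda>_. 0) x) G"
        using has_weak_deriv_iff_weakd[OF uv G] hw by blast
      then show ?thesis
        using W[OF \<alpha>] by (intro repr_cong[OF G] weakd_unique[OF open_regular _ W[OF \<alpha>]]) (auto simp: weakd_def)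
    qed
    have "kondratiev_integral l m a\<^sub>1 t (\<lambda>x. u x * v x) = (\<Sum>\<alpha> | mi_order \<alpha> \<le> m.
      \<integral>\<^sup>+x. ennreal ((rho l x powr (real (mi_order \<alpha>) - a\<^sub>1) * norm (W \<alpha> x)) powr t) \<partial>lborel)"
      by (rule kondratiev_integral_repr[OF repr_W])
    also have "\<dots> \<le> (\<Sum>\<alpha> | mi_order \<alpha> \<le> m. C \<alpha> * (epowr A (t / p) * epowr B (t / p)))"
      using C U(2) V(2) unfolding W_def Q_def by (intro sum_mono) blast
    also have "\<dots> = E * (epowr A (t / p) * epowr B (t / p))"
      by (simp add: E_def sum_distrib_right)
    finally have le: "kondratiev_integral l m a\<^sub>1 t (\<lambda>x. u x * v x) \<le> E * (epowr A (t / p) * epowr B (t / p))" .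
    obtain \<alpha> \<beta> where AB: "A = ennreal \<alpha>" "0 \<le> \<alpha>" "B = ennreal \<beta>" "0 \<le> \<beta>"
      using fin by (cases A; cases B) auto
    have le': "kondratiev_integral l m a\<^sub>1 t (\<lambda>x. u x * v x) \<le> ennreal (e * (\<alpha> powr (t / p) * \<beta> powr (t / p)))"
      using le AB e p t1 by (simp add: epowr_ennreal flip: ennreal_mult)
    then have finite: "kondratiev_integral l m a\<^sub>1 t (\<lambda>x. u x * v x) < top"
      by (rule le_less_trans) simp
    have "enn2real (kondratiev_integral l m a\<^sub>1 t (\<lambda>x. u x * v x)) \<le> e * (\<alpha> powr (t / p) * \<beta> powr (t / p))"
      using enn2real_mono[OF le'] e by simp
    then have "kondratiev_norm l m a\<^sub>1 t (\<lambda>x. u x * v x) \<le> (e * (\<alpha> powr (t / p) * \<beta> powr (t / p))) powr (1 / t)"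
      unfolding kondratiev_norm_def using t1 by (intro powr_mono2) auto
    \<comment> \<open>The exponents reduce by \<open>(t / p) * (1 / t) = 1 / p\<close>, which
      restores the norms of the two factors.\<close>
    also have "\<dots> = e powr (1 / t) * (\<alpha> powr (1 / p) * \<beta> powr (1 / p))"
      using e t1 by (simp add: powr_mult powr_powr)
    also have "\<dots> = e powr (1 / t) * kondratiev_norm l m a\<^sub>0 p u * kondratiev_norm l m a\<^sub>0 p v"
      unfolding kondratiev_norm_def A_def[symmetric] B_def[symmetric] using AB by simp
    finally have norm: "kondratiev_norm l m a\<^sub>1 t (\<lambda>x. u x * v x)
        \<le> e powr (1 / t) * kondratiev_norm l m a\<^sub>0 p u * kondratiev_norm l m a\<^sub>0 p v" .
    have "(\<lambda>x. u x * v x) \<in> borel_measurable (lebesgue_on ?\<Omega>)"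
      using u v by (auto simp: kondratiev_space_def)
    then have "(\<lambda>x. u x * v x) \<in> kondratiev_space l m a\<^sub>1 t"
      using has finite unfolding kondratiev_space_def by (auto simp: top.not_eq_extremum)
    with norm show ?thesis
      by blast
  qed
  then show ?thesis
    by blast
qed

end
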